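(* Let $(M,\mathcal L=\tfrac12L,\mathcal F,\mathcal D)$ be a conic pseudo-Finslerian mechanical system with non-holonomic constraint $\mathcal D$, where $L:\mathcal U\to\mathbb R$ is a conic pseudo-Finslerian metric on $M$, such that $\mathcal D_p$ is a nondegenerate subspace of $T_pM$ for each $p\in M$. Then there exists a unique reaction force $\mathcal R:\mathcal U\cap\mathcal D\to TM$ satisfying the d'Alembert principle.
   Context: Let $M$ be a smooth manifold, $\pi:TM\to M$ the projection, and $\mathcal U\subset TM\setminus 0$ an open set invariant under positive scalar multiplication. A conic pseudo-Finslerian metric is a smooth function $L:\mathcal U\to\mathbb R$ with $L(\lambda v)=\lambda^2L(v)$ for $\lambda>0$ whose fundamental tensor $g_v(u,w)=\tfrac12\frac{\partial^2}{\partial t\partial s}\big|_{t=s=0}L(v+tu+sw)$, $u,w\in T_{\pi(v)}M$, is nondegenerate for every $v\in\mathcal U$. An anisotropic vector field is a smooth map $X:\mathcal U\to TM$ with $X(v)\in T_{\pi(v)}M$. An anisotropic linear connection is a map $(v,X,Y)\in\mathcal U\times\mathfrak X(M)\times\mathfrak X(M)\mapsto\nabla^v_XY\in T_{\pi(v)}M$, with $v\mapsto \nabla^v_XY$ an anisotropic vector field, such that for each local vector field $V$ with values in $\mathcal U$, $\nabla^V$ is a linear connection on the domain of $V$. The Chern connection of $L$ is the unique anisotropic linear connection that is torsion-free ($\nabla^v_XY-\nabla^v_YX=[X,Y]$) and metric-compatible: $Xg_V(Y,Z)=g_V(\nabla^V_XY,Z)+g_V(Y,\nabla^V_XZ)+2C_V(Y,Z,\nabla^V_XV)$,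 where $C_v(u_1,u_2,u_3)=\tfrac12\frac{d}{dt}\big|_{t=0}g_{v+tu_1}(u_2,u_3)$. In coordinates put $\nabla^v_{\partial_i}\partial_j=\sum_k\Gamma^k_{ij}(v)\partial_k$. For a smooth curve $\gamma$ with $\gamma'\in\mathcal U$ ($\mathcal U$-admissible) and a vector field $X=\sum_kx_k\,\partial_k\circ\gamma$ along $\gamma$, $D^{\gamma'}_\gamma X=\sum_k\{x_k'+\sum_{ij}\Gamma^k_{ij}(\gamma')\gamma_i'x_j\}\partial_k$. A conic pseudo-Finslerian mechanical system is a triple $(M,\tfrac12L,\mathcal F)$ with $\mathcal F:\mathcal U\to TM$ an anisotropic vector field. A non-holonomic constraint is a smooth regular (constant rank) distribution $\mathcal D\subset TM$ on $M$. A curve $\gamma$ is compatible with $\mathcal D$ if $\gamma'(t)\in\mathcal D$ for all $t$. A subspace $E\subset T_pM$ is nondegenerate if $\mathcal U\cap E\ne\emptyset$ and $g_v|_{E\times E}$ is nondegenerate for every $v\in\mathcal U\cap E$. For $v\in\mathcal U\cap\mathcal D$, $\mathcal D_v^\perp=\{w\in T_{\pi(v)}M: g_v(w,u)=0\ \forall u\in\mathcal D_{\pi(v)}\}$. A reaction force is a map $\mathcal R:\mathcal U\cap\mathcal D\to TM$ with $\pi(\mathcal R(v))=\pi(v)$ such that for each $v\in\mathcal U\cap\mathcal D$ there is a $\mathcal U$-admissible curve $\gamma:I\to M$ with $\gamma'(0)=v$, compatible with $\mathcal D$, and solving $D^{\gamma'}_\gamma\gamma'=\mathcal F(\gamma')+\mathcal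 R(\gamma')$. It satisfies the d'Alembert principle if $\mathcal R(v)\in\mathcal D_v^\perp$ for each $v\in\mathcal U\cap\mathcal D$. *)

theory Defs
  imports "HOL-Analysis.Analysis" "HOL-Library.Function_Algebras"
begin

text \<open>
  Tangent vectors are modelled below as functions, with pointwise vector space operations.
\<close>

instantiation "fun" :: (type, real_vector) real_vector
begin

definition "r *\<^sub>R f = (\<lambda>x. r *\<^sub>R f x)"

instance
  by standard (auto simp: scaleR_fun_def fun_eq_iff scaleR_add_right scaleR_add_left)

end


section \<open>Smooth maps between open subsets of vector spaces\<close>

text \<open>
  For open \<open>S\<close> in a finite-dimensional space: \<open>f\<close> is \<open>n + 1\<close> times continuously differentiable
  iff it is differentiable and all its directional derivatives are \<open>n\<close> times
  continuously differentiable.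
\<close>

fun ck_on :: "nat \<Rightarrow> 'a::real_normed_vector set \<Rightarrow> ('a \<Rightarrow> 'b::real_normed_vector) \<Rightarrow> bool" where
  "ck_on 0 S f \<longleftrightarrow> continuous_on S f"
| "ck_on (Suc n) S f \<longleftrightarrow>
     (\<forall>x\<in>S. f differentiable (at x)) \<and> (\<forall>h. ck_on n S (\<lambda>x. frechet_derivative f (at x) h))"

definition smooth_on :: "'a::real_normed_vector set \<Rightarrow> ('a \<Rightarrow> 'b::real_normed_vector) \<Rightarrow> bool" where
  "smooth_on S f \<longleftrightarrow> (\<forall>n. ck_on n S f)"


section \<open>Smooth manifolds and their tangent bundle\<close>

text \<open>
  The manifold is a Hausdorff, second countable type \<open>'m\<close> together with an atlas \<open>A\<close>; a chart is
  a domain paired with a coordinate map, whose values off the domain are irrelevant.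
  The atlas need not be maximal: all notions below are
  unchanged if \<open>A\<close> is replaced by the maximal atlas it generates.
\<close>

type_synonym ('m, 'e) chart = "'m set \<times> ('m \<Rightarrow> 'e)"

definition cinv :: "('m, 'e) chart \<Rightarrow> 'e \<Rightarrow> 'm" where
  "cinv c = inv_into (fst c) (snd c)"

definition smooth_manifold ::
  "('m::{t2_space, second_countable_topology}, 'e::euclidean_space) chart set \<Rightarrow> bool" where
  "smooth_manifold A \<longleftrightarrow>
     (\<forall>c\<in>A. open (fst c) \<and> open (snd c ` fst c) \<and>
        homeomorphism (fst c) (snd c ` fst c) (snd c) (cinv c)) \<and>
     (\<Union>c\<in>A. fst c) = UNIV \<and>
     (\<forall>c\<in>A. \<forall>d\<in>A. smooth_on (snd c ` (fst c \<inter> fst d)) (snd d \<circ> cinv c))"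

text \<open>
  A tangent vector at \<open>p\<close> is the family of its component vectors with respect to all charts around
  \<open>p\<close>, related by the Jacobians of the transition maps (and, by convention, \<open>0\<close> at all other
  arguments).  The points of \<open>TM\<close> are pairs of a point and a tangent vector at
  it, so that \<open>fst\<close> is the projection.
\<close>

type_synonym ('m, 'e) tvec = "('m, 'e) chart \<Rightarrow> 'e"
type_synonym ('m, 'e) tpoint = "'m \<times> ('m, 'e) tvec"
type_synonym ('m, 'e) vfield = "'m \<Rightarrow> ('m, 'e) tvec"

definition jacobian ::
  "('m, 'e::euclidean_space) chart \<Rightarrow> ('m, 'e) chart \<Rightarrow> 'm \<Rightarrow> 'e \<Rightarrow> 'e" where
  "jacobian c d p = frechet_derivative (snd d \<circ> cinv c) (at (snd c p))"

definition tangent_space ::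
  "('m, 'e::euclidean_space) chart set \<Rightarrow> 'm \<Rightarrow> ('m, 'e) tvec set" where
  "tangent_space A p =
     {w. (\<forall>c. \<not> (c \<in> A \<and> p \<in> fst c) \<longrightarrow> w c = 0) \<and>
         (\<forall>c\<in>A. \<forall>d\<in>A. p \<in> fst c \<longrightarrow> p \<in> fst d \<longrightarrow> w d = jacobian c d p (w c))}"

definition tangent_bundle :: "('m, 'e::euclidean_space) chart set \<Rightarrow> ('m, 'e) tpoint set" where
  "tangent_bundle A = (SIGMA p:UNIV. tangent_space A p)"

text \<open>The tangent vector at \<open>p\<close> whose components with respect to the chart \<open>c\<close> are \<open>y\<close>.\<close>

definition tvec_of ::
  "('m, 'e::euclidean_space) chart set \<Rightarrow> ('m, 'e) chart \<Rightarrow> 'm \<Rightarrow> 'e \<Rightarrow> ('m, 'e) tvec" where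
  "tvec_of A c p y = (\<lambda>d. if d \<in> A \<and> p \<in> fst d then jacobian c d p y else 0)"

text \<open>
  The bundle chart of \<open>TM\<close> induced by \<open>c\<close>: the coordinate region occupied by a subset \<open>S\<close> of \<open>TM\<close>,
  and the inverse of the coordinate map.  Topology and smooth structure of \<open>TM\<close> are those given by
  these charts.
\<close>

definition bundle_coords :: "('m, 'e) chart \<Rightarrow> ('m, 'e) tpoint set \<Rightarrow> ('e \<times> 'e) set" where
  "bundle_coords c S = (\<lambda>v. (snd c (fst v), snd v c)) ` {v \<in> S. fst v \<in> fst c}"

definition bundle_point ::
  "('m, 'e::euclidean_space) chart set \<Rightarrow> ('m, 'e) chart \<Rightarrow> 'e \<times> 'e \<Rightarrow> ('m, 'e) tpoint" where
  "bundle_point A c z = (cinv c (fst z), tvec_of A c (cinv c (fst z)) (snd z))"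

definition open_in_tangent_bundle ::
  "('m, 'e::euclidean_space) chart set \<Rightarrow> ('m, 'e) tpoint set \<Rightarrow> bool" where
  "open_in_tangent_bundle A U \<longleftrightarrow>
     U \<subseteq> tangent_bundle A \<and> (\<forall>c\<in>A. open (bundle_coords c U))"

definition smooth_fun_on ::
  "('m, 'e::euclidean_space) chart set \<Rightarrow> 'm set \<Rightarrow> ('m \<Rightarrow> real) \<Rightarrow> bool" where
  "smooth_fun_on A W f \<longleftrightarrow> (\<forall>c\<in>A. smooth_on (snd c ` (W \<inter> fst c)) (f \<circ> cinv c))"

definition vfields_on ::
  "('m, 'e::euclidean_space) chart set \<Rightarrow> 'm set \<Rightarrow> ('m, 'e) vfield set" where
  "vfields_on A W =
     {X. (\<forall>p\<in>W. X p \<in> tangent_space A p) \<and>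
         (\<forall>c\<in>A. smooth_on (snd c ` (W \<inter> fst c)) (\<lambda>x. X (cinv c x) c))}"

abbreviation vfields :: "('m, 'e::euclidean_space) chart set \<Rightarrow> ('m, 'e) vfield set" where
  "vfields A \<equiv> vfields_on A UNIV"

text \<open>
  The derivative \<open>u(f)\<close> of a function along \<open>u\<close> tangent at \<open>p\<close>; for \<open>f\<close> smooth near \<open>p\<close> it does not
  depend on the choice of the chart.
\<close>

definition dir_deriv ::
  "('m, 'e::euclidean_space) chart set \<Rightarrow> 'm \<Rightarrow> ('m, 'e) tvec \<Rightarrow> ('m \<Rightarrow> real) \<Rightarrow> real" where
  "dir_deriv A p u f =
     (let c = (SOME c. c \<in> A \<and> p \<in> fst c)
      in frechet_derivative (f \<circ> cinv c) (at (snd c p)) (u c))"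

definition lie_bracket ::
  "('m, 'e::euclidean_space) chart set \<Rightarrow> ('m, 'e) vfield \<Rightarrow> ('m, 'e) vfield \<Rightarrow> ('m, 'e) vfield" where
  "lie_bracket A X Y p = (\<lambda>c.
     if c \<in> A \<and> p \<in> fst c
     then frechet_derivative (\<lambda>x. Y (cinv c x) c) (at (snd c p)) (X p c)
        - frechet_derivative (\<lambda>x. X (cinv c x) c) (at (snd c p)) (Y p c)
     else 0)"

text \<open>The coordinate vector field in the direction of \<open>i\<close>, a basis vector.\<close>

definition coord_field ::
  "('m, 'e::euclidean_space) chart set \<Rightarrow> ('m, 'e) chart \<Rightarrow> 'e \<Rightarrow> ('m, 'e) vfield" where
  "coord_field A c i p = tvec_of A c p i"


section \<open>Conic pseudo-Finslerian metrics\<close>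

text \<open>
  A map \<open>X : U \<rightarrow> TM\<close> with \<open>\<pi>(X(v)) = \<pi>(v)\<close> is represented by its fibre component, a map from \<open>U\<close>
  with \<open>X v \<in> T\<^bsub>\<pi>(v)\<^esub>M\<close>.
\<close>

definition anisotropic_vfield ::
  "('m, 'e::euclidean_space) chart set \<Rightarrow> ('m, 'e) tpoint set \<Rightarrow>
   (('m, 'e) tpoint \<Rightarrow> ('m, 'e) tvec) \<Rightarrow> bool" where
  "anisotropic_vfield A U X \<longleftrightarrow>
     (\<forall>v\<in>U. X v \<in> tangent_space A (fst v)) \<and>
     (\<forall>c\<in>A. smooth_on (bundle_coords c U) (\<lambda>z. X (bundle_point A c z) c))"

definition fundamental_tensor ::
  "(('m, 'e::euclidean_space) tpoint \<Rightarrow> real) \<Rightarrow> ('m, 'e) tpoint \<Rightarrow>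
   ('m, 'e) tvec \<Rightarrow> ('m, 'e) tvec \<Rightarrow> real" where
  "fundamental_tensor L v u w =
     1/2 * deriv (\<lambda>t. deriv (\<lambda>s. L (fst v, snd v + t *\<^sub>R u + s *\<^sub>R w)) 0) 0"

definition cartan_tensor ::
  "(('m, 'e::euclidean_space) tpoint \<Rightarrow> real) \<Rightarrow> ('m, 'e) tpoint \<Rightarrow>
   ('m, 'e) tvec \<Rightarrow> ('m, 'e) tvec \<Rightarrow> ('m, 'e) tvec \<Rightarrow> real" where
  "cartan_tensor L v u1 u2 u3 =
     1/2 * deriv (\<lambda>t. fundamental_tensor L (fst v, snd v + t *\<^sub>R u1) u2 u3) 0"

definition nondegenerate_on ::
  "('m, 'e) tvec set \<Rightarrow> (('m, 'e) tvec \<Rightarrow> ('m, 'e::euclidean_space) tvec \<Rightarrow> real) \<Rightarrow> bool" where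
  "nondegenerate_on E g \<longleftrightarrow> (\<forall>u\<in>E. (\<forall>w\<in>E. g u w = 0) \<longrightarrow> u = 0)"

definition conic_pseudo_finsler ::
  "('m, 'e::euclidean_space) chart set \<Rightarrow> ('m, 'e) tpoint set \<Rightarrow>
   (('m, 'e) tpoint \<Rightarrow> real) \<Rightarrow> bool" where
  "conic_pseudo_finsler A U L \<longleftrightarrow>
     open_in_tangent_bundle A U \<and>
     (\<forall>v\<in>U. snd v \<noteq> 0) \<and>
     (\<forall>v\<in>U. \<forall>r>0. (fst v, r *\<^sub>R snd v) \<in> U) \<and>
     (\<forall>c\<in>A. smooth_on (bundle_coords c U) (\<lambda>z. L (bundle_point A c z))) \<and>
     (\<forall>v\<in>U. \<forall>r>0. L (fst v, r *\<^sub>R snd v) = r\<^sup>2 * L v) \<and>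
     (\<forall>v\<in>U. nondegenerate_on (tangent_space A (fst v)) (fundamental_tensor L v))"


section \<open>Anisotropic connections and the Chern connection\<close>

definition linear_connection_on ::
  "('m, 'e::euclidean_space) chart set \<Rightarrow> 'm set \<Rightarrow>
   (('m, 'e) vfield \<Rightarrow> ('m, 'e) vfield \<Rightarrow> ('m, 'e) vfield) \<Rightarrow> bool" where
  "linear_connection_on A W N \<longleftrightarrow>
     (\<forall>X\<in>vfields_on A W. \<forall>Y\<in>vfields_on A W. N X Y \<in> vfields_on A W) \<and>
     (\<forall>X\<in>vfields_on A W. \<forall>Y\<in>vfields_on A W. \<forall>Z\<in>vfields_on A W. \<forall>p\<in>W.
        N (X + Y) Z p = N X Z p + N Y Z p \<and>
        N X (Y + Z) p = N X Y p + N X Z p) \<and>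
     (\<forall>f. smooth_fun_on A W f \<longrightarrow> (\<forall>X\<in>vfields_on A W. \<forall>Y\<in>vfields_on A W. \<forall>p\<in>W.
        N (\<lambda>q. f q *\<^sub>R X q) Y p = f p *\<^sub>R N X Y p \<and>
        N X (\<lambda>q. f q *\<^sub>R Y q) p = dir_deriv A p (X p) f *\<^sub>R Y p + f p *\<^sub>R N X Y p))"

type_synonym ('m, 'e) anconn =
  "('m, 'e) tpoint \<Rightarrow> ('m, 'e) vfield \<Rightarrow> ('m, 'e) vfield \<Rightarrow> ('m, 'e) tvec"

text \<open>
  \<open>nabla v X Y\<close> is \<open>\<nabla>\<^sup>v\<^sub>X Y\<close> for globally defined \<open>X\<close>, \<open>Y\<close>.  For a local field \<open>V\<close> on \<open>W\<close>, saying that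
  \<open>\<nabla>\<^sup>V\<close> is a linear connection on \<open>W\<close> means that it is the restriction to global fields of a linear
  connection \<open>N\<close> acting on the fields on \<open>W\<close> (as connections are local, \<open>N\<close> is unique).
\<close>

definition anisotropic_connection ::
  "('m::topological_space, 'e::euclidean_space) chart set \<Rightarrow> ('m, 'e) tpoint set \<Rightarrow>
   ('m, 'e) anconn \<Rightarrow> bool" where
  "anisotropic_connection A U nabla \<longleftrightarrow>
     (\<forall>X\<in>vfields A. \<forall>Y\<in>vfields A. anisotropic_vfield A U (\<lambda>v. nabla v X Y)) \<and>
     (\<forall>W V. open W \<and> V \<in> vfields_on A W \<and> (\<forall>p\<in>W. (p, V p) \<in> U) \<longrightarrow>
        (\<exists>N. linear_connection_on A W N \<and>
             (\<forall>X\<in>vfields A. \<forall>Y\<in>vfields A. \<forall>p\<in>W. nabla (p, V p) X Y = N X Y p)))"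

text \<open>
  \<open>\<nabla>\<^sup>v\<^sub>X Y\<close> for fields \<open>X\<close>, \<open>Y\<close> defined only near the base point of \<open>v\<close>: replace them by global
  fields with the same germs there.
\<close>

definition global_extension ::
  "('m::topological_space, 'e::euclidean_space) chart set \<Rightarrow> 'm \<Rightarrow> ('m, 'e) vfield \<Rightarrow>
   ('m, 'e) vfield" where
  "global_extension A p X =
     (SOME X'. X' \<in> vfields A \<and> (\<exists>W. open W \<and> p \<in> W \<and> (\<forall>q\<in>W. X' q = X q)))"

definition local_nabla ::
  "('m::topological_space, 'e::euclidean_space) chart set \<Rightarrow> ('m, 'e) anconn \<Rightarrow> ('m, 'e) anconn" where
  "local_nabla A nabla v X Y =
     nabla v (global_extension A (fst v) X) (global_extension A (fst v) Y)"

definition torsion_free ::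
  "('m, 'e::euclidean_space) chart set \<Rightarrow> ('m, 'e) tpoint set \<Rightarrow> ('m, 'e) anconn \<Rightarrow> bool" where
  "torsion_free A U nabla \<longleftrightarrow>
     (\<forall>v\<in>U. \<forall>X\<in>vfields A. \<forall>Y\<in>vfields A.
        nabla v X Y - nabla v Y X = lie_bracket A X Y (fst v))"

definition metric_compatible ::
  "('m::topological_space, 'e::euclidean_space) chart set \<Rightarrow> ('m, 'e) tpoint set \<Rightarrow>
   (('m, 'e) tpoint \<Rightarrow> real) \<Rightarrow> ('m, 'e) anconn \<Rightarrow> bool" where
  "metric_compatible A U L nabla \<longleftrightarrow>
     (\<forall>W V. open W \<and> V \<in> vfields_on A W \<and> (\<forall>p\<in>W. (p, V p) \<in> U) \<longrightarrow>
        (\<forall>X\<in>vfields_on A W. \<forall>Y\<in>vfields_on A W. \<forall>Z\<in>vfields_on A W. \<forall>p\<in>W.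
           dir_deriv A p (X p) (\<lambda>q. fundamental_tensor L (q, V q) (Y q) (Z q)) =
             fundamental_tensor L (p, V p) (local_nabla A nabla (p, V p) X Y) (Z p)
           + fundamental_tensor L (p, V p) (Y p) (local_nabla A nabla (p, V p) X Z)
           + 2 * cartan_tensor L (p, V p) (Y p) (Z p) (local_nabla A nabla (p, V p) X V)))"

definition chern_connection ::
  "('m::topological_space, 'e::euclidean_space) chart set \<Rightarrow> ('m, 'e) tpoint set \<Rightarrow>
   (('m, 'e) tpoint \<Rightarrow> real) \<Rightarrow> ('m, 'e) anconn \<Rightarrow> bool" where
  "chern_connection A U L nabla \<longleftrightarrow>
     anisotropic_connection A U nabla \<and> torsion_free A U nabla \<and> metric_compatible A U L nabla"

text \<open>
  The symbol \<open>\<Gamma>\<^sup>k\<^sub>i\<^sub>j(v)\<close> with respect to the chart \<open>c\<close>; the coordinate indices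
  \<open>i\<close>, \<open>j\<close>, \<open>k\<close> run through the basis vectors of the model space.
\<close>

definition christoffel ::
  "('m::topological_space, 'e::euclidean_space) chart set \<Rightarrow> ('m, 'e) anconn \<Rightarrow>
   ('m, 'e) chart \<Rightarrow> ('m, 'e) tpoint \<Rightarrow> 'e \<Rightarrow> 'e \<Rightarrow> 'e \<Rightarrow> real" where
  "christoffel A nabla c v i j k =
     local_nabla A nabla v (coord_field A c i) (coord_field A c j) c \<bullet> k"


section \<open>Curves\<close>

definition smooth_curve ::
  "('m::topological_space, 'e::euclidean_space) chart set \<Rightarrow> real set \<Rightarrow> (real \<Rightarrow> 'm) \<Rightarrow> bool" where
  "smooth_curve A I \<gamma> \<longleftrightarrow>
     open I \<and> is_interval I \<and> continuous_on I \<gamma> \<and>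
     (\<forall>c\<in>A. smooth_on {t \<in> I. \<gamma> t \<in> fst c} (snd c \<circ> \<gamma>))"

definition velocity ::
  "('m, 'e::euclidean_space) chart set \<Rightarrow> (real \<Rightarrow> 'm) \<Rightarrow> real \<Rightarrow> ('m, 'e) tvec" where
  "velocity A \<gamma> t =
     (\<lambda>c. if c \<in> A \<and> \<gamma> t \<in> fst c then vector_derivative (snd c \<circ> \<gamma>) (at t) else 0)"

abbreviation canonical_lift ::
  "('m, 'e::euclidean_space) chart set \<Rightarrow> (real \<Rightarrow> 'm) \<Rightarrow> real \<Rightarrow> ('m, 'e) tpoint" where
  "canonical_lift A \<gamma> t \<equiv> (\<gamma> t, velocity A \<gamma> t)"

definition admissible_curve ::
  "('m::topological_space, 'e::euclidean_space) chart set \<Rightarrow> ('m, 'e) tpoint set \<Rightarrow> real set \<Rightarrow>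
   (real \<Rightarrow> 'm) \<Rightarrow> bool" where
  "admissible_curve A U I \<gamma> \<longleftrightarrow>
     smooth_curve A I \<gamma> \<and> (\<forall>t\<in>I. canonical_lift A \<gamma> t \<in> U)"

text \<open>The covariant derivative at time \<open>t\<close> of a field \<open>X\<close> along \<open>\<gamma>\<close>, with reference vector \<open>\<gamma>'\<close>.\<close>

definition covariant_derivative ::
  "('m::topological_space, 'e::euclidean_space) chart set \<Rightarrow> ('m, 'e) anconn \<Rightarrow> (real \<Rightarrow> 'm) \<Rightarrow>
   (real \<Rightarrow> ('m, 'e) tvec) \<Rightarrow> real \<Rightarrow> ('m, 'e) tvec" where
  "covariant_derivative A nabla \<gamma> X t = (\<lambda>c.
     if c \<in> A \<and> \<gamma> t \<in> fst c
     then (\<Sum>k\<in>Basis.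
             (deriv (\<lambda>s. X s c \<bullet> k) t
              + (\<Sum>i\<in>Basis. \<Sum>j\<in>Basis.
                   christoffel A nabla c (canonical_lift A \<gamma> t) i j k
                   * (velocity A \<gamma> t c \<bullet> i) * (X t c \<bullet> j))) *\<^sub>R k)
     else 0)"


section \<open>Constraints and reaction forces\<close>

definition regular_distribution ::
  "('m::topological_space, 'e::euclidean_space) chart set \<Rightarrow> ('m \<Rightarrow> ('m, 'e) tvec set) \<Rightarrow> bool" where
  "regular_distribution A D \<longleftrightarrow>
     (\<exists>r. (\<forall>p. D p \<subseteq> tangent_space A p \<and> subspace (D p) \<and> dim (D p) = r) \<and>
          (\<forall>p. \<exists>W X. open W \<and> p \<in> W \<and> (\<forall>i<r. X i \<in> vfields_on A W) \<and>
                      (\<forall>q\<in>W. D q = span ((\<lambda>i::nat. X i q) ` {..<r}))))"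

definition compatible_curve ::
  "('m, 'e::euclidean_space) chart set \<Rightarrow> ('m \<Rightarrow> ('m, 'e) tvec set) \<Rightarrow> real set \<Rightarrow>
   (real \<Rightarrow> 'm) \<Rightarrow> bool" where
  "compatible_curve A D I \<gamma> \<longleftrightarrow> (\<forall>t\<in>I. velocity A \<gamma> t \<in> D (\<gamma> t))"

definition nondegenerate_subspace ::
  "('m, 'e::euclidean_space) tpoint set \<Rightarrow> (('m, 'e) tpoint \<Rightarrow> real) \<Rightarrow> 'm \<Rightarrow>
   ('m, 'e) tvec set \<Rightarrow> bool" where
  "nondegenerate_subspace U L p E \<longleftrightarrow>
     (\<exists>v\<in>E. (p, v) \<in> U) \<and>
     (\<forall>v\<in>E. (p, v) \<in> U \<longrightarrow> nondegenerate_on E (fundamental_tensor L (p, v)))"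

definition orth_complement ::
  "('m, 'e::euclidean_space) chart set \<Rightarrow> (('m, 'e) tpoint \<Rightarrow> real) \<Rightarrow>
   ('m \<Rightarrow> ('m, 'e) tvec set) \<Rightarrow> ('m, 'e) tpoint \<Rightarrow> ('m, 'e) tvec set" where
  "orth_complement A L D v =
     {w \<in> tangent_space A (fst v). \<forall>u\<in>D (fst v). fundamental_tensor L v w u = 0}"

definition mechanical_system ::
  "('m, 'e::euclidean_space) chart set \<Rightarrow> ('m, 'e) tpoint set \<Rightarrow> (('m, 'e) tpoint \<Rightarrow> real) \<Rightarrow>
   (('m, 'e) tpoint \<Rightarrow> ('m, 'e) tvec) \<Rightarrow> bool" where
  "mechanical_system A U L F \<longleftrightarrow> conic_pseudo_finsler A U L \<and> anisotropic_vfield A U F"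

text \<open>
  Here \<open>U \<inter> Sigma UNIV D\<close> is the set of the vectors of \<open>U\<close> that lie in \<open>D\<close>.  Reaction forces
  are extensional functions, so that equality means equality on this set.
\<close>

definition reaction_force ::
  "('m::topological_space, 'e::euclidean_space) chart set \<Rightarrow> ('m, 'e) tpoint set \<Rightarrow>
   ('m, 'e) anconn \<Rightarrow> (('m, 'e) tpoint \<Rightarrow> ('m, 'e) tvec) \<Rightarrow> ('m \<Rightarrow> ('m, 'e) tvec set) \<Rightarrow>
   (('m, 'e) tpoint \<Rightarrow> ('m, 'e) tvec) \<Rightarrow> bool" where
  "reaction_force A U nabla F D R \<longleftrightarrow>
     R \<in> (\<Pi>\<^sub>E v \<in> U \<inter> Sigma UNIV D. tangent_space A (fst v)) \<and>
     (\<forall>v \<in> U \<inter> Sigma UNIV D. \<exists>I \<gamma>.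
        0 \<in> I \<and> admissible_curve A U I \<gamma> \<and> canonical_lift A \<gamma> 0 = v \<and>
        compatible_curve A D I \<gamma> \<and>
        (\<forall>t\<in>I. covariant_derivative A nabla \<gamma> (velocity A \<gamma>) t =
                 F (canonical_lift A \<gamma> t) + R (canonical_lift A \<gamma> t)))"

definition dAlembert ::
  "('m, 'e::euclidean_space) chart set \<Rightarrow> ('m, 'e) tpoint set \<Rightarrow> (('m, 'e) tpoint \<Rightarrow> real) \<Rightarrow>
   ('m \<Rightarrow> ('m, 'e) tvec set) \<Rightarrow> (('m, 'e) tpoint \<Rightarrow> ('m, 'e) tvec) \<Rightarrow> bool" where
  "dAlembert A U L D R \<longleftrightarrow> (\<forall>v \<in> U \<inter> Sigma UNIV D. R v \<in> orth_complement A L D v)"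

end

theory Submission
  imports Defs
begin

text \<open>
  Two curves tangent to \<open>D\<close> with the same velocity \<open>v\<close> at some time have covariant accelerations that differ by an
  element of \<open>D\<close>: write both velocities in a local frame of \<open>D\<close> and differentiate.  Since
  \<open>D \<inter> D\<^sub>v\<^sup>\<bottom> = 0\<close>, at most one of these accelerations lies in \<open>F(v) + D\<^sub>v\<^sup>\<bottom>\<close>; this gives
  uniqueness, and it makes the reaction force well defined by any family of curves whose covariant acceleration lies
  in \<open>F + D\<^sup>\<bottom>\<close> at all times.  Such curves exist: their frame coefficients satisfy an ordinary differential
  equation, which can be solved for the highest derivatives since the Gram matrix of the frame with respect to the
  fundamental tensor is invertible.
\<close>

section \<open>Calculus of smooth maps\<close>

text \<open>A reaction force needs one solution curve through each vector and no regularity in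
  \<open>v\<close>. The curves can therefore be chosen independently of each other: differential
  equations are solved for a fixed initial value, and the solution has to be smooth in time only.
  Two Gram matrices occur. A given curve tangent to \<open>D\<close> has frame coefficients at each
  time, but nothing says that they vary differentiably; this comes from the Gram matrix of the frame
  for the Euclidean product of a chart, which is always definite. The Gram matrix for the
  fundamental tensor is invertible by hypothesis only at vectors of \<open>U\<close> lying in
  \<open>D\<close>. The equation is therefore posed for frame coefficients, so that every state has
  its velocity in \<open>D\<close>. The other obstacle is the dependence on choices:
  \<open>covariant_derivative\<close> is defined chart by chart, and \<open>local_nabla\<close>
  selects global extensions anew for each base point. A coordinate formula relative to a fixed
  family of global fields settles both points.\<close>

lemma ck_on_cong:
  fixes f g :: "'a::real_normed_vector \<Rightarrow> 'b::real_normed_vector"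
  assumes "open S" "\<And>x. x \<in> S \<Longrightarrow> f x = g x" "ck_on n S f"
  shows "ck_on n S g"
  using assms(2,3)
proof (induction n arbitrary: f g)
  case 0
  then show ?case
    by (metis ck_on.simps(1) continuous_on_cong)
next
  case (Suc n)
  have d: "(g has_derivative frechet_derivative f (at x)) (at x)" if "x \<in> S" for x
    using Suc.prems that assms(1) has_derivative_transform_within_open[of f _ x UNIV S g]
    by (simp add: frechet_derivative_works)
  have "ck_on n S (\<lambda>x. frechet_derivative g (at x) h)" for h
    by (rule Suc.IH[of "\<lambda>x. frechet_derivative f (at x) h"])
       (use Suc.prems(2) frechet_derivative_at[OF d] in simp_all)
  then show ?case
    using d differentiable_def by (simp, blast)
qed

text \<open>Since \<open>frechet_derivative\<close> is a choice operator, proofs of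
  differentiability go through this rule, where an explicit candidate derivative takes its
  place.\<close>

lemma ck_on_derivativeI:
  fixes f :: "'a::real_normed_vector \<Rightarrow> 'b::real_normed_vector"
  assumes "\<And>x. x \<in> S \<Longrightarrow> (f has_derivative f' x) (at x)" "\<And>h. ck_on n S (\<lambda>x. f' x h)" "open S"
  shows "ck_on (Suc n) S f"
proof -
  have "ck_on n S (\<lambda>x. frechet_derivative f (at x) h)" for h
    by (rule ck_on_cong[OF assms(3) _ assms(2)[of h]]) (use frechet_derivative_at[OF assms(1)] in simp)
  then show ?thesis
    using assms(1) differentiable_def by (simp, blast)
qed

lemma ck_on_subset: "ck_on n S f \<Longrightarrow> T \<subseteq> S \<Longrightarrow> ck_on n T f"
  by (induction n arbitrary: f) (auto intro: continuous_on_subset)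

lemma ck_on_SucD: "ck_on (Suc n) S f \<Longrightarrow> ck_on n S f"
proof (induction n arbitrary: f)
  case 0
  then show ?case
    by (auto intro!: continuous_at_imp_continuous_on differentiable_imp_continuous_within)
next
  case (Suc n)
  show ?case
    using Suc.prems Suc.IH by (subst ck_on.simps(2)) (metis ck_on.simps(2))
qed

lemma ck_on_local:
  assumes "\<And>x. x \<in> S \<Longrightarrow> \<exists>T. open T \<and> x \<in> T \<and> ck_on n T f"
  shows "ck_on n S f"
  using assms
proof (induction n arbitrary: f)
  case 0
  then show ?case
    by (fastforce simp: continuous_on_eq_continuous_at intro!: continuous_at_imp_continuous_on)
next
  case (Suc n)
  show ?case
    unfolding ck_on.simps
  proof (intro conjI ballI allI)
    show "f differentiable at x" if "x \<in> S" for x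
      using Suc.prems[OF that] by auto
    show "ck_on n S (\<lambda>x. frechet_derivative f (at x) h)" for h
    proof (rule Suc.IH)
      show "\<exists>T. open T \<and> x \<in> T \<and> ck_on n T (\<lambda>x. frechet_derivative f (at x) h)" if "x \<in> S" for x
        using Suc.prems[OF that] by auto
    qed
  qed
qed

lemma ck_on_const [simp]: "ck_on n S (\<lambda>x. c)"
  by (induction n arbitrary: c) (auto simp: frechet_derivative_const)

lemma ck_on_bounded_linear:
  assumes "bounded_linear L" "open S" "ck_on n S f"
  shows "ck_on n S (\<lambda>x. L (f x))"
  using assms(3)
proof (induction n arbitrary: f)
  case 0
  then show ?case
    by (auto intro: bounded_linear.continuous_on[OF assms(1)])
next
  case (Suc n)
  show ?case
    by (rule ck_on_derivativeI[where f' = "\<lambda>x h. L (frechet_derivative f (at x) h)"])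
       (use Suc assms(2) in \<open>auto intro!: bounded_linear.has_derivative[OF assms(1)]
          simp: frechet_derivative_works\<close>)
qed

lemma ck_on_add:
  assumes "open S" "ck_on n S f" "ck_on n S g"
  shows "ck_on n S (\<lambda>x. f x + g x)"
  using assms(2,3)
proof (induction n arbitrary: f g)
  case 0
  then show ?case by (auto intro: continuous_on_add)
next
  case (Suc n)
  show ?case
    by (rule ck_on_derivativeI[where f' =
          "\<lambda>x h. frechet_derivative f (at x) h + frechet_derivative g (at x) h"])
       (use Suc assms(1) in \<open>auto intro!: has_derivative_add simp: frechet_derivative_works\<close>)
qed

lemma ck_on_sum:
  assumes "open S" "\<And>i. i \<in> I \<Longrightarrow> ck_on n S (f i)"
  shows "ck_on n S (\<lambda>x. \<Sum>i\<in>I. f i x)"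
  using assms(2) by (induction I rule: infinite_finite_induct) (auto intro: ck_on_add assms(1))

lemma ck_on_bilinear:
  assumes "bounded_bilinear B" "open S" "ck_on n S f" "ck_on n S g"
  shows "ck_on n S (\<lambda>x. B (f x) (g x))"
  using assms(3,4)
proof (induction n arbitrary: f g)
  case 0
  then show ?case by (auto intro: bounded_bilinear.continuous_on[OF assms(1)])
next
  case (Suc n)
  have c: "ck_on n S f" "ck_on n S g"
    using Suc.prems ck_on_SucD by auto
  show ?case
    by (rule ck_on_derivativeI[where f' = "\<lambda>x h. B (f x) (frechet_derivative g (at x) h)
          + B (frechet_derivative f (at x) h) (g x)"])
       (use Suc assms(2) c in \<open>auto intro!: bounded_bilinear.FDERIV[OF assms(1)] ck_on_add
          simp: frechet_derivative_works\<close>)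
qed

lemma linear_expand:
  fixes f :: "'a::euclidean_space \<Rightarrow> 'b::real_vector"
  assumes "linear f"
  shows "f h = (\<Sum>b\<in>Basis. (h \<bullet> b) *\<^sub>R f b)"
proof -
  have "f h = f (\<Sum>b\<in>Basis. (h \<bullet> b) *\<^sub>R b)"
    by (simp only: euclidean_representation)
  also have "\<dots> = (\<Sum>b\<in>Basis. (h \<bullet> b) *\<^sub>R f b)"
    by (simp only: linear_sum[OF assms] linear_cmul[OF assms])
  finally show ?thesis .
qed

text \<open>The chain rule applies the derivative of \<open>g\<close> to a direction that moves with
  \<open>x\<close>, while \<open>ck_on\<close> controls fixed directions only. Expanding the
  direction in the basis leaves products with partial derivatives of \<open>g\<close> composed with
  \<open>f\<close>, to which the induction hypothesis applies because \<open>g\<close> is arbitrary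
  in it.\<close>

lemma ck_on_compose:
  fixes f :: "'a::real_normed_vector \<Rightarrow> 'b::euclidean_space" and g :: "'b \<Rightarrow> 'c::real_normed_vector"
  assumes "open S" "open T" "\<And>x. x \<in> S \<Longrightarrow> f x \<in> T" "ck_on n S f" "ck_on n T g"
  shows "ck_on n S (\<lambda>x. g (f x))"
  using assms(4,5)
proof (induction n arbitrary: g)
  case 0
  then show ?case
    using assms(3) by (auto intro: continuous_on_compose2)
next
  case (Suc n)
  have lin: "frechet_derivative g (at (f x)) h
      = (\<Sum>b\<in>Basis. (h \<bullet> b) *\<^sub>R frechet_derivative g (at (f x)) b)" if "x \<in> S" for x h
  proof -
    have "linear (frechet_derivative g (at (f x)))"
      using Suc.prems(2) assms(3)[OF that] by (auto intro: linear_frechet_derivative)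
    then show ?thesis
      by (rule linear_expand)
  qed
  have d: "((\<lambda>x. g (f x)) has_derivative
      (\<lambda>h. frechet_derivative g (at (f x)) (frechet_derivative f (at x) h))) (at x)" if "x \<in> S" for x
  proof -
    have "(f has_derivative frechet_derivative f (at x)) (at x)"
      using Suc.prems(1) that by (simp add: frechet_derivative_works)
    moreover have "(g has_derivative frechet_derivative g (at (f x))) (at (f x))"
      using Suc.prems(2) assms(3)[OF that] by (simp add: frechet_derivative_works)
    ultimately show ?thesis
      using diff_chain_at[of f _ x g] unfolding o_def by blast
  qed
  show ?case
  proof (rule ck_on_derivativeI[OF _ _ assms(1)])
    show "((\<lambda>x. g (f x)) has_derivative
      (\<lambda>h. \<Sum>b\<in>Basis. (frechet_derivative f (at x) h \<bullet> b) *\<^sub>R frechet_derivative g (at (f x)) b)) (at x)"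
      if "x \<in> S" for x
      by (rule has_derivative_eq_rhs[OF d[OF that]]) (rule ext, rule lin[OF that])
    show "ck_on n S (\<lambda>x. \<Sum>b\<in>Basis. (frechet_derivative f (at x) h \<bullet> b) *\<^sub>R frechet_derivative g (at (f x)) b)" for h
    proof (intro ck_on_sum ck_on_bilinear[OF bounded_bilinear_scaleR] assms(1))
      show "ck_on n S (\<lambda>x. frechet_derivative f (at x) h \<bullet> b)" for b
        using Suc.prems(1) by (auto intro!: ck_on_bounded_linear[OF bounded_linear_inner_left] assms(1))
      show "ck_on n S (\<lambda>x. frechet_derivative g (at (f x)) b)" for b
        using Suc.prems ck_on_SucD[OF Suc.prems(1)] by (intro Suc.IH) auto
    qed
  qed
qed

lemma ck_on_Pair:
  fixes f :: "'a::real_normed_vector \<Rightarrow> 'b::real_normed_vector" and g :: "'a \<Rightarrow> 'c::real_normed_vector"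
  assumes "open S" "ck_on n S f" "ck_on n S g"
  shows "ck_on n S (\<lambda>x. (f x, g x))"
proof -
  have "bounded_linear (\<lambda>y::'b. (y, 0::'c))" "bounded_linear (\<lambda>y::'c. (0::'b, y))"
    by (auto intro: bounded_linear_Pair bounded_linear_ident bounded_linear_zero)
  then have "ck_on n S (\<lambda>x. (f x, 0) + (0, g x))"
    using assms by (intro ck_on_add) (blast intro: ck_on_bounded_linear[of "\<lambda>y. (y, 0)" S n f]
        ck_on_bounded_linear[of "\<lambda>y. (0, y)" S n g])+
  then show ?thesis by simp
qed

lemma ck_on_ident [simp]: "open S \<Longrightarrow> ck_on n S (\<lambda>x. x)"
  by (cases n) (auto simp: continuous_on_id)

section \<open>Smoothness of all orders\<close>

lemma smooth_on_cong: "open S \<Longrightarrow> (\<And>x. x \<in> S \<Longrightarrow> f x = g x) \<Longrightarrow> smooth_on S f \<Longrightarrow> smooth_on S g"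
  unfolding smooth_on_def using ck_on_cong by blast

lemma smooth_on_subset: "smooth_on S f \<Longrightarrow> T \<subseteq> S \<Longrightarrow> smooth_on T f"
  unfolding smooth_on_def using ck_on_subset by blast

lemma smooth_on_local:
  "(\<And>x. x \<in> S \<Longrightarrow> \<exists>T. open T \<and> x \<in> T \<and> smooth_on T f) \<Longrightarrow> smooth_on S f"
  unfolding smooth_on_def by (meson ck_on_local)

lemma smooth_on_const [simp]: "smooth_on S (\<lambda>x. c)"
  by (simp add: smooth_on_def)

lemma smooth_on_ident [simp]: "open S \<Longrightarrow> smooth_on S (\<lambda>x. x)"
  by (simp add: smooth_on_def)

lemma smooth_on_bounded_linear:
  "bounded_linear L \<Longrightarrow> open S \<Longrightarrow> smooth_on S f \<Longrightarrow> smooth_on S (\<lambda>x. L (f x))"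
  by (simp add: smooth_on_def ck_on_bounded_linear)

lemma smooth_on_add: "open S \<Longrightarrow> smooth_on S f \<Longrightarrow> smooth_on S g \<Longrightarrow> smooth_on S (\<lambda>x. f x + g x)"
  by (simp add: smooth_on_def ck_on_add)

lemma smooth_on_minus: "open S \<Longrightarrow> smooth_on S f \<Longrightarrow> smooth_on S (\<lambda>x. - f x)"
  using smooth_on_bounded_linear[OF bounded_linear_minus[OF bounded_linear_ident]] by blast

lemma smooth_on_diff: "open S \<Longrightarrow> smooth_on S f \<Longrightarrow> smooth_on S g \<Longrightarrow> smooth_on S (\<lambda>x. f x - g x)"
  using smooth_on_add[of S f "\<lambda>x. - g x"] smooth_on_minus[of S g] by simp

lemma smooth_on_sum:
  "open S \<Longrightarrow> (\<And>i. i \<in> I \<Longrightarrow> smooth_on S (f i)) \<Longrightarrow> smooth_on S (\<lambda>x. \<Sum>i\<in>I. f i x)"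
  by (simp add: smooth_on_def ck_on_sum)

lemma smooth_on_bilinear:
  "bounded_bilinear B \<Longrightarrow> open S \<Longrightarrow> smooth_on S f \<Longrightarrow> smooth_on S g \<Longrightarrow> smooth_on S (\<lambda>x. B (f x) (g x))"
  by (simp add: smooth_on_def ck_on_bilinear)

lemmas smooth_on_scaleR = smooth_on_bilinear[OF bounded_bilinear_scaleR]
lemmas smooth_on_inner = smooth_on_bilinear[OF bounded_bilinear_inner]
lemmas smooth_on_mult = smooth_on_bilinear[OF bounded_bilinear_mult]
lemmas smooth_on_fst = smooth_on_bounded_linear[OF bounded_linear_fst]
lemmas smooth_on_snd = smooth_on_bounded_linear[OF bounded_linear_snd]

lemma smooth_on_Pair: "open S \<Longrightarrow> smooth_on S f \<Longrightarrow> smooth_on S g \<Longrightarrow> smooth_on S (\<lambda>x. (f x, g x))"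
  by (simp add: smooth_on_def ck_on_Pair)

lemma smooth_on_compose:
  fixes f :: "'a::real_normed_vector \<Rightarrow> 'b::euclidean_space"
  shows "smooth_on T g \<Longrightarrow> open S \<Longrightarrow> open T \<Longrightarrow> (\<And>x. x \<in> S \<Longrightarrow> f x \<in> T) \<Longrightarrow> smooth_on S f
    \<Longrightarrow> smooth_on S (\<lambda>x. g (f x))"
  unfolding smooth_on_def using ck_on_compose by blast

lemma smooth_on_continuous_on: "smooth_on S f \<Longrightarrow> continuous_on S f"
  unfolding smooth_on_def by (metis ck_on.simps(1))

lemma smooth_on_has_derivative:
  "smooth_on S f \<Longrightarrow> x \<in> S \<Longrightarrow> (f has_derivative frechet_derivative f (at x)) (at x)"
  unfolding smooth_on_def by (metis ck_on.simps(2) frechet_derivative_works)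

lemma smooth_on_frechet:
  "smooth_on S f \<Longrightarrow> smooth_on S (\<lambda>x. frechet_derivative f (at x) h)"
  unfolding smooth_on_def by (metis ck_on.simps(2))

lemma frechet_derivative_expand:
  fixes f :: "'a::euclidean_space \<Rightarrow> 'b::real_normed_vector"
  assumes "f differentiable at x"
  shows "frechet_derivative f (at x) h = (\<Sum>b\<in>Basis. (h \<bullet> b) *\<^sub>R frechet_derivative f (at x) b)"
proof -
  have "linear (frechet_derivative f (at x))"
    using assms linear_frechet_derivative by auto
  then show ?thesis
    by (rule linear_expand)
qed

lemma smooth_on_differentiable: "smooth_on S f \<Longrightarrow> x \<in> S \<Longrightarrow> f differentiable at x"
  using smooth_on_has_derivative differentiable_def by blast

text \<open>Both the base point and the direction move here; the basis expansion again reduces this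
  to fixed directions.\<close>

lemma smooth_on_frechet_apply:
  fixes f :: "'a::euclidean_space \<Rightarrow> 'b::real_normed_vector"
  assumes "smooth_on T f" "open S" "open T" "\<And>x. x \<in> S \<Longrightarrow> u x \<in> T" "smooth_on S u" "smooth_on S h"
  shows "smooth_on S (\<lambda>x. frechet_derivative f (at (u x)) (h x))"
proof -
  have "smooth_on S (\<lambda>x. \<Sum>b\<in>Basis. (h x \<bullet> b) *\<^sub>R frechet_derivative f (at (u x)) b)"
    by (intro smooth_on_sum smooth_on_scaleR smooth_on_inner assms smooth_on_const
        smooth_on_compose[OF smooth_on_frechet[OF assms(1)]])
  then show ?thesis
    by (rule smooth_on_cong[OF assms(2), rotated])
       (use assms(1,4) smooth_on_differentiable frechet_derivative_expand in metis)
qed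

text \<open>Bootstrap for differential equations: if \<open>f'\<close> is a smooth function of
  \<open>f\<close>, each order of differentiability of \<open>f\<close> passes to \<open>f'\<close>
  and thereby rises by one.\<close>

lemma smooth_on_realI:
  fixes f :: "real \<Rightarrow> 'b::real_normed_vector"
  assumes "open S" "\<And>n. ck_on n S f \<Longrightarrow> ck_on n S f'"
    "\<And>x. x \<in> S \<Longrightarrow> (f has_vector_derivative f' x) (at x)"
  shows "smooth_on S f"
proof -
  have "ck_on n S f" for n
  proof (induction n)
    case 0
    then show ?case
      using assms(1,3) by (auto intro!: continuous_at_imp_continuous_on has_vector_derivative_continuous)
  next
    case (Suc n)
    show ?case
      by (rule ck_on_derivativeI[where f' = "\<lambda>x h. h *\<^sub>R f' x"])
         (use assms Suc in \<open>auto simp: has_vector_derivative_def intro!: ck_on_bilinear[OF bounded_bilinear_scaleR]\<close>)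
  qed
  then show ?thesis by (simp add: smooth_on_def)
qed

section \<open>Linear systems depending smoothly on parameters\<close>

text \<open>Meant for the error \<open>e\<close> of a linear approximation, with \<open>E\<close>
  its image under an operator that is bounded below near \<open>z0\<close>.\<close>

lemma has_derivative_zero_dominated:
  fixes e :: "'a::real_normed_vector \<Rightarrow> 'b::real_normed_vector" and E :: "'a \<Rightarrow> 'c::real_normed_vector"
  assumes E: "(E has_derivative (\<lambda>h. 0)) (at z0)" "E z0 = 0"
    and ev: "eventually (\<lambda>z. norm (e z) \<le> C * norm (E z)) (at z0)" and e0: "e z0 = 0"
  shows "(e has_derivative (\<lambda>h. 0)) (at z0)"
proof -
  have "((\<lambda>z. norm (E z) / norm (z - z0)) \<longlongrightarrow> 0) (at z0)"
    using E by (simp add: has_derivative_iff_norm)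
  from tendsto_mult_right_zero[OF this, of C]
  have "((\<lambda>z. C * (norm (E z) / norm (z - z0))) \<longlongrightarrow> 0) (at z0)" .
  then have "((\<lambda>z. norm (e z) / norm (z - z0)) \<longlongrightarrow> 0) (at z0)"
  proof (rule Lim_null_comparison[rotated])
    show "eventually (\<lambda>z. norm (norm (e z) / norm (z - z0)) \<le> C * (norm (E z) / norm (z - z0))) (at z0)"
      using ev by eventually_elim (simp add: divide_right_mono)
  qed
  then show ?thesis
    using e0 by (simp add: has_derivative_iff_norm)
qed

text \<open>In finite dimension the injective map \<open>M z0\<close> expands norms by at least some
  \<open>B > 0\<close>. Near \<open>z0\<close> the operator norm of \<open>M z - M z0\<close>,
  estimated by the sum \<open>\<rho> z\<close> over the basis, is below \<open>B/2\<close>, which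
  leaves the bound \<open>B/2\<close> for \<open>M z\<close>.\<close>

lemma eventually_linear_bounded_below:
  fixes M :: "'a::t2_space \<Rightarrow> 'e::euclidean_space \<Rightarrow> 'e"
  assumes lin: "\<And>z. z \<in> S \<Longrightarrow> linear (M z)" and inj: "\<And>u. M z0 u = 0 \<Longrightarrow> u = 0"
    and S: "open S" "z0 \<in> S" and cont: "\<And>u. continuous_on S (\<lambda>z. M z u)"
  obtains C where "C > 0" "eventually (\<lambda>z. \<forall>u. norm u \<le> C * norm (M z u)) (at z0)"
proof -
  have "inj (M z0)"
    using inj lin[OF S(2)] linear_injective_0 by blast
  then obtain B where B: "B > 0" "\<And>x. B * norm x \<le> norm (M z0 x)"
    using linear_inj_bounded_below_pos[OF lin[OF S(2)]] by blast
  define \<rho> where "\<rho> z = (\<Sum>b\<in>Basis. norm (M z b - M z0 b))" for z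
  have "isCont (\<lambda>z. M z b) z0" for b
    using cont S continuous_on_eq_continuous_at by blast
  then have "isCont \<rho> z0"
    unfolding \<rho>_def by (intro continuous_intros) auto
  then have "(\<rho> \<longlongrightarrow> 0) (at z0)"
    by (auto simp: isCont_def \<rho>_def)
  then have "eventually (\<lambda>z. \<rho> z < B/2) (at z0)"
    using B(1) order_tendstoD(2)[of \<rho> 0 "at z0" "B/2"] by simp
  moreover have "eventually (\<lambda>z. z \<in> S) (at z0)"
    using S eventually_at_topological by blast
  ultimately have "eventually (\<lambda>z. \<forall>u. norm u \<le> (2/B) * norm (M z u)) (at z0)"
  proof eventually_elim
    case (elim z)
    show ?case
    proof
      fix u
      have "M z u - M z0 u = (\<Sum>b\<in>Basis. (u \<bullet> b) *\<^sub>R (M z b - M z0 b))"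
        by (subst linear_expand[OF lin[OF elim(2)]], subst linear_expand[OF lin[OF S(2)]])
           (simp add: sum_subtractf scaleR_diff_right)
      also have "norm \<dots> \<le> (\<Sum>b\<in>Basis. norm u * norm (M z b - M z0 b))"
        by (intro sum_norm_le) (auto intro!: mult_right_mono simp: Basis_le_norm)
      also have "\<dots> = norm u * \<rho> z"
        by (simp add: \<rho>_def sum_distrib_left)
      also have "\<dots> \<le> norm u * (B/2)"
        using elim(1) by (intro mult_left_mono) auto
      finally have "norm (M z0 u) \<le> norm (M z u) + norm u * (B/2)"
        using norm_triangle_sub[of "M z0 u" "M z u"] norm_minus_commute[of "M z u" "M z0 u"] by linarith
      with B(2)[of u] have "B/2 * norm u \<le> norm (M z u)"
        by (simp add: algebra_simps)
      then show "norm u \<le> (2/B) * norm (M z u)"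
        using B(1) by (simp add: field_simps)
    qed
  qed
  then show thesis
    using that[of "2/B"] B(1) by simp
qed

text \<open>Differentiating \<open>M y = \<eta>\<close> shows that each directional derivative of
  the solution solves the same system with a new right-hand side. Induction on the order, for all
  right-hand sides at once, then gives smoothness without a formula for the inverse matrix.\<close>

lemma linear_solve_smooth:
  fixes M :: "'a::euclidean_space \<Rightarrow> 'e::euclidean_space \<Rightarrow> 'e"
  assumes S: "open S" and lin: "\<And>z. z \<in> S \<Longrightarrow> linear (M z)"
    and inj: "\<And>z u. z \<in> S \<Longrightarrow> M z u = 0 \<Longrightarrow> u = 0"
    and M: "\<And>u. smooth_on S (\<lambda>z. M z u)" and \<eta>: "smooth_on S \<eta>"
  obtains y where "smooth_on S y" "\<And>z. z \<in> S \<Longrightarrow> M z (y z) = \<eta> z"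
proof -
  define Y where "Y \<eta> z = inv (M z) (\<eta> z)" for \<eta> :: "'a \<Rightarrow> 'e" and z
  have inj': "inj (M z)" if "z \<in> S" for z
    using inj lin that linear_injective_0 by blast
  have MY: "M z (Y \<eta> z) = \<eta> z" if "z \<in> S" for \<eta> z
    using linear_injective_imp_surjective[OF lin inj'] that by (simp add: Y_def surj_f_inv_f)
  have YM: "Y \<eta> z = u" if "z \<in> S" "M z u = \<eta> z" for \<eta> z u
    using that inj' MY by (metis injD)
  have bd: "\<exists>C>0. eventually (\<lambda>z. \<forall>u. norm u \<le> C * norm (M z u)) (at z0)" if "z0 \<in> S" for z0
    by (rule eventually_linear_bounded_below[of S M z0])
       (use lin inj S that smooth_on_continuous_on[OF M] in auto)
  have evS: "eventually (\<lambda>z. z \<in> S) (at z0)" if "z0 \<in> S" for z0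
    using S that eventually_at_topological by blast
  have contM: "isCont (\<lambda>z. M z u) z" if "z \<in> S" for z u
    using smooth_on_continuous_on[OF M] S that continuous_on_eq_continuous_at by blast
  have contY: "isCont (Y \<eta>) z0" if z0: "z0 \<in> S" and c: "isCont \<eta> z0" for \<eta> z0
  proof -
    obtain C where "C > 0" and ev: "eventually (\<lambda>z. \<forall>u. norm u \<le> C * norm (M z u)) (at z0)"
      using bd z0 by blast
    have "((\<lambda>z. C * norm (\<eta> z - M z (Y \<eta> z0))) \<longlongrightarrow> C * norm (\<eta> z0 - M z0 (Y \<eta> z0))) (at z0)"
      using c contM[OF z0] unfolding isCont_def by (intro tendsto_intros)
    then have "((\<lambda>z. C * norm (\<eta> z - M z (Y \<eta> z0))) \<longlongrightarrow> 0) (at z0)"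
      by (simp add: MY z0)
    then have "((\<lambda>z. Y \<eta> z - Y \<eta> z0) \<longlongrightarrow> 0) (at z0)"
    proof (rule Lim_null_comparison[rotated])
      show "eventually (\<lambda>z. norm (Y \<eta> z - Y \<eta> z0) \<le> C * norm (\<eta> z - M z (Y \<eta> z0))) (at z0)"
        using ev evS[OF z0]
      proof eventually_elim
        case (elim z)
        then show ?case
          using linear_diff[OF lin[OF elim(2)]] MY[OF elim(2)] by metis
      qed
    qed
    then show ?thesis
      by (simp add: isCont_def LIM_zero_iff)
  qed
  define dM where "dM u h z = frechet_derivative (\<lambda>z. M z u) (at z) h" for u h z
  \<comment> \<open>The right-hand side of the differentiated system: the derivative of
    \<open>\<eta>\<close> in direction \<open>h\<close> minus the derivative of \<open>M\<close> in
    direction \<open>h\<close>, applied to the solution.\<close>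
  define \<eta>d where "\<eta>d \<eta> h z = frechet_derivative \<eta> (at z) h
      - (\<Sum>b\<in>Basis. (Y \<eta> z \<bullet> b) *\<^sub>R dM b h z)" for \<eta> h z
  have dY: "(Y \<eta> has_derivative (\<lambda>h. Y (\<eta>d \<eta> h) z0)) (at z0)"
    if z0: "z0 \<in> S" and d: "\<eta> differentiable (at z0)" for \<eta> z0
  proof -
    \<comment> \<open>The increment of the solution computed with the matrix frozen at
      \<open>z0\<close>. The error of this approximation is mapped by \<open>M z\<close> to
      \<open>E z\<close>, that is to \<open>M z0 - M z\<close> applied to \<open>w z\<close>: a
      product of two factors vanishing at \<open>z0\<close>, hence of derivative zero there.\<close>
    define w where "w z = inv (M z0) (\<eta> z - M z (Y \<eta> z0))" for z
    define E where "E z = (\<Sum>b\<in>Basis. (w z \<bullet> b) *\<^sub>R (M z0 b - M z b))" for z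
    obtain C where "C > 0" and ev: "eventually (\<lambda>z. \<forall>u. norm u \<le> C * norm (M z u)) (at z0)"
      using bd z0 by blast
    have bl: "bounded_linear (inv (M z0))"
      using eucl.inj_linear_imp_inv_linear[OF lin[OF z0] inj'[OF z0]] by (simp add: linear_conv_bounded_linear)
    have sum_dM: "dM u h z0 = (\<Sum>b\<in>Basis. (u \<bullet> b) *\<^sub>R dM b h z0)" for u h
    proof -
      have "((\<lambda>z. \<Sum>b\<in>Basis. (u \<bullet> b) *\<^sub>R M z b) has_derivative (\<lambda>h. \<Sum>b\<in>Basis. (u \<bullet> b) *\<^sub>R dM b h z0)) (at z0)"
        unfolding dM_def by (intro derivative_intros smooth_on_has_derivative[OF M z0])
      then have "((\<lambda>z. M z u) has_derivative (\<lambda>h. \<Sum>b\<in>Basis. (u \<bullet> b) *\<^sub>R dM b h z0)) (at z0)"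
        by (rule has_derivative_transform_within_open[OF _ S z0]) (rule linear_expand[OF lin, symmetric])
      from frechet_derivative_at[OF this, symmetric] show ?thesis
        unfolding dM_def[of u] by (rule fun_cong)
    qed
    have "((\<lambda>z. \<eta> z - M z (Y \<eta> z0)) has_derivative (\<lambda>h. \<eta>d \<eta> h z0)) (at z0)"
    proof -
      have "((\<lambda>z. M z (Y \<eta> z0)) has_derivative (\<lambda>h. dM (Y \<eta> z0) h z0)) (at z0)"
        unfolding dM_def by (rule smooth_on_has_derivative[OF M z0])
      then show ?thesis
        unfolding \<eta>d_def sum_dM[of "Y \<eta> z0"]
        using d frechet_derivative_works by (intro has_derivative_diff) auto
    qed
    from bounded_linear.has_derivative[OF bl this]
    have w: "(w has_derivative (\<lambda>h. Y (\<eta>d \<eta> h) z0)) (at z0)"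
      unfolding w_def Y_def .
    have inv0: "inv (M z0) 0 = 0"
      using bl linear_0 linear_conv_bounded_linear by blast
    have w0: "w z0 = 0"
      by (simp add: w_def MY z0 inv0)
    have "((\<lambda>z. (w z \<bullet> b) *\<^sub>R (M z0 b - M z b)) has_derivative (\<lambda>h. 0)) (at z0)" for b
      by (rule has_derivative_eq_rhs[OF has_derivative_scaleR[OF has_derivative_inner_left[OF w]
              has_derivative_diff[OF has_derivative_const smooth_on_has_derivative[OF M z0]]]])
         (simp add: w0)
    then have E: "(E has_derivative (\<lambda>h. 0)) (at z0)"
      unfolding E_def using has_derivative_sum[of Basis _ "\<lambda>b h. 0"] by fastforce
    have "((\<lambda>z. Y \<eta> z - Y \<eta> z0 - w z) has_derivative (\<lambda>h. 0)) (at z0)"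
    proof (rule has_derivative_zero_dominated[OF E])
      show "eventually (\<lambda>z. norm (Y \<eta> z - Y \<eta> z0 - w z) \<le> C * norm (E z)) (at z0)"
        using ev evS[OF z0]
      proof eventually_elim
        case (elim z)
        have "M z0 (w z) = \<eta> z - M z (Y \<eta> z0)"
          using linear_injective_imp_surjective[OF lin inj'] z0 by (simp add: w_def surj_f_inv_f)
        moreover have "E z = M z0 (w z) - M z (w z)"
          unfolding E_def by (subst (2) linear_expand[OF lin[OF z0]], subst (2) linear_expand[OF lin[OF elim(2)]])
            (simp add: sum_subtractf scaleR_diff_right)
        ultimately have "M z (Y \<eta> z - Y \<eta> z0 - w z) = E z"
          by (simp add: linear_diff[OF lin[OF elim(2)]] MY elim(2))
        then show ?case
          using elim(1) by metis
      qed
    qed (auto simp: E_def w0)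
    from has_derivative_add[OF has_derivative_add[OF this w] has_derivative_const[of "Y \<eta> z0"]]
    show ?thesis by simp
  qed
  have "ck_on n S (Y \<eta>)" if "ck_on n S \<eta>" for n \<eta>
    using that
  proof (induction n arbitrary: \<eta>)
    case 0
    then show ?case
      using contY S by (auto simp: continuous_on_eq_continuous_at)
  next
    case (Suc n)
    show ?case
    proof (rule ck_on_derivativeI[OF _ _ S])
      show "(Y \<eta> has_derivative (\<lambda>h. Y (\<eta>d \<eta> h) z)) (at z)" if "z \<in> S" for z
        using dY[OF that] Suc.prems that by auto
      have Y: "ck_on n S (Y \<eta>)"
        using Suc.IH ck_on_SucD[OF Suc.prems] by blast
      have "ck_on n S (\<lambda>z. - (\<Sum>b\<in>Basis. (Y \<eta> z \<bullet> b) *\<^sub>R dM b h z))" for h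
        unfolding dM_def
        by (intro ck_on_bounded_linear[OF bounded_linear_minus[OF bounded_linear_ident]] S ck_on_sum
            ck_on_bilinear[OF bounded_bilinear_scaleR] ck_on_bounded_linear[OF bounded_linear_inner_left] Y)
           (use smooth_on_frechet[OF M] in \<open>auto simp: smooth_on_def\<close>)
      then have "ck_on n S (\<eta>d \<eta> h)" for h
        using ck_on_add[OF S, of n "\<lambda>z. frechet_derivative \<eta> (at z) h"] Suc.prems unfolding \<eta>d_def by fastforce
      then show "ck_on n S (\<lambda>z. Y (\<eta>d \<eta> h) z)" for h
        using Suc.IH by blast
    qed
  qed
  then show thesis
    using that[of "Y \<eta>"] MY \<eta> unfolding smooth_on_def by blast
qed

text \<open>The one-dimensional case of the preceding lemma: the quotient solves
  \<open>d x * y = f x\<close>.\<close>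

lemma smooth_on_divide:
  fixes f d :: "'a::euclidean_space \<Rightarrow> real"
  assumes "open S" "smooth_on S f" "smooth_on S d" "\<And>x. x \<in> S \<Longrightarrow> d x \<noteq> 0"
  shows "smooth_on S (\<lambda>x. f x / d x)"
proof -
  obtain y where y: "smooth_on S y" "\<And>z. z \<in> S \<Longrightarrow> d z * y z = f z"
  proof (rule linear_solve_smooth[of S "\<lambda>z u. d z * u" f])
    show "linear ((*) (d z))" for z
      by (rule linear_times)
    show "smooth_on S (\<lambda>z. d z * u)" for u
      by (rule smooth_on_mult[OF assms(1,3) smooth_on_const])
  qed (use assms in auto)
  show ?thesis
    by (rule smooth_on_cong[OF assms(1) _ y(1)]) (use y(2) assms(4) in \<open>auto simp: field_simps\<close>)
qed

text \<open>The matrix indexed by \<open>Bs\<close> is completed to an endomorphism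
  \<open>M z\<close> of the model space by the identity on the coordinates outside
  \<open>Bs\<close>. Nondegeneracy of the matrix then becomes injectivity of
  \<open>M z\<close>.\<close>

lemma gram_solve_smooth:
  fixes G :: "'a::euclidean_space \<Rightarrow> 'e::euclidean_space \<Rightarrow> 'e \<Rightarrow> real"
  assumes S: "open S" and Bs: "Bs \<subseteq> Basis"
    and G: "\<And>a b. a \<in> Bs \<Longrightarrow> b \<in> Bs \<Longrightarrow> smooth_on S (\<lambda>z. G z a b)"
    and \<eta>: "\<And>b. b \<in> Bs \<Longrightarrow> smooth_on S (\<lambda>z. \<eta> z b)"
    and nondeg: "\<And>z u. z \<in> S \<Longrightarrow> \<forall>b\<in>Bs. (\<Sum>a\<in>Bs. u a * G z a b) = 0 \<Longrightarrow> \<forall>a\<in>Bs. u a = 0"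
  obtains y :: "'a \<Rightarrow> 'e" where "smooth_on S y"
    "\<And>z b. z \<in> S \<Longrightarrow> b \<in> Bs \<Longrightarrow> (\<Sum>a\<in>Bs. (y z \<bullet> a) * G z a b) = \<eta> z b"
proof -
  define M :: "'a \<Rightarrow> 'e \<Rightarrow> 'e" where
    "M z u = (\<Sum>b\<in>Basis. (if b \<in> Bs then \<Sum>a\<in>Bs. (u \<bullet> a) * G z a b else u \<bullet> b) *\<^sub>R b)" for z u
  have M_inner: "M z u \<bullet> b = (if b \<in> Bs then \<Sum>a\<in>Bs. (u \<bullet> a) * G z a b else u \<bullet> b)" if "b \<in> Basis" for z u b
    using that by (simp add: M_def)
  obtain y where y: "smooth_on S y" "\<And>z. z \<in> S \<Longrightarrow> M z (y z) = (\<Sum>b\<in>Bs. \<eta> z b *\<^sub>R b)"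
  proof (rule linear_solve_smooth[OF S, of M "\<lambda>z. \<Sum>b\<in>Bs. \<eta> z b *\<^sub>R b"])
    show "linear (M z)" for z
      unfolding M_def
    proof (rule linearI)
      fix u v :: 'e and r :: real
      have "(if b \<in> Bs then \<Sum>a\<in>Bs. ((u + v) \<bullet> a) * G z a b else (u + v) \<bullet> b)
        = (if b \<in> Bs then \<Sum>a\<in>Bs. (u \<bullet> a) * G z a b else u \<bullet> b)
        + (if b \<in> Bs then \<Sum>a\<in>Bs. (v \<bullet> a) * G z a b else v \<bullet> b)" for b
        by (simp add: inner_add_left distrib_right sum.distrib)
      then show "(\<Sum>b\<in>Basis. (if b \<in> Bs then \<Sum>a\<in>Bs. ((u + v) \<bullet> a) * G z a b else (u + v) \<bullet> b) *\<^sub>R b)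
        = (\<Sum>b\<in>Basis. (if b \<in> Bs then \<Sum>a\<in>Bs. (u \<bullet> a) * G z a b else u \<bullet> b) *\<^sub>R b)
        + (\<Sum>b\<in>Basis. (if b \<in> Bs then \<Sum>a\<in>Bs. (v \<bullet> a) * G z a b else v \<bullet> b) *\<^sub>R b)"
        by (simp only: scaleR_add_left sum.distrib)
      have "(if b \<in> Bs then \<Sum>a\<in>Bs. ((r *\<^sub>R u) \<bullet> a) * G z a b else (r *\<^sub>R u) \<bullet> b)
        = r * (if b \<in> Bs then \<Sum>a\<in>Bs. (u \<bullet> a) * G z a b else u \<bullet> b)" for b
        by (simp add: sum_distrib_left mult.assoc)
      then show "(\<Sum>b\<in>Basis. (if b \<in> Bs then \<Sum>a\<in>Bs. ((r *\<^sub>R u) \<bullet> a) * G z a b else (r *\<^sub>R u) \<bullet> b) *\<^sub>R b)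
        = r *\<^sub>R (\<Sum>b\<in>Basis. (if b \<in> Bs then \<Sum>a\<in>Bs. (u \<bullet> a) * G z a b else u \<bullet> b) *\<^sub>R b)"
        by (simp only: scaleR_sum_right scaleR_scaleR)
    qed
    show "u = 0" if z: "z \<in> S" and 0: "M z u = 0" for z u
    proof -
      have c: "(if b \<in> Bs then \<Sum>a\<in>Bs. (u \<bullet> a) * G z a b else u \<bullet> b) = 0" if "b \<in> Basis" for b
        using M_inner[OF that, of z u] 0 by simp
      have "\<forall>a\<in>Bs. u \<bullet> a = 0"
        by (rule nondeg[OF z]) (metis c Bs subsetD)
      then have "u \<bullet> b = 0" if "b \<in> Basis" for b
        using c[OF that] by (auto split: if_splits)
      then show ?thesis using euclidean_all_zero_iff by blast
    qed
    show "smooth_on S (\<lambda>z. M z u)" for u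
      unfolding M_def
    proof (intro smooth_on_sum smooth_on_scaleR S smooth_on_const)
      show "smooth_on S (\<lambda>z. if b \<in> Bs then \<Sum>a\<in>Bs. (u \<bullet> a) * G z a b else u \<bullet> b)" for b
        by (cases "b \<in> Bs") (auto intro!: smooth_on_sum smooth_on_mult S G)
    qed
    show "smooth_on S (\<lambda>z. \<Sum>b\<in>Bs. \<eta> z b *\<^sub>R b)"
      using \<eta> by (auto intro!: smooth_on_sum smooth_on_scaleR S)
  qed blast
  show thesis
  proof (rule that[OF y(1)])
    fix z b assume z: "z \<in> S" and b: "b \<in> Bs"
    have "(\<Sum>a\<in>Bs. (y z \<bullet> a) * G z a b) = M z (y z) \<bullet> b"
      using M_inner[of b] b Bs by auto
    also have "\<dots> = (\<Sum>c\<in>Bs. \<eta> z c * (c \<bullet> b))"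
      by (simp add: y(2)[OF z] inner_sum_left)
    also have "\<dots> = (\<Sum>c\<in>Bs. if c = b then \<eta> z c else 0)"
      using b Bs by (intro sum.cong) (auto simp: inner_Basis subset_iff)
    also have "\<dots> = \<eta> z b"
      using b Bs finite_subset[OF Bs] by simp
    finally show "(\<Sum>a\<in>Bs. (y z \<bullet> a) * G z a b) = \<eta> z b" .
  qed
qed

section \<open>Bump functions\<close>

text \<open>The derivatives of \<open>exp (- (1/t))\<close> are combinations of these functions.\<close>

definition flat :: "nat \<Rightarrow> real \<Rightarrow> real" where
  "flat m t = (if t > 0 then (1/t)^m * exp (- (1/t)) else 0)"

lemma flat_tendsto_0: "(flat m \<longlongrightarrow> 0) (at 0)"
proof -
  have "((\<lambda>t::real. inverse t ^ m / exp (inverse t)) \<longlongrightarrow> 0) (at_right 0)"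
    by (rule filterlim_compose[OF tendsto_power_div_exp_0 filterlim_inverse_at_top_right])
  then have "(flat m \<longlongrightarrow> 0) (at_right 0)"
    by (rule Lim_transform_eventually)
       (auto simp: flat_def eventually_at_filter exp_minus divide_inverse)
  moreover have "(flat m \<longlongrightarrow> 0) (at_left 0)"
    by (rule Lim_transform_eventually[OF tendsto_const])
       (auto simp: flat_def eventually_at_filter)
  ultimately show ?thesis
    by (simp add: filterlim_split_at)
qed

lemma flat_has_derivative:
  "(flat m has_real_derivative flat (m + 2) t - real m * flat (m + 1) t) (at t)"
proof (cases t "0::real" rule: linorder_cases)
  case less
  have "((\<lambda>t. 0) has_real_derivative 0) (at t)" by simp
  then have "(flat m has_real_derivative 0) (at t)"
    by (rule has_field_derivative_transform_within_open[of _ _ _ "{..<0}"]) (use less in \<open>auto simp: flat_def\<close>)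
  then show ?thesis
    using less by (simp add: flat_def)
next
  case equal
  \<comment> \<open>Away from 0, the difference quotient of \<open>flat m\<close> at 0 is
    \<open>flat (m + 1)\<close>, whose limit is already known.\<close>
  have "((\<lambda>h. (flat m (0 + h) - flat m 0) / h) \<longlongrightarrow> 0) (at 0)"
    by (rule Lim_transform_eventually[OF flat_tendsto_0[of "m + 1"]])
       (auto simp: flat_def eventually_at_filter)
  then have "(flat m has_real_derivative 0) (at 0)"
    unfolding DERIV_def .
  then show ?thesis
    using equal by (simp add: flat_def)
next
  case greater
  have "((\<lambda>t. 1/t) has_real_derivative - ((1/t)^2)) (at t)"
    using greater by (auto intro!: derivative_eq_intros simp: power2_eq_square)
  note d = DERIV_mult[OF DERIV_power[OF this, of m] DERIV_chain2[OF DERIV_exp DERIV_minus[OF this]]]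
  \<comment> \<open>For \<open>m = 0\<close> the truncated exponent \<open>m - Suc 0\<close> does no
    harm, since the factor \<open>real m\<close> vanishes.\<close>
  have "real m * (- ((1/t)^2) * (1/t)^(m - Suc 0)) = - real m * (1/t)^(m + 1)"
    by (cases m) (simp_all add: power2_eq_square algebra_simps diff_divide_distrib add_divide_distrib)
  then have "((\<lambda>t. (1/t)^m * exp (- (1/t))) has_real_derivative flat (m + 2) t - real m * flat (m + 1) t) (at t)"
    using greater by (intro DERIV_cong[OF d]) (simp add: flat_def power2_eq_square algebra_simps)
  then show ?thesis
    by (rule has_field_derivative_transform_within_open[of _ _ _ "{0<..}"]) (use greater in \<open>auto simp: flat_def\<close>)
qed

lemma smooth_on_flat: "smooth_on UNIV (flat m)"
proof -
  have "ck_on n UNIV (flat m)" for n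
  proof (induction n arbitrary: m)
    case 0
    show ?case
      using flat_has_derivative by (auto intro!: continuous_at_imp_continuous_on intro: DERIV_isCont)
  next
    case (Suc n)
    show ?case
    proof (rule ck_on_derivativeI)
      show "(flat m has_derivative (\<lambda>h. h *\<^sub>R (flat (m + 2) t + (- real m) *\<^sub>R flat (m + 1) t))) (at t)" for t
        by (rule has_derivative_eq_rhs[OF flat_has_derivative[unfolded has_field_derivative_def]]) auto
      show "ck_on n UNIV (\<lambda>t. h *\<^sub>R (flat (m + 2) t + (- real m) *\<^sub>R flat (m + 1) t))" for h
        by (intro ck_on_bounded_linear[OF bounded_linear_scaleR_right] ck_on_add Suc open_UNIV)
    qed simp
  qed
  then show ?thesis by (simp add: smooth_on_def)
qed

text \<open>The squared distance \<open>s\<close> is used because, unlike the distance, it is smooth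
  at the centre. The quotient \<open>flat 0 (r\<^sup>2 - s) / (flat 0 (r\<^sup>2 - s) + flat 0 (s -
  (r/2)\<^sup>2))\<close> has a positive denominator, as its two terms vanish only for
  \<open>s \<ge> r\<^sup>2\<close> and for \<open>s \<le> (r/2)\<^sup>2\<close>.\<close>

lemma smooth_bump:
  fixes x0 :: "'a::euclidean_space"
  assumes "r > 0"
  obtains \<phi> :: "'a \<Rightarrow> real" where "smooth_on UNIV \<phi>" "\<And>x. x \<in> ball x0 (r/2) \<Longrightarrow> \<phi> x = 1"
    "\<And>x. x \<notin> ball x0 r \<Longrightarrow> \<phi> x = 0"
proof -
  define s where "s x = (x - x0) \<bullet> (x - x0)" for x
  have s: "s x = (dist x0 x)\<^sup>2" for x
    by (simp add: s_def dist_norm norm_minus_commute[of x0] power2_norm_eq_inner)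
  have sm: "smooth_on UNIV s"
    unfolding s_def by (intro smooth_on_inner smooth_on_diff) auto
  have pos: "flat 0 t > 0" if "t > 0" for t using that by (simp add: flat_def)
  have nn: "flat 0 t \<ge> 0" for t by (simp add: flat_def)
  have z: "flat 0 t = 0" if "t \<le> 0" for t using that by (simp add: flat_def)
  have den: "flat 0 (r\<^sup>2 - s x) + flat 0 (s x - (r/2)\<^sup>2) > 0" for x
  proof (cases "s x < r\<^sup>2")
    case True
    then show ?thesis using pos[of "r\<^sup>2 - s x"] nn[of "s x - (r/2)\<^sup>2"] by simp
  next
    case False
    moreover have "(r/2)\<^sup>2 < r\<^sup>2" using assms by (simp add: power2_eq_square)
    ultimately show ?thesis using pos[of "s x - (r/2)\<^sup>2"] nn[of "r\<^sup>2 - s x"] by simp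
  qed
  define \<phi> where "\<phi> x = flat 0 (r\<^sup>2 - s x) / (flat 0 (r\<^sup>2 - s x) + flat 0 (s x - (r/2)\<^sup>2))" for x
  show thesis
  proof
    have f: "smooth_on UNIV (\<lambda>x. flat 0 (u x))" if "smooth_on UNIV u" for u :: "'a \<Rightarrow> real"
      by (rule smooth_on_compose[OF smooth_on_flat]) (use that in auto)
    show "smooth_on UNIV \<phi>"
      unfolding \<phi>_def
    proof (rule smooth_on_divide)
      have "smooth_on UNIV (\<lambda>x. flat 0 (r\<^sup>2 - s x))" "smooth_on UNIV (\<lambda>x. flat 0 (s x - (r/2)\<^sup>2))"
        by (rule f, rule smooth_on_diff; simp add: sm)+
      then show "smooth_on UNIV (\<lambda>x. flat 0 (r\<^sup>2 - s x))"
        "smooth_on UNIV (\<lambda>x. flat 0 (r\<^sup>2 - s x) + flat 0 (s x - (r/2)\<^sup>2))"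
        by (simp_all add: smooth_on_add)
      show "flat 0 (r\<^sup>2 - s x) + flat 0 (s x - (r/2)\<^sup>2) \<noteq> 0" for x
        using den[of x] by simp
    qed simp
    show "\<phi> x = 1" if "x \<in> ball x0 (r/2)" for x
    proof -
      have "s x \<le> (r/2)\<^sup>2"
        using that assms by (simp add: s abs_le_square_iff[symmetric])
      then show ?thesis using z[of "s x - (r/2)\<^sup>2"] den[of x] by (simp add: \<phi>_def)
    qed
    show "\<phi> x = 0" if "x \<notin> ball x0 r" for x
    proof -
      have "r\<^sup>2 \<le> s x"
        using that assms by (simp add: s abs_le_square_iff[symmetric])
      then show ?thesis using z[of "r\<^sup>2 - s x"] by (simp add: \<phi>_def)
    qed
  qed
qed

section \<open>Ordinary differential equations\<close>

lemma smooth_on_lipschitz_cball: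
  fixes G :: "'a::euclidean_space \<Rightarrow> 'b::real_normed_vector"
  assumes G: "smooth_on \<Omega> G" and sub: "cball z0 \<delta> \<subseteq> \<Omega>"
  obtains K where "K > 0" "\<And>x y. x \<in> cball z0 \<delta> \<Longrightarrow> y \<in> cball z0 \<delta> \<Longrightarrow> norm (G x - G y) \<le> K * norm (x - y)"
proof -
  have "\<exists>C. \<forall>x\<in>cball z0 \<delta>. norm (frechet_derivative G (at x) b) \<le> C" for b
  proof -
    have "continuous_on (cball z0 \<delta>) (\<lambda>x. frechet_derivative G (at x) b)"
      using smooth_on_continuous_on[OF smooth_on_frechet[OF G]] continuous_on_subset sub by blast
    then have "bounded ((\<lambda>x. frechet_derivative G (at x) b) ` cball z0 \<delta>)"
      by (intro compact_imp_bounded compact_continuous_image compact_cball)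
    then show ?thesis by (auto simp: bounded_iff)
  qed
  then obtain C where C: "\<And>b x. x \<in> cball z0 \<delta> \<Longrightarrow> norm (frechet_derivative G (at x) b) \<le> C b"
    by metis
  \<comment> \<open>The summand 1 keeps \<open>K\<close> positive, so that it can serve as a
    denominator in the choice of the time interval.\<close>
  define K where "K = \<bar>\<Sum>b\<in>Basis. C b\<bar> + 1"
  show thesis
  proof
    show "K > 0" by (simp add: K_def)
    fix x y assume xy: "x \<in> cball z0 \<delta>" "y \<in> cball z0 \<delta>"
    show "norm (G x - G y) \<le> K * norm (x - y)"
    proof (rule differentiable_bound[OF convex_cball _ _ xy])
      show "(G has_derivative frechet_derivative G (at x)) (at x within cball z0 \<delta>)" if "x \<in> cball z0 \<delta>" for x
        using smooth_on_has_derivative[OF G] sub that by (blast intro: has_derivative_at_withinI)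
      show "onorm (frechet_derivative G (at x)) \<le> K" if x: "x \<in> cball z0 \<delta>" for x
      proof (rule onorm_le)
        fix h
        have "frechet_derivative G (at x) h = (\<Sum>b\<in>Basis. (h \<bullet> b) *\<^sub>R frechet_derivative G (at x) b)"
          using x sub by (intro frechet_derivative_expand smooth_on_differentiable[OF G]) auto
        also have "norm \<dots> \<le> (\<Sum>b\<in>Basis. norm h * C b)"
          by (intro sum_norm_le) (auto intro!: mult_mono C[OF x] Basis_le_norm)
        also have "\<dots> = (\<Sum>b\<in>Basis. C b) * norm h"
          by (simp add: sum_distrib_left mult.commute)
        also have "\<dots> \<le> K * norm h"
          by (intro mult_right_mono) (auto simp: K_def)
        finally show "norm (frechet_derivative G (at x) h) \<le> K * norm h" .
      qed
    qed
  qed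
qed

text \<open>Banach's fixed point theorem for the integral operator \<open>P\<close>. Writing the
  integral from 0 to \<open>t\<close> as a difference of integrals from \<open>-e\<close> treats
  both signs of \<open>t\<close> alike. Each of these two integrals contributes at most
  \<open>2 * e * K\<close> to the Lipschitz constant, whence
  \<open>4 * e * K \<le> 1/2\<close>.\<close>

lemma picard_lindelof_lipschitz:
  fixes H :: "'a::euclidean_space \<Rightarrow> 'a"
  assumes K: "K > 0" "\<And>x y. norm (H x - H y) \<le> K * norm (x - y)" and e: "e > 0" "4 * e * K \<le> 1/2"
  obtains z where "z 0 = z0" "continuous_on {-e..e} z"
    "\<And>t. t \<in> {-e..e} \<Longrightarrow> z t = z0 + (integral {-e..t} (\<lambda>s. H (z s)) - integral {-e..0} (\<lambda>s. H (z s)))"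
proof -
  have contH: "continuous_on UNIV H"
    using K(1) K(2) by (intro lipschitz_on_continuous_on[of K] lipschitz_onI) (auto simp: dist_norm)
  \<comment> \<open>The complete space at hand consists of bounded continuous functions on the whole
    line, so times are clamped to \<open>{-e..e}\<close>; \<open>P f\<close> is then constant beyond
    the endpoints and bounded.\<close>
  define cl where "cl t = max (-e) (min e t)" for t
  have cl: "cl t \<in> {-e..e}" "t \<in> {-e..e} \<Longrightarrow> cl t = t" for t
    using e by (auto simp: cl_def)
  have contHf: "continuous_on T (\<lambda>s. H (apply_bcontfun f s))" for f :: "real \<Rightarrow>\<^sub>C 'a" and T
    by (rule continuous_on_compose2[OF contH]) auto
  define P where "P f t = z0 + (integral {-e..cl t} (\<lambda>s. H (apply_bcontfun f s))
      - integral {-e..0} (\<lambda>s. H (apply_bcontfun f s)))" for f :: "real \<Rightarrow>\<^sub>C 'a" and t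
  have contI: "continuous_on {-e..e} (\<lambda>t. integral {-e..t} (\<lambda>s. H (apply_bcontfun f s)))" for f :: "real \<Rightarrow>\<^sub>C 'a"
    by (intro indefinite_integral_continuous_1 integrable_continuous_interval contHf)
  have contP: "continuous_on UNIV (P f)" for f
    unfolding P_def
    by (intro continuous_intros continuous_on_compose2[OF contI]) (use cl in \<open>auto simp: cl_def intro!: continuous_intros\<close>)
  have "bounded (range (P f))" for f
  proof -
    have "bounded (P f ` {-e..e})"
      by (intro compact_imp_bounded compact_continuous_image continuous_on_subset[OF contP]) auto
    moreover have "range (P f) \<subseteq> P f ` {-e..e}"
    proof
      fix y assume "y \<in> range (P f)"
      then obtain t where "y = P f t" by auto
      then have "y = P f (cl t)" using cl by (simp add: P_def)
      then show "y \<in> P f ` {-e..e}" using cl by blast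
    qed
    ultimately show ?thesis using bounded_subset by blast
  qed
  then have apP: "apply_bcontfun (Bcontfun (P f)) = P f" for f
    using contP by (intro Bcontfun_inverse) (auto simp: bcontfun_def)
  have "dist (Bcontfun (P f)) (Bcontfun (P g)) \<le> 1/2 * dist f g" for f g
  proof (rule dist_bound)
    fix t
    have I: "norm (integral {-e..r} (\<lambda>s. H (apply_bcontfun f s)) - integral {-e..r} (\<lambda>s. H (apply_bcontfun g s)))
        \<le> 2 * e * K * dist f g" if r: "r \<in> {-e..e}" for r
    proof -
      have "integral {-e..r} (\<lambda>s. H (apply_bcontfun f s)) - integral {-e..r} (\<lambda>s. H (apply_bcontfun g s))
          = integral {-e..r} (\<lambda>s. H (apply_bcontfun f s) - H (apply_bcontfun g s))"
        by (intro integral_diff[symmetric] integrable_continuous_interval contHf)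
      also have "norm \<dots> \<le> (K * dist f g) * (r - (-e))"
      proof (rule integral_bound)
        show "continuous_on {-e..r} (\<lambda>s. H (apply_bcontfun f s) - H (apply_bcontfun g s))"
          by (intro continuous_on_diff contHf)
        show "norm (H (apply_bcontfun f s) - H (apply_bcontfun g s)) \<le> K * dist f g" for s
          using K(2)[of "apply_bcontfun f s" "apply_bcontfun g s"]
            mult_left_mono[OF dist_bounded[of f s g] less_imp_le[OF K(1)]] by (simp add: dist_norm)
      qed (use r in auto)
      also have "\<dots> \<le> (K * dist f g) * (2 * e)"
        using r K(1) by (intro mult_left_mono) auto
      finally show ?thesis by (simp add: mult_ac)
    qed
    have "dist (P f t) (P g t) \<le> 2 * e * K * dist f g + 2 * e * K * dist f g"
    proof -
      have "P f t - P g t = (integral {-e..cl t} (\<lambda>s. H (apply_bcontfun f s)) - integral {-e..cl t} (\<lambda>s. H (apply_bcontfun g s)))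
          - (integral {-e..0} (\<lambda>s. H (apply_bcontfun f s)) - integral {-e..0} (\<lambda>s. H (apply_bcontfun g s)))"
        by (simp add: P_def)
      also have "norm \<dots> \<le> 2 * e * K * dist f g + 2 * e * K * dist f g"
        using e cl by (intro norm_triangle_le_diff add_mono I) auto
      finally show ?thesis by (simp add: dist_norm)
    qed
    also have "\<dots> = (4 * e * K) * dist f g" by simp
    also have "\<dots> \<le> 1/2 * dist f g"
      using e by (intro mult_right_mono) auto
    finally show "dist (apply_bcontfun (Bcontfun (P f)) t) (apply_bcontfun (Bcontfun (P g)) t) \<le> 1/2 * dist f g"
      by (simp add: apP)
  qed
  then have "\<exists>!f. Bcontfun (P f) = f"
    by (intro banach_fix_type[where c = "1/2"] allI) (assumption | simp)+
  then obtain f where "Bcontfun (P f) = f"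
    by blast
  then have f: "apply_bcontfun f = P f"
    using apP[of f] by simp
  show thesis
  proof
    show "apply_bcontfun f 0 = z0"
      using cl(2)[of 0] e by (subst f) (simp add: P_def)
    show "apply_bcontfun f t = z0 + (integral {-e..t} (\<lambda>s. H (apply_bcontfun f s))
        - integral {-e..0} (\<lambda>s. H (apply_bcontfun f s)))" if "t \<in> {-e..e}" for t
      using cl(2)[OF that] by (subst f) (simp add: P_def)
  qed auto
qed

text \<open>Composing \<open>G\<close> with the nearest-point map onto a closed ball, which does not
  increase distances, gives a globally Lipschitz and bounded \<open>H\<close>. On a short time
  interval the solution for \<open>H\<close> cannot leave the ball, where \<open>H\<close> agrees
  with \<open>G\<close>.\<close>

lemma ode_solution_smooth:
  fixes G :: "'a::euclidean_space \<Rightarrow> 'a"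
  assumes \<Omega>: "open \<Omega>" "z0 \<in> \<Omega>" and G: "smooth_on \<Omega> G"
  obtains e z where "e > 0" "z 0 = z0" "smooth_on {-e<..<e} z"
    "\<And>t. t \<in> {-e<..<e} \<Longrightarrow> z t \<in> \<Omega>"
    "\<And>t. t \<in> {-e<..<e} \<Longrightarrow> (z has_vector_derivative G (z t)) (at t)"
proof -
  obtain \<delta> where \<delta>: "\<delta> > 0" "cball z0 \<delta> \<subseteq> \<Omega>"
    using \<Omega> open_contains_cball by blast
  obtain K where K: "K > 0" "\<And>x y. x \<in> cball z0 \<delta> \<Longrightarrow> y \<in> cball z0 \<delta> \<Longrightarrow> norm (G x - G y) \<le> K * norm (x - y)"
    using smooth_on_lipschitz_cball[OF G \<delta>(2)] by metis
  define H where "H x = G (closest_point (cball z0 \<delta>) x)" for x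
  have cp: "closest_point (cball z0 \<delta>) x \<in> cball z0 \<delta>" for x
    using \<delta> by (intro closest_point_in_set) auto
  have HG: "H x = G x" if "x \<in> cball z0 \<delta>" for x
    using that by (simp add: H_def closest_point_self)
  have HK: "norm (H x - H y) \<le> K * norm (x - y)" for x y
  proof -
    have "norm (H x - H y) \<le> K * dist (closest_point (cball z0 \<delta>) x) (closest_point (cball z0 \<delta>) y)"
      unfolding H_def using K(2)[OF cp cp] by (simp add: dist_norm)
    also have "\<dots> \<le> K * dist x y"
      using K(1) \<delta> by (intro mult_left_mono closest_point_lipschitz) auto
    finally show ?thesis by (simp add: dist_norm)
  qed
  have "continuous_on (cball z0 \<delta>) G"
    using smooth_on_continuous_on[OF G] \<delta>(2) continuous_on_subset by blast
  then have "bounded (G ` cball z0 \<delta>)"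
    by (intro compact_imp_bounded compact_continuous_image compact_cball)
  then obtain B where "\<forall>x\<in>cball z0 \<delta>. norm (G x) \<le> B"
    by (auto simp: bounded_iff)
  then have HB: "norm (H x) \<le> \<bar>B\<bar> + 1" for x
    using cp[of x] unfolding H_def by fastforce
  \<comment> \<open>The first bound gives the contraction condition
    \<open>4 * e * K \<le> 1/2\<close>. The second keeps the solution in the ball: the displacement
    is a difference of two integrals, each at most \<open>(\<bar>B\<bar> + 1) * (2 * e)\<close> in
    norm.\<close>
  define e where "e = min (1 / (8 * K)) (\<delta> / (4 * (\<bar>B\<bar> + 1)))"
  have e: "e > 0" "4 * e * K \<le> 1/2" "e * (4 * (\<bar>B\<bar> + 1)) \<le> \<delta>"
  proof -
    show "e > 0" using K \<delta> by (auto simp: e_def)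
    have "e \<le> 1 / (8 * K)" "e \<le> \<delta> / (4 * (\<bar>B\<bar> + 1))" by (auto simp: e_def)
    then show "4 * e * K \<le> 1/2" "e * (4 * (\<bar>B\<bar> + 1)) \<le> \<delta>"
      using K(1) by (auto simp: field_simps add_pos_nonneg)
  qed
  obtain z where z: "z 0 = z0" "continuous_on {-e..e} z"
    "\<And>t. t \<in> {-e..e} \<Longrightarrow> z t = z0 + (integral {-e..t} (\<lambda>s. H (z s)) - integral {-e..0} (\<lambda>s. H (z s)))"
    using picard_lindelof_lipschitz[OF K(1) HK e(1,2), of z0] by metis
  have "continuous_on UNIV H"
    using K(1) HK by (intro lipschitz_on_continuous_on[of K] lipschitz_onI) (auto simp: dist_norm)
  then have contHz: "continuous_on {-e..e} (\<lambda>s. H (z s))"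
    using continuous_on_compose2[OF _ z(2)] by blast
  have zin: "z t \<in> cball z0 \<delta>" if t: "t \<in> {-e..e}" for t
  proof -
    have I: "norm (integral {-e..r} (\<lambda>s. H (z s))) \<le> (\<bar>B\<bar> + 1) * (2 * e)" if r: "r \<in> {-e..e}" for r
    proof -
      have "norm (integral {-e..r} (\<lambda>s. H (z s))) \<le> (\<bar>B\<bar> + 1) * (r - (-e))"
        using r by (intro integral_bound continuous_on_subset[OF contHz] HB) auto
      also have "\<dots> \<le> (\<bar>B\<bar> + 1) * (2 * e)"
        using r by (intro mult_left_mono) auto
      finally show ?thesis .
    qed
    have "norm (z t - z0) \<le> (\<bar>B\<bar> + 1) * (2 * e) + (\<bar>B\<bar> + 1) * (2 * e)"
    proof -
      have "z t - z0 = integral {-e..t} (\<lambda>s. H (z s)) - integral {-e..0} (\<lambda>s. H (z s))"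
        using z(3)[OF t] by simp
      then show ?thesis
        using norm_triangle_ineq4[of "integral {-e..t} (\<lambda>s. H (z s))" "integral {-e..0} (\<lambda>s. H (z s))"]
          I[OF t] I[of 0] e(1) by (simp only: atLeastAtMost_iff) linarith
    qed
    also have "\<dots> \<le> \<delta>" using e(3) by (simp add: algebra_simps)
    finally show ?thesis by (simp add: dist_norm norm_minus_commute)
  qed
  have dz: "(z has_vector_derivative G (z t)) (at t)" if t: "t \<in> {-e<..<e}" for t
  proof -
    have "((\<lambda>t. integral {-e..t} (\<lambda>s. H (z s))) has_vector_derivative H (z t)) (at t within {-e..e})"
      using t by (intro integral_has_vector_derivative contHz) auto
    then have "((\<lambda>t. integral {-e..t} (\<lambda>s. H (z s))) has_vector_derivative H (z t)) (at t)"
      using t at_within_interior[of t "{-e..e}"] by (simp add: interior_atLeastAtMost_real)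
    then have "((\<lambda>t. z0 + (integral {-e..t} (\<lambda>s. H (z s)) - integral {-e..0} (\<lambda>s. H (z s))))
        has_vector_derivative G (z t)) (at t)"
      using HG zin t by (auto intro!: derivative_eq_intros)
    then show ?thesis
      by (rule has_vector_derivative_transform_within_open[of _ _ _ "{-e<..<e}"]) (use t z(3) in auto)
  qed
  show thesis
  proof (rule that[of e z, OF e(1) z(1)])
    show "z t \<in> \<Omega>" if "t \<in> {-e<..<e}" for t
      using zin[of t] \<delta> that by auto
    then have "ck_on n {-e<..<e} (\<lambda>t. G (z t))" if "ck_on n {-e<..<e} z" for n
      using ck_on_compose[OF open_greaterThanLessThan \<Omega>(1) _ that] G unfolding smooth_on_def by blast
    then show "smooth_on {-e<..<e} z"
      using dz by (intro smooth_on_realI[where f' = "\<lambda>t. G (z t)"]) simp_all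
  qed (rule dz)
qed

section \<open>Charts, tangent vectors and vector fields\<close>

lemma scaleR_fun_apply: "(r *\<^sub>R f) x = r *\<^sub>R f x"
  by (simp add: scaleR_fun_def)

lemma sum_fun_apply: "(\<Sum>i\<in>I. f i) x = (\<Sum>i\<in>I. f i x)" for f :: "'i \<Rightarrow> 'x \<Rightarrow> 'y::comm_monoid_add"
  by (induction I rule: infinite_finite_induct) auto

lemma sum_component: "(\<Sum>b\<in>I. k b *\<^sub>R w b) x = (\<Sum>b\<in>I. k b *\<^sub>R w b x)" for w :: "'i \<Rightarrow> 'x \<Rightarrow> 'y::real_vector"
  by (simp add: sum_fun_apply scaleR_fun_apply)

lemma sum_inner_Basis_scaleR:
  "j \<in> Basis \<Longrightarrow> (\<Sum>b\<in>Basis. (j \<bullet> b) *\<^sub>R h b) = h j" for j :: "'x::euclidean_space" and h :: "'x \<Rightarrow> 'y::real_vector"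
  using sum.mono_neutral_right[of Basis "{j}" "\<lambda>b. (j \<bullet> b) *\<^sub>R h b"] by (auto simp: inner_Basis)

lemma vector_derivative_frame_sum:
  assumes "\<And>b. b \<in> Bs \<Longrightarrow> (f b has_vector_derivative f' b) (at t)"
    and "\<And>b. b \<in> Bs \<Longrightarrow> (g b has_vector_derivative g' b) (at t)"
  shows "((\<lambda>s. \<Sum>b\<in>Bs. f b s *\<^sub>R g b s) has_vector_derivative (\<Sum>b\<in>Bs. f' b *\<^sub>R g b t) + (\<Sum>b\<in>Bs. f b t *\<^sub>R g' b)) (at t)"
proof -
  have "((\<lambda>s. f b s *\<^sub>R g b s) has_vector_derivative f' b *\<^sub>R g b t + f b t *\<^sub>R g' b) (at t)" if "b \<in> Bs" for b
    using has_vector_derivative_scaleR[OF _ assms(2)[OF that], of "f b" "f' b"] assms(1)[OF that]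
    by (simp add: has_real_derivative_iff_has_vector_derivative add.commute)
  then show ?thesis
    unfolding sum.distrib[symmetric] by (intro has_vector_derivative_sum)
qed

locale atlas =
  fixes A :: "('m::{t2_space, second_countable_topology}, 'e::euclidean_space) chart set"
  assumes mfd: "smooth_manifold A"
begin

lemma
  assumes "c \<in> A"
  shows open_dom: "open (fst c)" and open_range: "open (snd c ` fst c)"
    and chart_homeo: "homeomorphism (fst c) (snd c ` fst c) (snd c) (cinv c)"
  using assms mfd by (auto simp: smooth_manifold_def)

lemma open_Int_dom: "c \<in> A \<Longrightarrow> open W \<Longrightarrow> open (W \<inter> fst c)"
  by (intro open_Int open_dom)

lemma ex_chart: obtains c where "c \<in> A" "p \<in> fst c"
  using mfd unfolding smooth_manifold_def by blast

lemma cinv_snd [simp]: "c \<in> A \<Longrightarrow> p \<in> fst c \<Longrightarrow> cinv c (snd c p) = p"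
  using chart_homeo by (auto simp: homeomorphism_def)

lemma continuous_on_cinv: "c \<in> A \<Longrightarrow> continuous_on (snd c ` fst c) (cinv c)"
  using chart_homeo by (auto simp: homeomorphism_def)

lemma open_chart_image:
  assumes "c \<in> A" "open W" "W \<subseteq> fst c"
  shows "open (snd c ` W)"
proof -
  have "openin (top_of_set (snd c ` fst c)) (snd c ` W)"
    using homeomorphism_imp_open_map[OF chart_homeo[OF assms(1)], of W] assms open_dom[OF assms(1)]
    by (simp add: openin_open_eq)
  then show ?thesis
    using open_range[OF assms(1)] by (simp add: openin_open_eq)
qed

lemma open_cinv_image:
  assumes "c \<in> A" "open S" "S \<subseteq> snd c ` fst c"
  shows "open (cinv c ` S)"
proof -
  have "openin (top_of_set (fst c)) (cinv c ` S)"
    using homeomorphism_imp_open_map[OF homeomorphism_sym[THEN iffD1, OF chart_homeo[OF assms(1)]], of S]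
      assms open_range[OF assms(1)]
    by (simp add: openin_open_eq)
  then show ?thesis
    using open_dom[OF assms(1)] by (simp add: openin_open_eq)
qed

lemma smooth_transition:
  "c \<in> A \<Longrightarrow> d \<in> A \<Longrightarrow> smooth_on (snd c ` (fst c \<inter> fst d)) (snd d \<circ> cinv c)"
  using mfd by (auto simp: smooth_manifold_def)

lemma jacobian_has_derivative:
  assumes "c \<in> A" "d \<in> A" "p \<in> fst c" "p \<in> fst d"
  shows "((snd d \<circ> cinv c) has_derivative jacobian c d p) (at (snd c p))"
  unfolding jacobian_def
  by (rule smooth_on_has_derivative[OF smooth_transition]) (use assms in auto)

lemma linear_jacobian:
  assumes "c \<in> A" "d \<in> A" "p \<in> fst c" "p \<in> fst d"
  shows "linear (jacobian c d p)"
  using jacobian_has_derivative[OF assms] has_derivative_linear by blast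

lemma jacobian_eqI:
  assumes "c \<in> A" "p \<in> fst c" "(f has_derivative f') (at (snd c p))"
    and "open W" "p \<in> W" "W \<subseteq> fst c" "\<And>q. q \<in> W \<Longrightarrow> f (snd c q) = snd d q"
  shows "jacobian c d p = f'"
proof -
  have "((snd d \<circ> cinv c) has_derivative f') (at (snd c p))"
    by (rule has_derivative_transform_within_open[OF assms(3) open_chart_image[OF assms(1,4,6)]])
       (use assms in \<open>auto simp: subset_iff\<close>)
  then show ?thesis
    using frechet_derivative_at unfolding jacobian_def by metis
qed

lemma jacobian_self: "c \<in> A \<Longrightarrow> p \<in> fst c \<Longrightarrow> jacobian c c p y = y"
  using jacobian_eqI[of c p "\<lambda>x. x" "\<lambda>x. x" "fst c" c] open_dom by auto

lemma jacobian_comp: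
  assumes "c \<in> A" "d \<in> A" "e \<in> A" "p \<in> fst c" "p \<in> fst d" "p \<in> fst e"
  shows "jacobian d e p (jacobian c d p y) = jacobian c e p y"
proof -
  have "((snd e \<circ> cinv d) has_derivative jacobian d e p) (at ((snd d \<circ> cinv c) (snd c p)))"
    using jacobian_has_derivative[of d e p] assms by simp
  from diff_chain_at[OF jacobian_has_derivative[OF assms(1,2,4,5)] this]
  have "((snd e \<circ> cinv d \<circ> (snd d \<circ> cinv c)) has_derivative jacobian d e p \<circ> jacobian c d p) (at (snd c p))" .
  from jacobian_eqI[OF assms(1,4) this, of "fst c \<inter> fst d" e]
  have "jacobian c e p = jacobian d e p \<circ> jacobian c d p"
    using assms open_Int_dom[OF assms(2) open_dom[OF assms(1)]] by auto
  then show ?thesis by simp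
qed

lemma tangent_spaceD:
  "w \<in> tangent_space A p \<Longrightarrow> c \<in> A \<Longrightarrow> d \<in> A \<Longrightarrow> p \<in> fst c \<Longrightarrow> p \<in> fst d \<Longrightarrow> w d = jacobian c d p (w c)"
  unfolding tangent_space_def by blast

lemma tangent_space_undefined: "w \<in> tangent_space A p \<Longrightarrow> \<not> (c \<in> A \<and> p \<in> fst c) \<Longrightarrow> w c = 0"
  unfolding tangent_space_def by blast

lemma subspace_tangent_space: "subspace (tangent_space A p)"
proof (rule subspaceI)
  have lin: "linear (jacobian c d p)" if "c \<in> A" "d \<in> A" "p \<in> fst c" "p \<in> fst d" for c d
    using linear_jacobian that by blast
  show "0 \<in> tangent_space A p"
    unfolding tangent_space_def using linear_0[OF lin] by simp
  fix v w assume v: "v \<in> tangent_space A p"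
  show "r *\<^sub>R v \<in> tangent_space A p" for r
    unfolding tangent_space_def
  proof (intro CollectI conjI allI ballI impI)
    show "(r *\<^sub>R v) c = 0" if "\<not> (c \<in> A \<and> p \<in> fst c)" for c
      using tangent_space_undefined[OF v that] unfolding scaleR_fun_def by simp
    show "(r *\<^sub>R v) d = jacobian c d p ((r *\<^sub>R v) c)" if "c \<in> A" "d \<in> A" "p \<in> fst c" "p \<in> fst d" for c d
      using tangent_spaceD[OF v that] linear_cmul[OF lin[OF that]] unfolding scaleR_fun_def by simp
  qed
  assume w: "w \<in> tangent_space A p"
  show "v + w \<in> tangent_space A p"
    unfolding tangent_space_def
  proof (intro CollectI conjI allI ballI impI)
    show "(v + w) c = 0" if "\<not> (c \<in> A \<and> p \<in> fst c)" for c
      using tangent_space_undefined[OF v that] tangent_space_undefined[OF w that] by simp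
    show "(v + w) d = jacobian c d p ((v + w) c)" if "c \<in> A" "d \<in> A" "p \<in> fst c" "p \<in> fst d" for c d
      using tangent_spaceD[OF v that] tangent_spaceD[OF w that] linear_add[OF lin[OF that]] by simp
  qed
qed

text \<open>The Jacobians carry equality from one chart to every chart around \<open>p\<close>, and
  at all other arguments both sides are 0 by convention. Identities between tangent vectors are thus
  checked in a single chart.\<close>

lemma tangent_eqI:
  assumes "v \<in> tangent_space A p" "w \<in> tangent_space A p" "c \<in> A" "p \<in> fst c" "v c = w c"
  shows "v = w"
proof
  fix d
  show "v d = w d"
  proof (cases "d \<in> A \<and> p \<in> fst d")
    case True
    then show ?thesis using tangent_spaceD[OF assms(1), of c d] tangent_spaceD[OF assms(2), of c d] assms by simp
  next
    case False
    then show ?thesis using assms(1,2) tangent_space_undefined by metis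
  qed
qed

lemma tvec_of_in_tangent_space:
  assumes "c \<in> A" "p \<in> fst c"
  shows "tvec_of A c p y \<in> tangent_space A p"
  unfolding tangent_space_def tvec_of_def using jacobian_comp[OF assms(1) _ _ assms(2)] by simp

lemma tvec_of_self [simp]: "c \<in> A \<Longrightarrow> p \<in> fst c \<Longrightarrow> tvec_of A c p y c = y"
  by (simp add: tvec_of_def jacobian_self)

lemma tvec_of_component: "w \<in> tangent_space A p \<Longrightarrow> c \<in> A \<Longrightarrow> p \<in> fst c \<Longrightarrow> tvec_of A c p (w c) = w"
  by (rule tangent_eqI) (auto intro: tvec_of_in_tangent_space)

text \<open>The components in any other chart arise by applying the derivative of the transition
  map, at a moving point, to the components in the given chart; so one convenient chart near each
  point suffices.\<close>

lemma vfields_onI: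
  assumes T: "\<And>p. p \<in> W \<Longrightarrow> X p \<in> tangent_space A p"
    and loc: "\<And>p. p \<in> W \<Longrightarrow> \<exists>c\<in>A. \<exists>W'. open W' \<and> p \<in> W' \<and> W' \<subseteq> W \<inter> fst c \<and>
      smooth_on (snd c ` W') (\<lambda>x. X (cinv c x) c)"
  shows "X \<in> vfields_on A W"
  unfolding vfields_on_def
proof (intro CollectI conjI ballI T)
  fix d assume d: "d \<in> A"
  show "smooth_on (snd d ` (W \<inter> fst d)) (\<lambda>x. X (cinv d x) d)"
  proof (rule smooth_on_local)
    fix x assume "x \<in> snd d ` (W \<inter> fst d)"
    then obtain p where p: "p \<in> W" "p \<in> fst d" "x = snd d p" by auto
    obtain c W' where c: "c \<in> A" and W': "open W'" "p \<in> W'" "W' \<subseteq> W \<inter> fst c"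
      and sm: "smooth_on (snd c ` W') (\<lambda>x. X (cinv c x) c)"
      using loc[OF p(1)] by blast
    define T where "T = snd d ` (W' \<inter> fst d)"
    have oT: "open T"
      unfolding T_def by (rule open_chart_image[OF d]) (use W' open_dom[OF d] in auto)
    have oc: "open (snd c ` (fst c \<inter> fst d))" "open (snd c ` W')"
      by (rule open_chart_image[OF c]; use W' open_Int_dom[OF d open_dom[OF c]] in auto)+
    have u: "smooth_on T (snd c \<circ> cinv d)"
      by (rule smooth_on_subset[OF smooth_transition[OF d c]]) (use W' in \<open>auto simp: T_def\<close>)
    have "smooth_on T (\<lambda>x. frechet_derivative (snd d \<circ> cinv c) (at ((snd c \<circ> cinv d) x))
        ((\<lambda>x. X (cinv c x) c) ((snd c \<circ> cinv d) x)))"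
      by (rule smooth_on_frechet_apply[OF smooth_transition[OF c d] oT oc(1) _ u
            smooth_on_compose[OF sm oT oc(2) _ u]])
         (use W' d in \<open>auto simp: T_def\<close>)
    then have "smooth_on T (\<lambda>x. X (cinv d x) d)"
    proof (rule smooth_on_cong[OF oT, rotated])
      fix x assume "x \<in> T"
      then obtain q where q: "q \<in> W'" "q \<in> fst d" "x = snd d q" by (auto simp: T_def)
      then have qc: "q \<in> fst c" "q \<in> W" using W' by auto
      show "frechet_derivative (snd d \<circ> cinv c) (at ((snd c \<circ> cinv d) x))
          ((\<lambda>x. X (cinv c x) c) ((snd c \<circ> cinv d) x)) = X (cinv d x) d"
        using tangent_spaceD[OF T[OF qc(2)] c d qc(1) q(2)] q qc c d by (simp add: jacobian_def)
    qed
    then show "\<exists>T. open T \<and> x \<in> T \<and> smooth_on T (\<lambda>x. X (cinv d x) d)"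
      using oT p W' by (auto simp: T_def)
  qed
qed

lemma vfields_on_smooth:
  "X \<in> vfields_on A W \<Longrightarrow> c \<in> A \<Longrightarrow> W' \<subseteq> W \<inter> fst c \<Longrightarrow> smooth_on (snd c ` W') (\<lambda>x. X (cinv c x) c)"
  unfolding vfields_on_def by (auto elim!: ballE intro: smooth_on_subset)

lemma vfields_on_subset: "X \<in> vfields_on A W \<Longrightarrow> W' \<subseteq> W \<Longrightarrow> X \<in> vfields_on A W'"
  unfolding vfields_on_def by (auto intro: smooth_on_subset)

lemma vfields_on_tangent: "X \<in> vfields_on A W \<Longrightarrow> p \<in> W \<Longrightarrow> X p \<in> tangent_space A p"
  unfolding vfields_on_def by auto

lemma tvec_field_in_vfields_on:
  assumes c: "c \<in> A" and W: "open W" "W \<subseteq> fst c"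
  shows "(\<lambda>q. tvec_of A c q y) \<in> vfields_on A W"
proof (rule vfields_onI)
  fix p assume p: "p \<in> W"
  show "tvec_of A c p y \<in> tangent_space A p"
    using p W by (auto intro!: tvec_of_in_tangent_space c)
  have "smooth_on (snd c ` W) (\<lambda>x. tvec_of A c (cinv c x) y c)"
    by (rule smooth_on_cong[OF open_chart_image[OF c W] _ smooth_on_const[of _ y]])
       (use W c in auto)
  then show "\<exists>c'\<in>A. \<exists>W'. open W' \<and> p \<in> W' \<and> W' \<subseteq> W \<inter> fst c' \<and>
      smooth_on (snd c' ` W') (\<lambda>x. tvec_of A c (cinv c' x) y c')"
    using c W p by blast
qed

lemma coord_field_in_vfields_on: "c \<in> A \<Longrightarrow> coord_field A c i \<in> vfields_on A (fst c)"
  using tvec_field_in_vfields_on[of c "fst c" i] open_dom by (simp add: coord_field_def[abs_def])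

text \<open>The field is multiplied by a bump function in a chart and continued by 0. Smoothness of
  the continuation holds because the support lies in \<open>K\<close>, which is compact and
  therefore closed, the manifold being Hausdorff: points outside \<open>W1\<close> have a
  neighbourhood missing \<open>K\<close>.\<close>

lemma vfields_on_extend:
  assumes X: "X \<in> vfields_on A W" and W: "open W" "p \<in> W"
  obtains X' W' where "X' \<in> vfields A" "open W'" "p \<in> W'" "\<And>q. q \<in> W' \<Longrightarrow> X' q = X q"
proof -
  obtain c where c: "c \<in> A" "p \<in> fst c" by (rule ex_chart)
  define W1 where "W1 = W \<inter> fst c"
  have W1: "open W1" "p \<in> W1" "W1 \<subseteq> fst c"
    using W c open_dom[OF c(1)] by (auto simp: W1_def)
  obtain r where r: "r > 0" "cball (snd c p) r \<subseteq> snd c ` W1"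
    using open_chart_image[OF c(1) W1(1,3)] W1(2) open_contains_cball by (metis image_eqI)
  obtain \<phi> where \<phi>: "smooth_on UNIV \<phi>" "\<And>x. x \<in> ball (snd c p) (r/2) \<Longrightarrow> \<phi> x = (1::real)"
    "\<And>x. x \<notin> ball (snd c p) r \<Longrightarrow> \<phi> x = 0"
    using smooth_bump[OF r(1)] by metis
  define X' where "X' q = (if q \<in> W1 then \<phi> (snd c q) *\<^sub>R X q else 0)" for q
  define K where "K = cinv c ` cball (snd c p) r"
  have "continuous_on (cball (snd c p) r) (cinv c)"
    using continuous_on_subset[OF continuous_on_cinv[OF c(1)]] r(2) W1(3) by blast
  then have "closed K"
    unfolding K_def by (intro compact_imp_closed compact_continuous_image compact_cball)
  show thesis
  proof (rule that)
    show "X' \<in> vfields A"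
    proof (rule vfields_onI)
      fix q :: 'm
      show "X' q \<in> tangent_space A q"
        using vfields_on_tangent[OF X, of q] subspace_tangent_space[of q]
        by (auto simp: X'_def W1_def subspace_scale subspace_0)
      show "\<exists>c\<in>A. \<exists>W'. open W' \<and> q \<in> W' \<and> W' \<subseteq> UNIV \<inter> fst c \<and> smooth_on (snd c ` W') (\<lambda>x. X' (cinv c x) c)"
      proof (cases "q \<in> W1")
        case True
        have "smooth_on (snd c ` W1) (\<lambda>x. \<phi> x *\<^sub>R X (cinv c x) c)"
          by (intro smooth_on_scaleR open_chart_image c W1 vfields_on_smooth[OF X] smooth_on_subset[OF \<phi>(1)])
             (auto simp: W1_def)
        then have "smooth_on (snd c ` W1) (\<lambda>x. X' (cinv c x) c)"
          by (rule smooth_on_cong[OF open_chart_image[OF c(1) W1(1,3)], rotated])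
             (use W1 c in \<open>auto simp: X'_def scaleR_fun_def subset_iff\<close>)
        then show ?thesis using W1 c True by blast
      next
        case False
        obtain d where d: "d \<in> A" "q \<in> fst d" by (rule ex_chart)
        have "q \<notin> K"
          using False r(2) W1(3) c by (auto simp: K_def subset_iff)
        have oW: "open (fst d - K)"
          using open_dom[OF d(1)] \<open>closed K\<close> by blast
        have "X' q' = 0" if "q' \<notin> K" for q'
        proof (cases "q' \<in> W1")
          case True
          then have "snd c q' \<notin> ball (snd c p) r"
            using that W1(3) c by (auto simp: K_def image_iff) (metis cinv_snd dist_commute less_imp_le mem_cball subsetD)
          then show ?thesis using \<phi>(3) by (simp add: X'_def)
        qed (simp add: X'_def)
        then have "smooth_on (snd d ` (fst d - K)) (\<lambda>x. X' (cinv d x) d)"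
          by (intro smooth_on_cong[OF open_chart_image[OF d(1) oW] _ smooth_on_const[of _ 0]])
             (use d in auto)
        then show ?thesis using d oW \<open>q \<notin> K\<close> by blast
      qed
    qed
    have sub: "ball (snd c p) (r/2) \<subseteq> snd c ` W1"
      using r by (force simp: subset_iff)
    show "open (cinv c ` ball (snd c p) (r/2))"
      by (rule open_cinv_image) (use c sub W1 in auto)
    show "p \<in> cinv c ` ball (snd c p) (r/2)"
      using c r(1) by (auto simp: image_iff intro!: bexI[of _ "snd c p"])
    show "X' q = X q" if "q \<in> cinv c ` ball (snd c p) (r/2)" for q
    proof -
      obtain x where x: "x \<in> ball (snd c p) (r/2)" "q = cinv c x"
        using \<open>q \<in> cinv c ` ball (snd c p) (r/2)\<close> by blast
      then obtain q' where "q' \<in> W1" "x = snd c q'" using sub by auto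
      then have "q = q'" "q \<in> W1" using x c W1 by auto
      then show ?thesis using \<phi>(2)[OF x(1)] \<open>x = snd c q'\<close> by (simp add: X'_def)
    qed
  qed
qed

lemma global_extension:
  assumes X: "X \<in> vfields_on A W" and W: "open W" "p \<in> W"
  shows "global_extension A p X \<in> vfields A"
    and "\<exists>W'. open W' \<and> p \<in> W' \<and> (\<forall>q\<in>W'. global_extension A p X q = X q)"
proof -
  have "\<exists>X'. X' \<in> vfields A \<and> (\<exists>W. open W \<and> p \<in> W \<and> (\<forall>q\<in>W. X' q = X q))"
    using vfields_on_extend[OF assms] by metis
  from someI_ex[OF this]
  show "global_extension A p X \<in> vfields A"
    "\<exists>W'. open W' \<and> p \<in> W' \<and> (\<forall>q\<in>W'. global_extension A p X q = X q)"
    unfolding global_extension_def by auto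
qed

lemma smooth_fun_onI:
  assumes c: "c \<in> A" and W: "open W" "W \<subseteq> fst c" and f: "smooth_on (snd c ` W) (f \<circ> cinv c)"
  shows "smooth_fun_on A W f"
  unfolding smooth_fun_on_def
proof
  fix d assume d: "d \<in> A"
  have oT: "open (snd d ` (W \<inter> fst d))"
    by (rule open_chart_image[OF d]) (use W open_dom[OF d] in auto)
  have u: "smooth_on (snd d ` (W \<inter> fst d)) (snd c \<circ> cinv d)"
    by (rule smooth_on_subset[OF smooth_transition[OF d c]]) (use W in auto)
  have "smooth_on (snd d ` (W \<inter> fst d)) (\<lambda>x. (f \<circ> cinv c) ((snd c \<circ> cinv d) x))"
    by (rule smooth_on_compose[OF f oT open_chart_image[OF c W] _ u]) (use d in auto)
  then show "smooth_on (snd d ` (W \<inter> fst d)) (f \<circ> cinv d)"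
    by (rule smooth_on_cong[OF oT, rotated]) (use W c d in \<open>auto simp: subset_iff\<close>)
qed

text \<open>The chart selected by choice in \<open>dir_deriv\<close> can be exchanged: by the chain
  rule the derivative changes by the Jacobian of the transition, which also relates the components
  of \<open>u\<close>.\<close>

lemma dir_deriv_chart:
  assumes c: "c \<in> A" "p \<in> fst c" and f: "(f \<circ> cinv c) differentiable (at (snd c p))"
    and u: "u \<in> tangent_space A p"
  shows "dir_deriv A p u f = frechet_derivative (f \<circ> cinv c) (at (snd c p)) (u c)"
proof -
  define d where "d = (SOME c. c \<in> A \<and> p \<in> fst c)"
  have d: "d \<in> A" "p \<in> fst d"
    using someI[of "\<lambda>c. c \<in> A \<and> p \<in> fst c" c] c by (auto simp: d_def)
  have "((f \<circ> cinv c) has_derivative frechet_derivative (f \<circ> cinv c) (at (snd c p)))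
      (at ((snd c \<circ> cinv d) (snd d p)))"
    using f d by (simp add: frechet_derivative_works)
  from diff_chain_at[OF jacobian_has_derivative[OF d(1) c(1) d(2) c(2)] this]
  have "((f \<circ> cinv c \<circ> (snd c \<circ> cinv d)) has_derivative
      frechet_derivative (f \<circ> cinv c) (at (snd c p)) \<circ> jacobian d c p) (at (snd d p))" .
  then have "((f \<circ> cinv d) has_derivative
      frechet_derivative (f \<circ> cinv c) (at (snd c p)) \<circ> jacobian d c p) (at (snd d p))"
    by (rule has_derivative_transform_within_open[of _ _ _ _ "snd d ` (fst c \<inter> fst d)"])
       (use open_chart_image[OF d(1), of "fst c \<inter> fst d"] open_Int_dom[OF d(1) open_dom[OF c(1)]] c d in auto)
  from fun_cong[OF frechet_derivative_at[OF this], of "u d"]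
  have "frechet_derivative (f \<circ> cinv d) (at (snd d p)) (u d)
      = frechet_derivative (f \<circ> cinv c) (at (snd c p)) (jacobian d c p (u d))"
    by simp
  then show ?thesis
    using tangent_spaceD[OF u d(1) c(1) d(2) c(2)] by (simp add: dir_deriv_def Let_def d_def[symmetric])
qed


lemma open_vfield_image: "c \<in> A \<Longrightarrow> open W \<Longrightarrow> open (snd c ` (W \<inter> fst c))"
  by (intro open_chart_image open_Int_dom) auto

section \<open>Coordinates on the tangent bundle\<close>

lemma bundle_coords_iff:
  assumes U: "U \<subseteq> tangent_bundle A" and c: "c \<in> A"
  shows "(x, y) \<in> bundle_coords c U \<longleftrightarrow> x \<in> snd c ` fst c \<and> bundle_point A c (x, y) \<in> U"
proof
  assume "(x, y) \<in> bundle_coords c U"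
  then obtain q u where q: "(q, u) \<in> U" "q \<in> fst c" "x = snd c q" "y = u c"
    by (auto simp: bundle_coords_def)
  moreover have "u \<in> tangent_space A q"
    using q(1) U by (auto simp: tangent_bundle_def)
  ultimately show "x \<in> snd c ` fst c \<and> bundle_point A c (x, y) \<in> U"
    using c by (simp add: bundle_point_def tvec_of_component)
next
  assume *: "x \<in> snd c ` fst c \<and> bundle_point A c (x, y) \<in> U"
  then obtain q where q: "q \<in> fst c" "x = snd c q" by auto
  then have "(q, tvec_of A c q y) \<in> U" using * c by (simp add: bundle_point_def)
  then have "(snd c q, tvec_of A c q y c) \<in> bundle_coords c U"
    using q by (force simp: bundle_coords_def)
  then show "(x, y) \<in> bundle_coords c U"
    using q c by simp
qed

lemma bundle_point_coords:
  assumes "u \<in> tangent_space A q" "c \<in> A" "q \<in> fst c"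
  shows "bundle_point A c (snd c q, u c) = (q, u)"
  using assms by (simp add: bundle_point_def tvec_of_component)

section \<open>Connections in coordinates\<close>

lemma zero_vfield:
  assumes "open W" "\<And>q. q \<in> W \<Longrightarrow> Z q = 0"
  shows "Z \<in> vfields_on A W"
  unfolding vfields_on_def
proof (intro CollectI conjI ballI)
  show "Z p \<in> tangent_space A p" if "p \<in> W" for p
    using assms(2)[OF that] subspace_0[OF subspace_tangent_space] by simp
  show "smooth_on (snd c ` (W \<inter> fst c)) (\<lambda>x. Z (cinv c x) c)" if "c \<in> A" for c
    by (rule smooth_on_cong[OF open_vfield_image[OF that assms(1)] _ smooth_on_const[of _ 0]])
       (use assms(2) that in auto)
qed

lemma vfields_on_add:
  assumes "open W" "X \<in> vfields_on A W" "Y \<in> vfields_on A W"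
  shows "X + Y \<in> vfields_on A W"
  unfolding vfields_on_def
proof (intro CollectI conjI ballI)
  show "(X + Y) p \<in> tangent_space A p" if "p \<in> W" for p
    using vfields_on_tangent[OF assms(2) that] vfields_on_tangent[OF assms(3) that]
    by (simp add: subspace_add[OF subspace_tangent_space])
  show "smooth_on (snd c ` (W \<inter> fst c)) (\<lambda>x. (X + Y) (cinv c x) c)" if "c \<in> A" for c
    using smooth_on_add[OF open_vfield_image[OF that assms(1)] vfields_on_smooth[OF assms(2) that]
        vfields_on_smooth[OF assms(3) that]] by simp
qed

lemma vfields_on_scale:
  assumes "open W" "X \<in> vfields_on A W" "smooth_fun_on A W f"
  shows "(\<lambda>q. f q *\<^sub>R X q) \<in> vfields_on A W"
  unfolding vfields_on_def
proof (intro CollectI conjI ballI)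
  show "f p *\<^sub>R X p \<in> tangent_space A p" if "p \<in> W" for p
    using vfields_on_tangent[OF assms(2) that] by (simp add: subspace_scale[OF subspace_tangent_space])
  show "smooth_on (snd c ` (W \<inter> fst c)) (\<lambda>x. (f (cinv c x) *\<^sub>R X (cinv c x)) c)" if "c \<in> A" for c
    using smooth_on_scaleR[OF open_vfield_image[OF that assms(1)] _ vfields_on_smooth[OF assms(2) that]]
      assms(3) that by (simp add: scaleR_fun_def smooth_fun_on_def o_def)
qed

lemma vfields_on_sum:
  assumes "open W" "\<And>i. i \<in> I \<Longrightarrow> E i \<in> vfields_on A W" "\<And>i. i \<in> I \<Longrightarrow> smooth_fun_on A W (f i)"
  shows "(\<lambda>q. \<Sum>i\<in>I. f i q *\<^sub>R E i q) \<in> vfields_on A W"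
  using assms(2,3)
proof (induction I rule: infinite_finite_induct)
  case (insert j I)
  have eq: "(\<lambda>q. \<Sum>i\<in>insert j I. f i q *\<^sub>R E i q) = (\<lambda>q. f j q *\<^sub>R E j q) + (\<lambda>q. \<Sum>i\<in>I. f i q *\<^sub>R E i q)"
    using insert.hyps by (auto simp: fun_eq_iff)
  show ?case
    unfolding eq using insert by (intro vfields_on_add vfields_on_scale assms(1)) auto
qed (auto intro: zero_vfield assms(1))

text \<open>Fields are total functions with arbitrary values off \<open>W\<close>. Multiplying by
  this function, which is 0 on \<open>W\<close> and 1 elsewhere, lets the product rule show that a
  connection on \<open>W\<close> ignores those values.\<close>

lemma smooth_fun_on_indicator:
  assumes "open W"
  shows "smooth_fun_on A W (\<lambda>q. if q \<in> W then 0 else 1)"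
  unfolding smooth_fun_on_def
proof
  fix c assume "c \<in> A"
  show "smooth_on (snd c ` (W \<inter> fst c)) ((\<lambda>q. if q \<in> W then 0 else 1) \<circ> cinv c)"
    by (rule smooth_on_cong[OF open_vfield_image[OF \<open>c \<in> A\<close> assms] _ smooth_on_const[of _ 0]])
       (use \<open>c \<in> A\<close> in auto)
qed

section \<open>Locality and sum rules for a connection on an open set\<close>

context
  fixes W N
  assumes W: "open W" and N: "linear_connection_on A W N"
begin

lemma conn_add:
  assumes "X \<in> vfields_on A W" "Y \<in> vfields_on A W" "Z \<in> vfields_on A W" "p \<in> W"
  shows "N (X + Y) Z p = N X Z p + N Y Z p" "N X (Y + Z) p = N X Y p + N X Z p"
  using N assms unfolding linear_connection_on_def by blast+

lemma conn_scale:
  assumes "smooth_fun_on A W f" "X \<in> vfields_on A W" "Y \<in> vfields_on A W" "p \<in> W"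
  shows "N (\<lambda>q. f q *\<^sub>R X q) Y p = f p *\<^sub>R N X Y p"
    "N X (\<lambda>q. f q *\<^sub>R Y q) p = dir_deriv A p (X p) f *\<^sub>R Y p + f p *\<^sub>R N X Y p"
  using N assms unfolding linear_connection_on_def by blast+

text \<open>A field vanishing on \<open>W\<close> equals its product with the indicator of the complement of \<open>W\<close>.\<close>

lemma conn_zero:
  assumes Z: "\<And>q. q \<in> W \<Longrightarrow> Z q = 0" and Y: "Y \<in> vfields_on A W" and p: "p \<in> W"
  shows "N Z Y p = 0" "N Y Z p = 0"
proof -
  let ?f = "\<lambda>q. if q \<in> W then 0 else (1::real)"
  have ZV: "Z \<in> vfields_on A W"
    by (rule zero_vfield[OF W Z])
  have eq: "(\<lambda>q. ?f q *\<^sub>R Z q) = Z"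
    using Z by auto
  show "N Z Y p = 0"
    using conn_scale(1)[OF smooth_fun_on_indicator[OF W] ZV Y p] p unfolding eq by simp
  show "N Y Z p = 0"
    using conn_scale(2)[OF smooth_fun_on_indicator[OF W] Y ZV p] p Z[OF p] unfolding eq by simp
qed

text \<open>The difference of the two fields vanishes on \<open>W\<close>, so additivity and
  \<open>conn_zero\<close> apply.\<close>

lemma conn_cong:
  assumes X: "X \<in> vfields_on A W" "X' \<in> vfields_on A W" "\<And>q. q \<in> W \<Longrightarrow> X' q = X q"
    and Y: "Y \<in> vfields_on A W" and p: "p \<in> W"
  shows "N X' Y p = N X Y p" "N Y X' p = N Y X p"
proof -
  define D where "D = X' - X"
  have D: "D q = 0" if "q \<in> W" for q
    using X(3)[OF that] by (simp add: D_def)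
  have DV: "D \<in> vfields_on A W"
    by (rule zero_vfield[OF W D])
  have eq: "X + D = X'" by (simp add: D_def)
  show "N X' Y p = N X Y p"
    using conn_add(1)[OF X(1) DV Y p] conn_zero(1)[of D, OF D Y p] unfolding eq by simp
  show "N Y X' p = N Y X p"
    using conn_add(2)[OF Y X(1) DV p] conn_zero(2)[of D, OF D Y p] unfolding eq by simp
qed

lemma conn_sum:
  assumes E: "\<And>i. i \<in> I \<Longrightarrow> E i \<in> vfields_on A W" "\<And>i. i \<in> I \<Longrightarrow> smooth_fun_on A W (f i)"
    and Y: "Y \<in> vfields_on A W" and p: "p \<in> W"
  shows "N (\<lambda>q. \<Sum>i\<in>I. f i q *\<^sub>R E i q) Y p = (\<Sum>i\<in>I. f i p *\<^sub>R N (E i) Y p) \<and>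
    N Y (\<lambda>q. \<Sum>i\<in>I. f i q *\<^sub>R E i q) p
      = (\<Sum>i\<in>I. dir_deriv A p (Y p) (f i) *\<^sub>R E i p + f i p *\<^sub>R N Y (E i) p)"
  using E
proof (induction I rule: infinite_finite_induct)
  case (insert j I)
  have eq: "(\<lambda>q. \<Sum>i\<in>insert j I. f i q *\<^sub>R E i q) = (\<lambda>q. f j q *\<^sub>R E j q) + (\<lambda>q. \<Sum>i\<in>I. f i q *\<^sub>R E i q)"
    using insert.hyps by (auto simp: fun_eq_iff)
  have Ej: "(\<lambda>q. f j q *\<^sub>R E j q) \<in> vfields_on A W"
    using insert.prems by (intro vfields_on_scale W) auto
  have EI: "(\<lambda>q. \<Sum>i\<in>I. f i q *\<^sub>R E i q) \<in> vfields_on A W"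
    using insert.prems by (intro vfields_on_sum W) auto
  have fj: "smooth_fun_on A W (f j)" "E j \<in> vfields_on A W"
    using insert.prems by auto
  show ?case
    unfolding eq conn_add(1)[OF Ej EI Y p] conn_add(2)[OF Y Ej EI p]
      conn_scale(1)[OF fj Y p] conn_scale(2)[OF fj(1) Y fj(2) p]
    using insert by simp
qed (auto intro: conn_zero Y p)

end

lemma smooth_component_fun:
  assumes c: "c \<in> A" and W: "open W" "W \<subseteq> fst c" and X: "X \<in> vfields_on A W"
  shows "smooth_fun_on A W (\<lambda>q. X q c \<bullet> k)"
proof (rule smooth_fun_onI[OF c W])
  show "smooth_on (snd c ` W) ((\<lambda>q. X q c \<bullet> k) \<circ> cinv c)"
    unfolding o_def using W
    by (intro smooth_on_inner open_chart_image c vfields_on_smooth[OF X] smooth_on_const) auto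
qed

lemma tangent_expand:
  assumes w: "w \<in> tangent_space A p" and c: "c \<in> A" "p \<in> fst c"
  shows "w = (\<Sum>i\<in>Basis. (w c \<bullet> i) *\<^sub>R coord_field A c i p)"
proof (rule tangent_eqI[OF w _ c])
  show "(\<Sum>i\<in>Basis. (w c \<bullet> i) *\<^sub>R coord_field A c i p) \<in> tangent_space A p"
    unfolding coord_field_def
    by (intro subspace_sum subspace_scale subspace_tangent_space tvec_of_in_tangent_space c)
  show "w c = (\<Sum>i\<in>Basis. (w c \<bullet> i) *\<^sub>R coord_field A c i p) c"
    using c by (simp add: sum_fun_apply scaleR_fun_def coord_field_def euclidean_representation)
qed

text \<open>Only global fields may be inserted into \<open>nabla\<close>, so the coordinate fields
  are replaced by global ones with the same germs at \<open>p\<close>. A common neighbourhood exists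
  because the basis is finite.\<close>

lemma coord_frame_extension:
  assumes c: "c \<in> A" "p \<in> fst c"
  obtains E W1 where "open W1" "p \<in> W1" "W1 \<subseteq> fst c" "\<And>i. i \<in> Basis \<Longrightarrow> E i \<in> vfields A"
    "\<And>i q. i \<in> Basis \<Longrightarrow> q \<in> W1 \<Longrightarrow> E i q = coord_field A c i q"
proof -
  define E where "E i = global_extension A p (coord_field A c i)" for i
  note ext = global_extension[OF coord_field_in_vfields_on[OF c(1)] open_dom[OF c(1)] c(2)]
  obtain W where W: "\<And>i. open (W i)" "\<And>i. p \<in> W i" "\<And>i q. q \<in> W i \<Longrightarrow> E i q = coord_field A c i q"
    using ext(2) unfolding E_def by metis
  show thesis
  proof (rule that[of "fst c \<inter> (\<Inter>i\<in>Basis. W i)" E])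
    show "open (fst c \<inter> (\<Inter>i\<in>Basis. W i))"
      by (intro open_Int open_INT open_dom c ballI W finite_Basis)
  qed (use W c ext(1) in \<open>auto simp: E_def\<close>)
qed

lemma anisotropic_connection_on:
  assumes "anisotropic_connection A U nabla" "open W" "V \<in> vfields_on A W" "\<And>p. p \<in> W \<Longrightarrow> (p, V p) \<in> U"
  shows "\<exists>N. linear_connection_on A W N \<and>
    (\<forall>X\<in>vfields A. \<forall>Y\<in>vfields A. \<forall>p\<in>W. nabla (p, V p) X Y = N X Y p)"
  using conjunct2[OF assms(1)[unfolded anisotropic_connection_def], THEN spec, THEN spec, THEN mp, of W V]
    assms(2-4) by simp

text \<open>The vector \<open>w\<close> is extended to a local field \<open>V\<close> with constant
  components and values in \<open>U\<close>. Then \<open>nabla\<close> along \<open>V\<close> comes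
  from a linear connection \<open>N\<close>, for which both arguments can be expanded in the frame
  \<open>E\<close>; the product rule yields the derivative term.\<close>

lemma nabla_in_frame:
  assumes nabla: "anisotropic_connection A U nabla" and U: "open_in_tangent_bundle A U"
    and v: "(p, w) \<in> U" and c: "c \<in> A" "p \<in> fst c"
    and W1: "open W1" "p \<in> W1" "\<And>i. i \<in> Basis \<Longrightarrow> E i \<in> vfields A"
    and E: "\<And>i q. i \<in> Basis \<Longrightarrow> q \<in> W1 \<Longrightarrow> E i q = coord_field A c i q"
    and XY: "X \<in> vfields A" "Y \<in> vfields A"
  shows "nabla (p, w) X Y c = frechet_derivative (\<lambda>x. Y (cinv c x) c) (at (snd c p)) (X p c)
    + (\<Sum>i\<in>Basis. \<Sum>j\<in>Basis. ((X p c \<bullet> i) * (Y p c \<bullet> j)) *\<^sub>R nabla (p, w) (E i) (E j) c)"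
proof -
  have U': "U \<subseteq> tangent_bundle A" "open (bundle_coords c U)"
    using U c by (auto simp: open_in_tangent_bundle_def)
  have w: "w \<in> tangent_space A p"
    using v U' by (auto simp: tangent_bundle_def)
  define V where "V q = tvec_of A c q (w c)" for q
  \<comment> \<open>The points over which the vector with components \<open>w c\<close> still
    belongs to \<open>U\<close>; this set is open because \<open>U\<close> is open in the tangent
    bundle.\<close>
  define S where "S = snd c ` (W1 \<inter> fst c) \<inter> (\<lambda>x. (x, w c)) -` bundle_coords c U"
  define W where "W = cinv c ` S"
  have "open S"
    unfolding S_def by (intro open_Int open_vfield_image c W1 open_vimage U' continuous_intros)
  then have oW: "open W"
    unfolding W_def by (intro open_cinv_image c) (auto simp: S_def)
  have Wsub: "W \<subseteq> fst c" "W \<subseteq> W1"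
    using c by (auto simp: W_def S_def)
  have pW: "p \<in> W"
  proof -
    have "snd c p \<in> S"
      using W1(2) c v w by (auto simp: S_def bundle_coords_iff[OF U'(1) c(1)] bundle_point_coords)
    then show ?thesis using c unfolding W_def by (metis cinv_snd imageI)
  qed
  have VU: "(q, V q) \<in> U" if "q \<in> W" for q
    using that c by (auto simp: W_def S_def V_def bundle_coords_iff[OF U'(1) c(1)] bundle_point_def)
  have "V \<in> vfields_on A W"
    unfolding V_def[abs_def] by (rule tvec_field_in_vfields_on[OF c(1) oW Wsub(1)])
  then obtain N where N: "linear_connection_on A W N"
    and nN: "\<And>X Y q. X \<in> vfields A \<Longrightarrow> Y \<in> vfields A \<Longrightarrow> q \<in> W \<Longrightarrow> nabla (q, V q) X Y = N X Y q"
    using anisotropic_connection_on[OF nabla oW _ VU] by metis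
  have Vp: "V p = w"
    using w c by (simp add: V_def tvec_of_component)
  have sub: "Z \<in> vfields_on A W" if "Z \<in> vfields A" for Z
    using vfields_on_subset[OF that] by simp
  have sm: "smooth_fun_on A W (\<lambda>q. Z q c \<bullet> k)" if "Z \<in> vfields A" for Z k
    by (rule smooth_component_fun[OF c(1) oW Wsub(1) sub[OF that]])
  have EW: "E i \<in> vfields_on A W" if "i \<in> Basis" for i
    using sub W1(3) that by blast
  have exp: "Z q = (\<Sum>i\<in>Basis. (Z q c \<bullet> i) *\<^sub>R E i q)" if "Z \<in> vfields A" "q \<in> W" for Z q
  proof -
    have q: "q \<in> fst c" "q \<in> W1" using that(2) Wsub by auto
    have "Z q = (\<Sum>i\<in>Basis. (Z q c \<bullet> i) *\<^sub>R coord_field A c i q)"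
      by (rule tangent_expand[OF vfields_on_tangent[OF that(1) UNIV_I] c(1) q(1)])
    also have "\<dots> = (\<Sum>i\<in>Basis. (Z q c \<bullet> i) *\<^sub>R E i q)"
      using E q(2) by (intro sum.cong) auto
    finally show ?thesis .
  qed
  have sumV: "(\<lambda>q. \<Sum>i\<in>Basis. (Z q c \<bullet> i) *\<^sub>R E i q) \<in> vfields_on A W" if "Z \<in> vfields A" for Z
    by (rule vfields_on_sum[OF oW EW sm[OF that]])
  have dd: "dir_deriv A p (E i p) (\<lambda>q. Y q c \<bullet> j) = frechet_derivative (\<lambda>x. Y (cinv c x) c) (at (snd c p)) i \<bullet> j"
    if "i \<in> Basis" for i j
  proof -
    have "smooth_on (snd c ` fst c) (\<lambda>x. Y (cinv c x) c)"
      by (rule vfields_on_smooth[OF XY(2) c(1)]) auto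
    from smooth_on_has_derivative[OF this, of "snd c p"]
    have "((\<lambda>x. Y (cinv c x) c) has_derivative frechet_derivative (\<lambda>x. Y (cinv c x) c) (at (snd c p))) (at (snd c p))"
      using c by auto
    then have "(((\<lambda>q. Y q c \<bullet> j) \<circ> cinv c) has_derivative
        (\<lambda>h. frechet_derivative (\<lambda>x. Y (cinv c x) c) (at (snd c p)) h \<bullet> j)) (at (snd c p))"
      unfolding o_def by (rule has_derivative_inner_left)
    note d = this
    have Ei: "E i p = tvec_of A c p i"
      using E that W1(2) by (simp add: coord_field_def)
    have "dir_deriv A p (E i p) (\<lambda>q. Y q c \<bullet> j)
        = frechet_derivative ((\<lambda>q. Y q c \<bullet> j) \<circ> cinv c) (at (snd c p)) (E i p c)"
      by (rule dir_deriv_chart[OF c]) (use d differentiable_def vfields_on_tangent[OF W1(3)[OF that]] in auto)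
    then show ?thesis
      using fun_cong[OF frechet_derivative_at[OF d], of i] Ei c by simp
  qed
  have "N X Y p = N (\<lambda>q. \<Sum>i\<in>Basis. (X q c \<bullet> i) *\<^sub>R E i q) Y p"
    by (rule conn_cong(1)[OF oW N sumV[OF XY(1)] sub[OF XY(1)] exp[OF XY(1)] sub[OF XY(2)] pW])
  also have "\<dots> = (\<Sum>i\<in>Basis. (X p c \<bullet> i) *\<^sub>R N (E i) Y p)"
    by (rule conn_sum[THEN conjunct1, OF oW N EW sm[OF XY(1)] sub[OF XY(2)] pW])
  also have "\<dots> = (\<Sum>i\<in>Basis. (X p c \<bullet> i) *\<^sub>R
      (\<Sum>j\<in>Basis. dir_deriv A p (E i p) (\<lambda>q. Y q c \<bullet> j) *\<^sub>R E j p + (Y p c \<bullet> j) *\<^sub>R N (E i) (E j) p))"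
  proof (intro sum.cong refl arg_cong2[where f = scaleR])
    fix i :: 'e assume i: "i \<in> Basis"
    have "N (E i) Y p = N (E i) (\<lambda>q. \<Sum>j\<in>Basis. (Y q c \<bullet> j) *\<^sub>R E j q) p"
      by (rule conn_cong(2)[OF oW N sumV[OF XY(2)] sub[OF XY(2)] exp[OF XY(2)] EW[OF i] pW])
    also have "\<dots> = (\<Sum>j\<in>Basis. dir_deriv A p (E i p) (\<lambda>q. Y q c \<bullet> j) *\<^sub>R E j p + (Y p c \<bullet> j) *\<^sub>R N (E i) (E j) p)"
      by (rule conn_sum[THEN conjunct2, OF oW N EW sm[OF XY(2)] EW[OF i] pW])
    finally show "N (E i) Y p = \<dots>" .
  qed
  finally have "N X Y p c = (\<Sum>i\<in>Basis. (X p c \<bullet> i) *\<^sub>R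
      (\<Sum>j\<in>Basis. dir_deriv A p (E i p) (\<lambda>q. Y q c \<bullet> j) *\<^sub>R E j p c + (Y p c \<bullet> j) *\<^sub>R N (E i) (E j) p c))"
    by (simp add: sum_fun_apply scaleR_fun_def)
  also have "\<dots> = (\<Sum>i\<in>Basis. (X p c \<bullet> i) *\<^sub>R
      (frechet_derivative (\<lambda>x. Y (cinv c x) c) (at (snd c p)) i + (\<Sum>j\<in>Basis. (Y p c \<bullet> j) *\<^sub>R N (E i) (E j) p c)))"
  proof (intro sum.cong refl arg_cong2[where f = scaleR])
    fix i :: 'e assume i: "i \<in> Basis"
    have "(\<Sum>j\<in>Basis. dir_deriv A p (E i p) (\<lambda>q. Y q c \<bullet> j) *\<^sub>R E j p c)
      = (\<Sum>j\<in>Basis. (frechet_derivative (\<lambda>x. Y (cinv c x) c) (at (snd c p)) i \<bullet> j) *\<^sub>R j)"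
      using dd[OF i] E W1(2) c by (intro sum.cong) (auto simp: coord_field_def)
    then show "(\<Sum>j\<in>Basis. dir_deriv A p (E i p) (\<lambda>q. Y q c \<bullet> j) *\<^sub>R E j p c + (Y p c \<bullet> j) *\<^sub>R N (E i) (E j) p c)
      = frechet_derivative (\<lambda>x. Y (cinv c x) c) (at (snd c p)) i + (\<Sum>j\<in>Basis. (Y p c \<bullet> j) *\<^sub>R N (E i) (E j) p c)"
      by (simp add: sum.distrib euclidean_representation)
  qed
  also have "\<dots> = frechet_derivative (\<lambda>x. Y (cinv c x) c) (at (snd c p)) (X p c)
    + (\<Sum>i\<in>Basis. \<Sum>j\<in>Basis. ((X p c \<bullet> i) * (Y p c \<bullet> j)) *\<^sub>R N (E i) (E j) p c)"
  proof -
    have "smooth_on (snd c ` fst c) (\<lambda>x. Y (cinv c x) c)"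
      by (rule vfields_on_smooth[OF XY(2) c(1)]) auto
    then have "frechet_derivative (\<lambda>x. Y (cinv c x) c) (at (snd c p)) (X p c)
        = (\<Sum>i\<in>Basis. (X p c \<bullet> i) *\<^sub>R frechet_derivative (\<lambda>x. Y (cinv c x) c) (at (snd c p)) i)"
      using c by (intro frechet_derivative_expand smooth_on_differentiable) auto
    then show ?thesis
      by (simp add: scaleR_add_right sum.distrib scaleR_sum_right)
  qed
  also have "N X Y p = nabla (p, w) X Y"
    using nN[OF XY pW] Vp by simp
  also have "(\<Sum>i\<in>Basis. \<Sum>j\<in>Basis. ((X p c \<bullet> i) * (Y p c \<bullet> j)) *\<^sub>R N (E i) (E j) p c)
      = (\<Sum>i\<in>Basis. \<Sum>j\<in>Basis. ((X p c \<bullet> i) * (Y p c \<bullet> j)) *\<^sub>R nabla (p, w) (E i) (E j) c)"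
    using nN[OF W1(3) W1(3) pW] Vp by (intro sum.cong) auto
  finally show ?thesis .
qed

text \<open>The extensions chosen inside \<open>local_nabla\<close> have constant components near
  \<open>p\<close>, so in the preceding formula the derivative term vanishes and the double sum
  reduces to one term. As \<open>E\<close> stays fixed while \<open>p\<close> varies in
  \<open>W1\<close>, the right-hand side depends smoothly on the reference vector, which is not
  visible from the choices on the left.\<close>

lemma local_nabla_coord_fields:
  assumes nabla: "anisotropic_connection A U nabla" and U: "open_in_tangent_bundle A U"
    and v: "(p, w) \<in> U" and c: "c \<in> A" "p \<in> fst c"
    and W1: "open W1" "p \<in> W1" "\<And>i. i \<in> Basis \<Longrightarrow> E i \<in> vfields A"
    and E: "\<And>i q. i \<in> Basis \<Longrightarrow> q \<in> W1 \<Longrightarrow> E i q = coord_field A c i q"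
    and ij: "i \<in> Basis" "j \<in> Basis"
  shows "local_nabla A nabla (p, w) (coord_field A c i) (coord_field A c j) c = nabla (p, w) (E i) (E j) c"
proof -
  define X where "X k = global_extension A p (coord_field A c k)" for k
  note ext = global_extension[OF coord_field_in_vfields_on[OF c(1)] open_dom[OF c(1)] c(2)]
  have X: "X k \<in> vfields A" for k
    using ext(1) by (simp add: X_def)
  have Xc: "\<exists>W. open W \<and> p \<in> W \<and> W \<subseteq> fst c \<and> (\<forall>q\<in>W. X k q c = k)" for k
  proof -
    obtain W where "open W" "p \<in> W" "\<forall>q\<in>W. X k q = coord_field A c k q"
      using ext(2) X_def by metis
    then show ?thesis
      using open_Int_dom[OF c(1), of W] c by (intro exI[of _ "W \<inter> fst c"]) (auto simp: coord_field_def)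
  qed
  have Xp: "X k p c = k" for k
    using Xc by blast
  have 0: "frechet_derivative (\<lambda>x. X j (cinv c x) c) (at (snd c p)) h = 0" for h
  proof -
    obtain W where W: "open W" "p \<in> W" "W \<subseteq> fst c" "\<forall>q\<in>W. X j q c = j"
      using Xc by blast
    have "((\<lambda>x. X j (cinv c x) c) has_derivative (\<lambda>h. 0)) (at (snd c p))"
      by (rule has_derivative_transform_within_open[OF has_derivative_const[of j] open_chart_image[OF c(1) W(1,3)]])
         (use W c in \<open>auto simp: subset_iff\<close>)
    from fun_cong[OF frechet_derivative_at[OF this], of h] show ?thesis by simp
  qed
  have "local_nabla A nabla (p, w) (coord_field A c i) (coord_field A c j) c = nabla (p, w) (X i) (X j) c"
    by (simp add: local_nabla_def X_def)
  also have "\<dots> = (\<Sum>i'\<in>Basis. \<Sum>j'\<in>Basis. ((i \<bullet> i') * (j \<bullet> j')) *\<^sub>R nabla (p, w) (E i') (E j') c)"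
    using nabla_in_frame[OF nabla U v c W1 E X X, of i j] by (simp add: Xp 0)
  also have "\<dots> = nabla (p, w) (E i) (E j) c"
    by (simp only: scaleR_scaleR[symmetric] scaleR_sum_right[symmetric] sum_inner_Basis_scaleR[OF ij(1)]
        sum_inner_Basis_scaleR[OF ij(2)])
  finally show ?thesis .
qed

lemma nabla_coordinates:
  assumes nabla: "anisotropic_connection A U nabla" and U: "open_in_tangent_bundle A U"
    and v: "(p, w) \<in> U" and c: "c \<in> A" "p \<in> fst c" and XY: "X \<in> vfields A" "Y \<in> vfields A"
  shows "nabla (p, w) X Y c = frechet_derivative (\<lambda>x. Y (cinv c x) c) (at (snd c p)) (X p c)
    + (\<Sum>i\<in>Basis. \<Sum>j\<in>Basis. ((X p c \<bullet> i) * (Y p c \<bullet> j)) *\<^sub>R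
         local_nabla A nabla (p, w) (coord_field A c i) (coord_field A c j) c)"
proof -
  obtain E W1 where E: "open W1" "p \<in> W1" "W1 \<subseteq> fst c" "\<And>i. i \<in> Basis \<Longrightarrow> E i \<in> vfields A"
    "\<And>i q. i \<in> Basis \<Longrightarrow> q \<in> W1 \<Longrightarrow> E i q = coord_field A c i q"
    using coord_frame_extension[OF c] by metis
  show ?thesis
    using nabla_in_frame[OF nabla U v c E(1,2,4,5) XY] local_nabla_coord_fields[OF nabla U v c E(1,2,4,5)]
    by simp
qed


section \<open>Velocity and covariant acceleration\<close>

lemma open_curve_preimage:
  assumes "smooth_curve A I \<gamma>" "open W"
  shows "open {t \<in> I. \<gamma> t \<in> W}"
proof -
  have "open (\<gamma> -` W \<inter> I)"
    using assms continuous_on_open_vimage[of I \<gamma>] by (auto simp: smooth_curve_def)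
  then show ?thesis
    by (simp add: vimage_def Int_def conj_commute)
qed

lemma curve_coords_smooth:
  "smooth_curve A I \<gamma> \<Longrightarrow> c \<in> A \<Longrightarrow> smooth_on {t \<in> I. \<gamma> t \<in> fst c} (snd c \<circ> \<gamma>)"
  by (simp add: smooth_curve_def)

lemma velocity_has_vector_derivative:
  assumes "smooth_curve A I \<gamma>" "t \<in> I" "c \<in> A" "\<gamma> t \<in> fst c"
  shows "((snd c \<circ> \<gamma>) has_vector_derivative velocity A \<gamma> t c) (at t)"
proof -
  have "(snd c \<circ> \<gamma>) differentiable (at t)"
    by (rule smooth_on_differentiable[OF curve_coords_smooth[OF assms(1,3)]]) (use assms in auto)
  then show ?thesis
    using assms by (simp add: velocity_def vector_derivative_works)
qed

lemma velocity_smooth: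
  assumes "smooth_curve A I \<gamma>" "c \<in> A"
  shows "smooth_on {t \<in> I. \<gamma> t \<in> fst c} (\<lambda>t. velocity A \<gamma> t c)"
proof (rule smooth_on_cong)
  show "open {t \<in> I. \<gamma> t \<in> fst c}"
    by (rule open_curve_preimage[OF assms(1) open_dom[OF assms(2)]])
  show "smooth_on {t \<in> I. \<gamma> t \<in> fst c} (\<lambda>t. frechet_derivative (snd c \<circ> \<gamma>) (at t) 1)"
    by (rule smooth_on_frechet[OF curve_coords_smooth[OF assms]])
  fix t assume "t \<in> {t \<in> I. \<gamma> t \<in> fst c}"
  then have "((snd c \<circ> \<gamma>) has_vector_derivative velocity A \<gamma> t c) (at t)"
    using velocity_has_vector_derivative assms by auto
  then have "((snd c \<circ> \<gamma>) has_derivative (\<lambda>h. h *\<^sub>R velocity A \<gamma> t c)) (at t)"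
    by (simp add: has_vector_derivative_def)
  from fun_cong[OF frechet_derivative_at[OF this], of 1]
  show "frechet_derivative (snd c \<circ> \<gamma>) (at t) 1 = velocity A \<gamma> t c" by simp
qed

lemma velocity_in_tangent_space:
  assumes \<gamma>: "smooth_curve A I \<gamma>" and t: "t \<in> I"
  shows "velocity A \<gamma> t \<in> tangent_space A (\<gamma> t)"
  unfolding tangent_space_def
proof (intro CollectI conjI allI ballI impI)
  show "velocity A \<gamma> t c = 0" if "\<not> (c \<in> A \<and> \<gamma> t \<in> fst c)" for c
    using that by (auto simp: velocity_def)
  fix c d assume cd: "c \<in> A" "d \<in> A" "\<gamma> t \<in> fst c" "\<gamma> t \<in> fst d"
  have 1: "((snd c \<circ> \<gamma>) has_derivative (\<lambda>h. h *\<^sub>R velocity A \<gamma> t c)) (at t)"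
    using velocity_has_vector_derivative[OF \<gamma> t cd(1,3)] by (simp add: has_vector_derivative_def)
  have 2: "((snd d \<circ> cinv c) has_derivative jacobian c d (\<gamma> t)) (at ((snd c \<circ> \<gamma>) t))"
    using jacobian_has_derivative[OF cd] by simp
  have "((snd d \<circ> cinv c \<circ> (snd c \<circ> \<gamma>)) has_derivative jacobian c d (\<gamma> t) \<circ> (\<lambda>h. h *\<^sub>R velocity A \<gamma> t c)) (at t)"
    by (rule diff_chain_at[OF 1 2])
  then have "((snd d \<circ> \<gamma>) has_derivative jacobian c d (\<gamma> t) \<circ> (\<lambda>h. h *\<^sub>R velocity A \<gamma> t c)) (at t)"
    by (rule has_derivative_transform_within_open[OF _ open_curve_preimage[OF \<gamma> open_dom[OF cd(1)]]])
       (use t cd in auto)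
  then have "((snd d \<circ> \<gamma>) has_vector_derivative jacobian c d (\<gamma> t) (velocity A \<gamma> t c)) (at t)"
    using linear_cmul[OF linear_jacobian[OF cd]] by (simp add: has_vector_derivative_def o_def)
  then show "velocity A \<gamma> t d = jacobian c d (\<gamma> t) (velocity A \<gamma> t c)"
    using velocity_has_vector_derivative[OF \<gamma> t cd(2,4)] vector_derivative_unique_at by blast
qed

text \<open>The coordinate acceleration in each chart. Despite its type it is in general not a
  tangent vector, since second derivatives also involve the derivative of the Jacobian; the
  Christoffel terms compensate for this.\<close>

definition accel :: "(real \<Rightarrow> 'm) \<Rightarrow> real \<Rightarrow> ('m, 'e) tvec" where
  "accel \<gamma> t c = vector_derivative (\<lambda>s. velocity A \<gamma> s c) (at t)"

lemma accel_has_vector_derivative: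
  assumes "smooth_curve A I \<gamma>" "t \<in> I" "c \<in> A" "\<gamma> t \<in> fst c"
  shows "((\<lambda>s. velocity A \<gamma> s c) has_vector_derivative accel \<gamma> t c) (at t)"
proof -
  have "(\<lambda>s. velocity A \<gamma> s c) differentiable (at t)"
    by (rule smooth_on_differentiable[OF velocity_smooth[OF assms(1,3)]]) (use assms in auto)
  then show ?thesis
    by (simp add: accel_def vector_derivative_works)
qed

lemma covariant_derivative_velocity:
  assumes \<gamma>: "smooth_curve A I \<gamma>" "t \<in> I" and c: "c \<in> A" "\<gamma> t \<in> fst c"
  shows "covariant_derivative A nabla \<gamma> (velocity A \<gamma>) t c = accel \<gamma> t c
    + (\<Sum>i\<in>Basis. \<Sum>j\<in>Basis. ((velocity A \<gamma> t c \<bullet> i) * (velocity A \<gamma> t c \<bullet> j)) *\<^sub>R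
         local_nabla A nabla (canonical_lift A \<gamma> t) (coord_field A c i) (coord_field A c j) c)"
    (is "_ = _ + ?S")
proof -
  have "((\<lambda>s. velocity A \<gamma> s c \<bullet> k) has_vector_derivative accel \<gamma> t c \<bullet> k) (at t)" for k
    using bounded_linear.has_vector_derivative[OF bounded_linear_inner_left accel_has_vector_derivative[OF \<gamma> c]] .
  then have d: "deriv (\<lambda>s. velocity A \<gamma> s c \<bullet> k) t = accel \<gamma> t c \<bullet> k" for k
    by (intro DERIV_imp_deriv) (simp add: has_real_derivative_iff_has_vector_derivative)
  have "covariant_derivative A nabla \<gamma> (velocity A \<gamma>) t c = (\<Sum>k\<in>Basis. ((accel \<gamma> t c + ?S) \<bullet> k) *\<^sub>R k)"
    using c by (auto simp: covariant_derivative_def d inner_add_left inner_sum_left christoffel_def mult_ac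
        intro!: sum.cong)
  then show ?thesis by (simp only: euclidean_representation)
qed

text \<open>The term containing the derivative of the Jacobian drops out because \<open>\<delta> t = 0\<close>.\<close>

lemma vanishing_field_derivative:
  assumes \<gamma>: "smooth_curve A I \<gamma>" "t \<in> I" and c: "c \<in> A" "\<gamma> t \<in> fst c" and d: "d \<in> A" "\<gamma> t \<in> fst d"
    and \<delta>: "\<And>s. s \<in> I \<Longrightarrow> \<delta> s \<in> tangent_space A (\<gamma> s)" "\<delta> t = 0"
    and a: "((\<lambda>s. \<delta> s c) has_vector_derivative a) (at t)"
  shows "((\<lambda>s. \<delta> s d) has_vector_derivative jacobian c d (\<gamma> t) a) (at t)"
proof -
  define T where "T = {s \<in> I. \<gamma> s \<in> fst c \<inter> fst d}"
  have T: "open T" "t \<in> T"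
    unfolding T_def using open_curve_preimage[OF \<gamma>(1), of "fst c \<inter> fst d"] open_Int_dom[OF d(1) open_dom[OF c(1)]]
      \<gamma> c d by auto
  have o: "open (snd c ` (fst c \<inter> fst d))"
    by (rule open_chart_image[OF c(1) open_Int_dom[OF d(1) open_dom[OF c(1)]]]) auto
  define Jb where "Jb b s = frechet_derivative (snd d \<circ> cinv c) (at ((snd c \<circ> \<gamma>) s)) b" for b s
  have "smooth_on T (snd c \<circ> \<gamma>)"
    by (rule smooth_on_subset[OF curve_coords_smooth[OF \<gamma>(1) c(1)]]) (auto simp: T_def)
  then have "smooth_on T (Jb b)" for b
    unfolding Jb_def
    by (rule smooth_on_compose[OF smooth_on_frechet[OF smooth_transition[OF c(1) d(1)]] T(1) o, rotated])
       (auto simp: T_def)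
  then have "(Jb b has_vector_derivative vector_derivative (Jb b) (at t)) (at t)" for b
    using smooth_on_differentiable T(2) by (subst vector_derivative_works[symmetric]) blast
  note dJb = this
  have eq: "\<delta> s d = (\<Sum>b\<in>Basis. (\<delta> s c \<bullet> b) *\<^sub>R Jb b s)" if "s \<in> T" for s
  proof -
    have s: "s \<in> I" "\<gamma> s \<in> fst c" "\<gamma> s \<in> fst d" using that by (auto simp: T_def)
    have "\<delta> s d = jacobian c d (\<gamma> s) (\<delta> s c)"
      by (rule tangent_spaceD[OF \<delta>(1)[OF s(1)] c(1) d(1) s(2,3)])
    also have "\<dots> = (\<Sum>b\<in>Basis. (\<delta> s c \<bullet> b) *\<^sub>R jacobian c d (\<gamma> s) b)"
      by (rule linear_expand[OF linear_jacobian[OF c(1) d(1) s(2,3)]])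
    finally show ?thesis by (simp add: jacobian_def Jb_def)
  qed
  have "((\<lambda>s. \<delta> s c \<bullet> b) has_vector_derivative a \<bullet> b) (at t)" for b
    using bounded_linear.has_vector_derivative[OF bounded_linear_inner_left a] .
  then have "((\<lambda>s. (\<delta> s c \<bullet> b) *\<^sub>R Jb b s) has_vector_derivative (a \<bullet> b) *\<^sub>R Jb b t) (at t)" for b
    using has_vector_derivative_scaleR[OF _ dJb, of "\<lambda>s. \<delta> s c \<bullet> b" "a \<bullet> b" b] \<delta>(2)
    by (simp add: has_real_derivative_iff_has_vector_derivative)
  then have "((\<lambda>s. \<Sum>b\<in>Basis. (\<delta> s c \<bullet> b) *\<^sub>R Jb b s) has_vector_derivative (\<Sum>b\<in>Basis. (a \<bullet> b) *\<^sub>R Jb b t)) (at t)"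
    by (intro has_vector_derivative_sum)
  then have "((\<lambda>s. \<delta> s d) has_vector_derivative (\<Sum>b\<in>Basis. (a \<bullet> b) *\<^sub>R Jb b t)) (at t)"
    by (rule has_vector_derivative_transform_within_open[OF _ T]) (simp add: eq)
  moreover have "(\<Sum>b\<in>Basis. (a \<bullet> b) *\<^sub>R Jb b t) = jacobian c d (\<gamma> t) a"
    using linear_expand[OF linear_jacobian[OF c(1) d(1) c(2) d(2)], of a] by (simp add: jacobian_def Jb_def)
  ultimately show ?thesis by simp
qed

text \<open>If \<open>X\<close> is a vector field whose value at \<open>\<gamma> t\<close> is the velocity there, then the covariant
  acceleration is the sum of \<open>\<nabla>\<^sub>X X\<close> and of the derivative at \<open>t\<close> of \<open>\<gamma>' - X \<circ> \<gamma>\<close>, and both are tangent.\<close>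

lemma covariant_derivative_in_tangent_space:
  assumes nabla: "anisotropic_connection A U nabla" and U: "open_in_tangent_bundle A U"
    and \<gamma>: "smooth_curve A I \<gamma>" "t \<in> I" and lift: "canonical_lift A \<gamma> t \<in> U"
  shows "covariant_derivative A nabla \<gamma> (velocity A \<gamma>) t \<in> tangent_space A (\<gamma> t)"
proof -
  define v where "v = velocity A \<gamma> t"
  define p where "p = \<gamma> t"
  have v: "v \<in> tangent_space A p" "(p, v) \<in> U"
    using velocity_in_tangent_space[OF \<gamma>] lift by (auto simp: v_def p_def)
  obtain c0 where c0: "c0 \<in> A" "p \<in> fst c0" by (rule ex_chart)
  \<comment> \<open>All that matters is a global field with value \<open>v\<close> at
    \<open>p\<close>; constant components in one chart provide it.\<close>
  obtain X W where X: "X \<in> vfields A" and W: "open W" "p \<in> W" "\<And>q. q \<in> W \<Longrightarrow> X q = coord_field A c0 (v c0) q"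
    using vfields_on_extend[OF coord_field_in_vfields_on[OF c0(1)] open_dom[OF c0(1)] c0(2)] by metis
  have Xp: "X p = v"
    using W v c0 by (simp add: coord_field_def tvec_of_component)
  define \<delta> where "\<delta> s = velocity A \<gamma> s - X (\<gamma> s)" for s
  define \<kappa> where "\<kappa> c = accel \<gamma> t c - frechet_derivative (\<lambda>x. X (cinv c x) c) (at (snd c p)) (v c)" for c
  have d\<delta>: "((\<lambda>s. \<delta> s c) has_vector_derivative \<kappa> c) (at t)" if c: "c \<in> A" "p \<in> fst c" for c
  proof -
    have c': "\<gamma> t \<in> fst c" using c by (simp add: p_def)
    have "smooth_on (snd c ` fst c) (\<lambda>x. X (cinv c x) c)"
      by (rule vfields_on_smooth[OF X c(1)]) auto
    then have 1: "((\<lambda>x. X (cinv c x) c) has_derivative frechet_derivative (\<lambda>x. X (cinv c x) c) (at (snd c p)))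
        (at ((snd c \<circ> \<gamma>) t))"
      using smooth_on_has_derivative[of "snd c ` fst c" _ "snd c p"] c by (simp add: p_def)
    have "((snd c \<circ> \<gamma>) has_vector_derivative v c) (at t)"
      using velocity_has_vector_derivative[OF \<gamma> c(1) c'] by (simp add: v_def)
    from vector_derivative_diff_chain_within[OF this has_derivative_at_withinI[OF 1]]
    have "(((\<lambda>x. X (cinv c x) c) \<circ> (snd c \<circ> \<gamma>)) has_vector_derivative
        frechet_derivative (\<lambda>x. X (cinv c x) c) (at (snd c p)) (v c)) (at t)" .
    then have "((\<lambda>s. X (\<gamma> s) c) has_vector_derivative
        frechet_derivative (\<lambda>x. X (cinv c x) c) (at (snd c p)) (v c)) (at t)"
      by (rule has_vector_derivative_transform_within_open[OF _ open_curve_preimage[OF \<gamma>(1) open_dom[OF c(1)]]])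
         (use \<gamma> c c' in auto)
    from has_vector_derivative_diff[OF accel_has_vector_derivative[OF \<gamma> c(1) c'] this]
    show ?thesis by (simp add: \<delta>_def \<kappa>_def)
  qed
  have \<delta>T: "\<delta> s \<in> tangent_space A (\<gamma> s)" if "s \<in> I" for s
    unfolding \<delta>_def
    by (intro subspace_diff subspace_tangent_space velocity_in_tangent_space[OF \<gamma>(1) that] vfields_on_tangent[OF X]) simp
  have \<kappa>: "\<kappa> d = jacobian c d p (\<kappa> c)" if "c \<in> A" "d \<in> A" "p \<in> fst c" "p \<in> fst d" for c d
  proof -
    have "((\<lambda>s. \<delta> s d) has_vector_derivative jacobian c d (\<gamma> t) (\<kappa> c)) (at t)"
      by (rule vanishing_field_derivative[OF \<gamma> _ _ _ _ \<delta>T _ d\<delta>])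
         (use that Xp in \<open>auto simp: p_def \<delta>_def v_def\<close>)
    then show ?thesis
      using d\<delta>[of d] that vector_derivative_unique_at unfolding p_def by blast
  qed
  have "nabla (p, v) X X \<in> tangent_space A p"
    using nabla X v(2) unfolding anisotropic_connection_def anisotropic_vfield_def by fastforce
  note nab = this
  \<comment> \<open>The derivative of \<open>X\<close> along \<open>v\<close> is subtracted in
    \<open>\<kappa>\<close> and added in the coordinate formula for \<open>nabla\<close>, and the
    Christoffel terms agree since \<open>X p = v\<close>. This takes the place of the transformation
    law of the Christoffel symbols.\<close>
  have cov: "covariant_derivative A nabla \<gamma> (velocity A \<gamma>) t c = \<kappa> c + nabla (p, v) X X c"
    if c: "c \<in> A" "p \<in> fst c" for c
    using covariant_derivative_velocity[OF \<gamma> c(1), of nabla] c nabla_coordinates[OF nabla U v(2) c X X]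
    unfolding Xp by (simp add: \<kappa>_def v_def p_def)
  show ?thesis
    unfolding tangent_space_def
  proof (intro CollectI conjI allI ballI impI)
    show "covariant_derivative A nabla \<gamma> (velocity A \<gamma>) t c = 0" if "\<not> (c \<in> A \<and> \<gamma> t \<in> fst c)" for c
      using that by (auto simp: covariant_derivative_def)
    fix c d assume cd: "c \<in> A" "d \<in> A" "\<gamma> t \<in> fst c" "\<gamma> t \<in> fst d"
    note cd' = cd[folded p_def]
    show "covariant_derivative A nabla \<gamma> (velocity A \<gamma>) t d
        = jacobian c d (\<gamma> t) (covariant_derivative A nabla \<gamma> (velocity A \<gamma>) t c)"
      using cov[OF cd'(1,3)] cov[OF cd'(2,4)] \<kappa>[OF cd'] tangent_spaceD[OF nab cd']
        linear_add[OF linear_jacobian[OF cd']] unfolding p_def by metis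
  qed
qed

end

section \<open>The fundamental tensor in coordinates\<close>

text \<open>The direction \<open>b\<close> belongs to the inner derivative, whose linearity holds at
  every point of the open set \<open>S\<close> and can therefore be differentiated once more.
  Together with linearity in the outer direction this makes the Hessian bilinear without an appeal
  to its symmetry.\<close>

lemma linear_frechet_in_direction:
  fixes f :: "'a::real_normed_vector \<Rightarrow> 'b::real_normed_vector"
  assumes S: "open S" "z0 \<in> S" and f: "smooth_on S f"
  shows "linear (\<lambda>b. frechet_derivative (\<lambda>z. frechet_derivative f (at z) b) (at z0) a)"
proof -
  have lin: "linear (frechet_derivative f (at z))" if "z \<in> S" for z
    using smooth_on_differentiable[OF f that] linear_frechet_derivative by blast
  note d = smooth_on_has_derivative[OF smooth_on_frechet[OF f] S(2)]
  show ?thesis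
  proof (rule linearI)
    fix b1 b2
    have "((\<lambda>z. frechet_derivative f (at z) (b1 + b2)) has_derivative
        (\<lambda>a. frechet_derivative (\<lambda>z. frechet_derivative f (at z) b1) (at z0) a
          + frechet_derivative (\<lambda>z. frechet_derivative f (at z) b2) (at z0) a)) (at z0)"
      by (rule has_derivative_transform_within_open[OF has_derivative_add[OF d d] S])
         (simp add: linear_add[OF lin])
    from fun_cong[OF frechet_derivative_at[OF this], of a]
    show "frechet_derivative (\<lambda>z. frechet_derivative f (at z) (b1 + b2)) (at z0) a =
        frechet_derivative (\<lambda>z. frechet_derivative f (at z) b1) (at z0) a
        + frechet_derivative (\<lambda>z. frechet_derivative f (at z) b2) (at z0) a" by simp
  next
    fix r b
    have "((\<lambda>z. frechet_derivative f (at z) (r *\<^sub>R b)) has_derivative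
        (\<lambda>a. r *\<^sub>R frechet_derivative (\<lambda>z. frechet_derivative f (at z) b) (at z0) a)) (at z0)"
      by (rule has_derivative_transform_within_open[OF has_derivative_scaleR_right[OF d] S])
         (simp add: linear_cmul[OF lin])
    from fun_cong[OF frechet_derivative_at[OF this], of a]
    show "frechet_derivative (\<lambda>z. frechet_derivative f (at z) (r *\<^sub>R b)) (at z0) a =
        r *\<^sub>R frechet_derivative (\<lambda>z. frechet_derivative f (at z) b) (at z0) a" by simp
  qed
qed

text \<open>Half the fibrewise Hessian of \<open>L\<close> in the bundle chart: directions
  \<open>(0, a)\<close> move the vector and keep its base point. The order of differentiation is
  that of \<open>fundamental_tensor\<close>, with \<open>b\<close> inside and \<open>a\<close>
  outside.\<close>

definition tensor_coords ::
  "('m, 'e::euclidean_space) chart set \<Rightarrow> (('m, 'e) tpoint \<Rightarrow> real) \<Rightarrow> ('m, 'e) chart \<Rightarrow>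
   'e \<times> 'e \<Rightarrow> 'e \<Rightarrow> 'e \<Rightarrow> real" where
  "tensor_coords A L c z a b =
     1/2 * frechet_derivative (\<lambda>z. frechet_derivative (\<lambda>z. L (bundle_point A c z)) (at z) (0, b)) (at z) (0, a)"

locale finsler = atlas +
  fixes U :: "('a, 'b) tpoint set" and L :: "('a, 'b) tpoint \<Rightarrow> real"
  assumes finsler: "conic_pseudo_finsler A U L"
begin

lemma open_U: "open_in_tangent_bundle A U"
  using finsler by (simp add: conic_pseudo_finsler_def)

lemma U_tangent: "(p, w) \<in> U \<Longrightarrow> w \<in> tangent_space A p"
  using open_U by (auto simp: open_in_tangent_bundle_def tangent_bundle_def)

lemma coords_in: "(p, w) \<in> U \<Longrightarrow> p \<in> fst c \<Longrightarrow> (snd c p, w c) \<in> bundle_coords c U"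
  by (force simp: bundle_coords_def)

lemma open_bundle_coords: "c \<in> A \<Longrightarrow> open (bundle_coords c U)"
  using open_U by (simp add: open_in_tangent_bundle_def)

lemma smooth_L: "c \<in> A \<Longrightarrow> smooth_on (bundle_coords c U) (\<lambda>z. L (bundle_point A c z))"
  using finsler by (simp add: conic_pseudo_finsler_def)

lemma tensor_coords_bilinear:
  assumes "c \<in> A" "z \<in> bundle_coords c U"
  shows "linear (\<lambda>a. tensor_coords A L c z a b)" "linear (\<lambda>b. tensor_coords A L c z a b)"
proof -
  have l: "linear (\<lambda>b. (0::'b, b::'b))"
    by (rule linearI) auto
  have "linear (frechet_derivative (\<lambda>z. frechet_derivative (\<lambda>z. L (bundle_point A c z)) (at z) (0, b)) (at z))"
    by (rule linear_frechet_derivative[OF smooth_on_differentiable[OF smooth_on_frechet[OF smooth_L[OF assms(1)]] assms(2)]])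
  from linear_compose[OF l this]
  show "linear (\<lambda>a. tensor_coords A L c z a b)"
    unfolding tensor_coords_def o_def by (rule linear_compose_scale_right[where 'b = real, unfolded real_scaleR_def])
  from linear_compose[OF l linear_frechet_in_direction[OF open_bundle_coords[OF assms(1)] assms(2) smooth_L[OF assms(1)], of "(0, a)"]]
  show "linear (\<lambda>b. tensor_coords A L c z a b)"
    unfolding tensor_coords_def o_def by (rule linear_compose_scale_right[where 'b = real, unfolded real_scaleR_def])
qed

text \<open>Point and both arguments move with \<open>s\<close>; bilinearity reduces this to the
  entries at fixed basis vectors, which are second partial derivatives of \<open>L\<close>.\<close>

lemma tensor_coords_smooth:
  fixes u :: "'x::real_normed_vector \<Rightarrow> 'b \<times> 'b"
  assumes c: "c \<in> A" and S: "open S" and u: "smooth_on S u" "\<And>s. s \<in> S \<Longrightarrow> u s \<in> bundle_coords c U"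
    and a: "smooth_on S a" and b: "smooth_on S b"
  shows "smooth_on S (\<lambda>s. tensor_coords A L c (u s) (a s) (b s))"
proof (rule smooth_on_cong[OF S])
  show "smooth_on S (\<lambda>s. \<Sum>i\<in>Basis. (a s \<bullet> i) *\<^sub>R (\<Sum>j\<in>Basis. (b s \<bullet> j) *\<^sub>R tensor_coords A L c (u s) i j))"
  proof (intro smooth_on_sum smooth_on_scaleR smooth_on_inner S a b smooth_on_const)
    fix i j :: 'b
    have "smooth_on (bundle_coords c U) (\<lambda>z. tensor_coords A L c z i j)"
      unfolding tensor_coords_def
      by (intro smooth_on_mult open_bundle_coords c smooth_on_const smooth_on_frechet smooth_L)
    then show "smooth_on S (\<lambda>s. tensor_coords A L c (u s) i j)"
      by (rule smooth_on_compose[OF _ S open_bundle_coords[OF c] u(2) u(1)])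
  qed
  fix s assume "s \<in> S"
  note lin = tensor_coords_bilinear[OF c u(2)[OF \<open>s \<in> S\<close>]]
  show "(\<Sum>i\<in>Basis. (a s \<bullet> i) *\<^sub>R (\<Sum>j\<in>Basis. (b s \<bullet> j) *\<^sub>R tensor_coords A L c (u s) i j))
      = tensor_coords A L c (u s) (a s) (b s)"
    using linear_expand[OF lin(1), of "a s" "b s"] linear_expand[OF lin(2), of _ "b s"] by simp
qed

lemma fundamental_tensor_coords:
  assumes v: "(p, w) \<in> U" and c: "c \<in> A" "p \<in> fst c"
    and u: "u \<in> tangent_space A p" "u' \<in> tangent_space A p"
  shows "fundamental_tensor L (p, w) u u' = tensor_coords A L c (snd c p, w c) (u c) (u' c)"
proof -
  define Lc where "Lc = (\<lambda>z. L (bundle_point A c z))"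
  note sm = smooth_L[OF c(1), folded Lc_def]
  define x where "x = snd c p"
  \<comment> \<open>The inner derivative is evaluated only while the vector stays in
    \<open>U\<close>; this open set of parameters contains 0, where the outer derivative is
    taken.\<close>
  define Tt where "Tt = (\<lambda>t::real. (x, w c + t *\<^sub>R u c)) -` bundle_coords c U"
  have Tt: "open Tt" "0 \<in> Tt"
    using coords_in[OF v c(2)] open_bundle_coords[OF c(1)]
    by (auto simp: Tt_def x_def intro!: open_vimage continuous_intros)
  have L: "L (p, w + t *\<^sub>R u + s *\<^sub>R u') = Lc (x, w c + t *\<^sub>R u c + s *\<^sub>R u' c)" for t s
  proof -
    have "w + t *\<^sub>R u + s *\<^sub>R u' \<in> tangent_space A p"
      by (intro subspace_add subspace_scale subspace_tangent_space u U_tangent[OF v])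
    from bundle_point_coords[OF this c] show ?thesis
      by (simp add: Lc_def x_def scaleR_fun_def)
  qed
  have 1: "deriv (\<lambda>s. L (p, w + t *\<^sub>R u + s *\<^sub>R u')) 0 = frechet_derivative Lc (at (x, w c + t *\<^sub>R u c)) (0, u' c)"
    if "t \<in> Tt" for t
  proof -
    have z: "(x, w c + t *\<^sub>R u c) \<in> bundle_coords c U"
      using that by (simp add: Tt_def)
    have i: "((\<lambda>s. (x, w c + t *\<^sub>R u c + s *\<^sub>R u' c)) has_vector_derivative (0, u' c)) (at (0::real))"
      by (auto intro!: derivative_eq_intros has_vector_derivative_Pair)
    have "(Lc has_derivative frechet_derivative Lc (at (x, w c + t *\<^sub>R u c))) (at (x, w c + t *\<^sub>R u c + 0 *\<^sub>R u' c))"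
      using smooth_on_has_derivative[OF sm z] by simp
    from vector_derivative_diff_chain_within[OF i has_derivative_at_withinI[OF this]]
    show ?thesis
      unfolding L o_def by (intro DERIV_imp_deriv) (simp add: has_real_derivative_iff_has_vector_derivative)
  qed
  have "((\<lambda>t. (x, w c + t *\<^sub>R u c)) has_vector_derivative (0, u c)) (at (0::real))"
    by (auto intro!: derivative_eq_intros has_vector_derivative_Pair)
  moreover have "((\<lambda>z. frechet_derivative Lc (at z) (0, u' c)) has_derivative
      frechet_derivative (\<lambda>z. frechet_derivative Lc (at z) (0, u' c)) (at (x, w c))) (at (x, w c + 0 *\<^sub>R u c))"
    using smooth_on_has_derivative[OF smooth_on_frechet[OF sm]] coords_in[OF v c(2)] by (simp add: x_def)
  ultimately have "((\<lambda>t. frechet_derivative Lc (at (x, w c + t *\<^sub>R u c)) (0, u' c)) has_vector_derivative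
      frechet_derivative (\<lambda>z. frechet_derivative Lc (at z) (0, u' c)) (at (x, w c)) (0, u c)) (at (0::real))"
    using vector_derivative_diff_chain_within[OF _ has_derivative_at_withinI] unfolding o_def by blast
  then have "((\<lambda>t. deriv (\<lambda>s. L (p, w + t *\<^sub>R u + s *\<^sub>R u')) 0) has_vector_derivative
      frechet_derivative (\<lambda>z. frechet_derivative Lc (at z) (0, u' c)) (at (x, w c)) (0, u c)) (at (0::real))"
    by (rule has_vector_derivative_transform_within_open[OF _ Tt]) (simp add: 1)
  then have "deriv (\<lambda>t. deriv (\<lambda>s. L (p, w + t *\<^sub>R u + s *\<^sub>R u')) 0) 0
      = frechet_derivative (\<lambda>z. frechet_derivative Lc (at z) (0, u' c)) (at (x, w c)) (0, u c)"
    by (intro DERIV_imp_deriv) (simp add: has_real_derivative_iff_has_vector_derivative)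
  then show ?thesis
    by (simp add: fundamental_tensor_def tensor_coords_def Lc_def x_def)
qed

end

section \<open>Frames of the constraint\<close>

text \<open>A basis extracted from the family has as many elements as the index set, by the
  dimension hypothesis. Since the image of the family lies between them in size, nothing was
  discarded and no value was repeated.\<close>

lemma span_of_full_dimension:
  fixes f :: "'i \<Rightarrow> 'v::real_vector"
  assumes I: "finite I" and dim: "dim (span (f ` I)) = card I"
  shows "inj_on f I" "independent (f ` I)"
proof -
  obtain B where B: "B \<subseteq> f ` I" "independent B" "f ` I \<subseteq> span B"
    using maximal_independent_subset by blast
  have "span B = span (f ` I)"
    using span_mono[OF B(1)] span_minimal[OF B(3)] by auto
  then have "card B = card I"
    using dim_eq_card[of B "span (f ` I)"] B(2) dim by (simp add: span_span)
  moreover have "card B \<le> card (f ` I)"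
    using B(1) I by (intro card_mono) auto
  moreover have "card (f ` I) \<le> card I"
    using I by (rule card_image_le)
  ultimately have *: "card (f ` I) = card I" "card B = card (f ` I)" by auto
  show "inj_on f I"
    using I *(1) by (rule eq_card_imp_inj_on)
  have "B = f ` I"
    using B(1) I *(2) by (intro card_subset_eq) auto
  then show "independent (f ` I)" using B(2) by simp
qed

lemma span_image_eq_range:
  fixes f :: "'i \<Rightarrow> 'v::real_vector"
  assumes I: "finite I" and inj: "inj_on f I"
  shows "span (f ` I) = range (\<lambda>k. \<Sum>i\<in>I. k i *\<^sub>R f i)"
proof
  show "span (f ` I) \<subseteq> range (\<lambda>k. \<Sum>i\<in>I. k i *\<^sub>R f i)"
  proof
    fix x assume "x \<in> span (f ` I)"
    then obtain u where "x = (\<Sum>v\<in>f ` I. u v *\<^sub>R v)"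
      using span_finite[of "f ` I"] I by auto
    then have "x = (\<Sum>i\<in>I. (u \<circ> f) i *\<^sub>R f i)"
      using sum.reindex[OF inj] by simp
    then show "x \<in> range (\<lambda>k. \<Sum>i\<in>I. k i *\<^sub>R f i)" by blast
  qed
  show "range (\<lambda>k. \<Sum>i\<in>I. k i *\<^sub>R f i) \<subseteq> span (f ` I)"
    by (intro image_subsetI span_sum span_scale span_base imageI)
qed

lemma independent_image_coeffs:
  fixes f :: "'i \<Rightarrow> 'v::real_vector"
  assumes I: "finite I" and inj: "inj_on f I" and ind: "independent (f ` I)"
    and 0: "(\<Sum>i\<in>I. k i *\<^sub>R f i) = 0" and i: "i \<in> I"
  shows "k i = 0"
proof -
  have "(\<Sum>v\<in>f ` I. (k \<circ> inv_into I f) v *\<^sub>R v) = 0"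
    using 0 by (simp add: sum.reindex[OF inj] inv_into_f_f[OF inj])
  from independentD[OF ind _ _ this, of "f i"] show ?thesis
    using I i by (simp add: inv_into_f_f[OF inj])
qed

context atlas
begin

text \<open>The frame is indexed by a part of the standard basis of the model space, so that its coefficients
  can be gathered in a vector of that space.\<close>

definition local_frame :: "('m \<Rightarrow> ('m, 'e) tvec set) \<Rightarrow> 'm set \<Rightarrow> 'e set \<Rightarrow> ('e \<Rightarrow> ('m, 'e) vfield) \<Rightarrow> bool" where
  "local_frame D W Bs Y \<longleftrightarrow> open W \<and> Bs \<subseteq> Basis \<and> (\<forall>b\<in>Bs. Y b \<in> vfields_on A W) \<and>
     (\<forall>q\<in>W. D q = range (\<lambda>k. \<Sum>b\<in>Bs. k b *\<^sub>R Y b q)) \<and>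
     (\<forall>q\<in>W. \<forall>k. (\<Sum>b\<in>Bs. k b *\<^sub>R Y b q) = 0 \<longrightarrow> (\<forall>b\<in>Bs. k b = 0))"

lemma local_frameD:
  assumes "local_frame D W Bs Y"
  shows "open W" "Bs \<subseteq> Basis" "b \<in> Bs \<Longrightarrow> Y b \<in> vfields_on A W"
    "q \<in> W \<Longrightarrow> D q = range (\<lambda>k. \<Sum>b\<in>Bs. k b *\<^sub>R Y b q)"
    "q \<in> W \<Longrightarrow> (\<Sum>b\<in>Bs. k b *\<^sub>R Y b q) = 0 \<Longrightarrow> \<forall>b\<in>Bs. k b = 0"
    "q \<in> W \<Longrightarrow> b \<in> Bs \<Longrightarrow> Y b q \<in> tangent_space A q"
  using assms unfolding local_frame_def by (auto intro: vfields_on_tangent)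

text \<open>Constancy of the rank makes the local generators independent at every point of
  \<open>W\<close>. A chart at \<open>p\<close> sends them to independent vectors of the model
  space, so their number is at most \<open>DIM('e)\<close> and they can be reindexed by a part of
  \<open>Basis\<close>.\<close>

lemma ex_local_frame:
  assumes D: "regular_distribution A D"
  obtains W Bs Y where "local_frame D W Bs Y" "p \<in> W"
proof -
  obtain r where r: "\<And>q. D q \<subseteq> tangent_space A q" "\<And>q. dim (D q) = r"
    and fr: "\<exists>W X. open W \<and> p \<in> W \<and> (\<forall>i<r. X i \<in> vfields_on A W) \<and>
                      (\<forall>q\<in>W. D q = span ((\<lambda>i::nat. X i q) ` {..<r}))"
    using D unfolding regular_distribution_def by metis
  obtain W X where W: "open W" "p \<in> W" and X: "\<And>i. i < r \<Longrightarrow> X i \<in> vfields_on A W"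
    and span: "\<And>q. q \<in> W \<Longrightarrow> D q = span ((\<lambda>i::nat. X i q) ` {..<r})"
    using fr by blast
  have ind: "inj_on (\<lambda>i. X i q) {..<r}" "independent ((\<lambda>i. X i q) ` {..<r})" if "q \<in> W" for q
    using span_of_full_dimension[of "{..<r}" "\<lambda>i. X i q"] r(2)[of q] span[OF that] by auto
  obtain c where c: "c \<in> A" "p \<in> fst c" by (rule ex_chart)
  have lin: "linear (\<lambda>w :: ('m, 'e) tvec. w c)"
    by (rule linearI) (auto simp: scaleR_fun_def)
  have inj: "inj_on (\<lambda>w. w c) (span ((\<lambda>i. X i p) ` {..<r}))"
  proof (rule inj_onI)
    fix x y assume "x \<in> span ((\<lambda>i. X i p) ` {..<r})" "y \<in> span ((\<lambda>i. X i p) ` {..<r})" "x c = y c"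
    then show "x = y"
      using r(1)[of p] span[OF W(2)] by (intro tangent_eqI[OF _ _ c]) auto
  qed
  have "independent ((\<lambda>w. w c) ` (\<lambda>i. X i p) ` {..<r})"
    by (rule linear_independent_injective_image[OF lin ind(2)[OF W(2)] inj])
  then have "card ((\<lambda>w. w c) ` (\<lambda>i. X i p) ` {..<r}) \<le> DIM('e)"
    using independent_bound by blast
  moreover have "card ((\<lambda>w. w c) ` (\<lambda>i. X i p) ` {..<r}) = r"
    using card_image[OF inj_on_subset[OF inj span_superset]] card_image[OF ind(1)[OF W(2)]] by simp
  ultimately obtain Bs :: "'e set" where Bs: "Bs \<subseteq> Basis" "card Bs = r"
    using obtain_subset_with_card_n by metis
  then have fin: "finite Bs" using finite_subset finite_Basis by blast
  obtain h where h: "bij_betw h Bs {..<r}"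
    using ex_bij_betw_finite_nat[OF fin] Bs(2) by (auto simp: atLeast0LessThan)
  define Y where "Y b = X (h b)" for b
  have im: "(\<lambda>b. Y b q) ` Bs = (\<lambda>i. X i q) ` {..<r}" for q
  proof -
    have "{..<r} = h ` Bs" using h by (simp add: bij_betw_def)
    then show ?thesis by (simp add: Y_def image_image)
  qed
  have inj: "inj_on (\<lambda>b. Y b q) Bs" if "q \<in> W" for q
    using comp_inj_on[of h Bs "\<lambda>i. X i q"] h ind(1)[OF that] by (simp add: bij_betw_def Y_def o_def)
  have "local_frame D W Bs Y"
    unfolding local_frame_def
  proof (intro conjI ballI allI impI)
    show "Y b \<in> vfields_on A W" if "b \<in> Bs" for b
      using X h that by (auto simp: Y_def bij_betw_def)
    show "D q = range (\<lambda>k. \<Sum>b\<in>Bs. k b *\<^sub>R Y b q)" if "q \<in> W" for q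
      using span_image_eq_range[OF fin inj[OF that]] span[OF that] im by simp
    show "k b = 0" if "q \<in> W" "(\<Sum>b\<in>Bs. k b *\<^sub>R Y b q) = 0" "b \<in> Bs" for q k b
      using independent_image_coeffs[OF fin inj[OF that(1)] _ that(2,3)] ind(2)[OF that(1)] im by simp
  qed (use W Bs in auto)
  then show thesis using that W(2) by blast
qed

section \<open>Acceleration of curves tangent to the constraint\<close>

lemma vfield_along_curve:
  assumes \<gamma>: "smooth_curve A I \<gamma>" "t \<in> I" and c: "c \<in> A" "\<gamma> t \<in> fst c"
    and W: "open W" "\<gamma> t \<in> W" and X: "X \<in> vfields_on A W"
  shows "((\<lambda>s. X (\<gamma> s) c) has_vector_derivative
    frechet_derivative (\<lambda>x. X (cinv c x) c) (at (snd c (\<gamma> t))) (velocity A \<gamma> t c)) (at t)"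
proof -
  have "smooth_on (snd c ` (W \<inter> fst c)) (\<lambda>x. X (cinv c x) c)"
    by (rule vfields_on_smooth[OF X c(1)]) auto
  then have 1: "((\<lambda>x. X (cinv c x) c) has_derivative
      frechet_derivative (\<lambda>x. X (cinv c x) c) (at (snd c (\<gamma> t)))) (at ((snd c \<circ> \<gamma>) t))"
    using smooth_on_has_derivative[of "snd c ` (W \<inter> fst c)" _ "snd c (\<gamma> t)"] c W by auto
  from vector_derivative_diff_chain_within[OF velocity_has_vector_derivative[OF \<gamma> c] has_derivative_at_withinI[OF 1]]
  have "(((\<lambda>x. X (cinv c x) c) \<circ> (snd c \<circ> \<gamma>)) has_vector_derivative
      frechet_derivative (\<lambda>x. X (cinv c x) c) (at (snd c (\<gamma> t))) (velocity A \<gamma> t c)) (at t)" .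
  then show ?thesis
    by (rule has_vector_derivative_transform_within_open[OF _ open_curve_preimage[OF \<gamma>(1) open_dom[OF c(1)]]])
       (use \<gamma> c in auto)
qed

text \<open>The product rule for the velocity written in the frame. In the result only the
  coefficients \<open>k'\<close> depend on the curve beyond its velocity at \<open>t\<close>, which
  is what makes two curves with the same velocity comparable.\<close>

lemma compatible_accel:
  assumes \<gamma>: "smooth_curve A I \<gamma>" "t \<in> I" and D: "compatible_curve A D I \<gamma>"
    and fr: "local_frame D W Bs Y" "\<gamma> t \<in> W" and c: "c \<in> A" "\<gamma> t \<in> fst c"
    and k: "velocity A \<gamma> t = (\<Sum>b\<in>Bs. k b *\<^sub>R Y b (\<gamma> t))"
  obtains k' where "accel \<gamma> t c = (\<Sum>b\<in>Bs. k' b *\<^sub>R Y b (\<gamma> t) c)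
    + (\<Sum>b\<in>Bs. k b *\<^sub>R frechet_derivative (\<lambda>x. Y b (cinv c x) c) (at (snd c (\<gamma> t))) (velocity A \<gamma> t c))"
proof -
  note W = local_frameD(1)[OF fr(1)] and Bs = local_frameD(2)[OF fr(1)] and Y = local_frameD(3)[OF fr(1)]
    and DY = local_frameD(4)[OF fr(1)] and ind = local_frameD(5)[OF fr(1)]
  define J where "J = {s \<in> I. \<gamma> s \<in> W \<inter> fst c}"
  have J: "open J" "t \<in> J"
    unfolding J_def using open_curve_preimage[OF \<gamma>(1) open_Int_dom[OF c(1) W]] \<gamma> c fr by auto
  have oc: "open (snd c ` (W \<inter> fst c))"
    by (rule open_vfield_image[OF c(1) W])
  have xs: "smooth_on J (snd c \<circ> \<gamma>)"
    by (rule smooth_on_subset[OF curve_coords_smooth[OF \<gamma>(1) c(1)]]) (auto simp: J_def)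
  have Ys: "smooth_on J (\<lambda>s. Y b (\<gamma> s) c)" if "b \<in> Bs" for b
  proof -
    have "smooth_on J (\<lambda>s. Y b (cinv c ((snd c \<circ> \<gamma>) s)) c)"
      by (rule smooth_on_compose[OF vfields_on_smooth[OF Y[OF that] c(1) subset_refl] J(1) oc _ xs])
         (auto simp: J_def)
    then show ?thesis
      by (rule smooth_on_cong[OF J(1), rotated]) (use c in \<open>auto simp: J_def\<close>)
  qed
  have vs: "smooth_on J (\<lambda>s. velocity A \<gamma> s c)"
    by (rule smooth_on_subset[OF velocity_smooth[OF \<gamma>(1) c(1)]]) (auto simp: J_def)
  have nondeg: "\<forall>a\<in>Bs. u a = 0"
    if s: "s \<in> J" and u: "\<forall>b\<in>Bs. (\<Sum>a\<in>Bs. u a * (Y a (\<gamma> s) c \<bullet> Y b (\<gamma> s) c)) = 0" for s u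
  proof -
    have s': "\<gamma> s \<in> W" "\<gamma> s \<in> fst c" using s by (auto simp: J_def)
    define z where "z = (\<Sum>a\<in>Bs. u a *\<^sub>R Y a (\<gamma> s))"
    have zc: "z c = (\<Sum>a\<in>Bs. u a *\<^sub>R Y a (\<gamma> s) c)"
      by (simp add: z_def sum_component)
    have "z c \<bullet> z c = (\<Sum>b\<in>Bs. u b * (\<Sum>a\<in>Bs. u a * (Y a (\<gamma> s) c \<bullet> Y b (\<gamma> s) c)))"
      unfolding zc by (simp add: inner_sum_left inner_sum_right sum_distrib_left mult.left_commute)
    also have "\<dots> = 0" using u by simp
    finally have "z c = 0" by simp
    moreover have "z \<in> tangent_space A (\<gamma> s)"
      unfolding z_def using vfields_on_tangent[OF Y s'(1)]
      by (intro subspace_sum subspace_scale subspace_tangent_space) auto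
    ultimately have "z = 0"
      by (intro tangent_eqI[OF _ subspace_0[OF subspace_tangent_space] c(1) s'(2)]) auto
    then show ?thesis using ind[OF s'(1)] unfolding z_def by blast
  qed
  \<comment> \<open>Compatibility gives frame coefficients separately at each time. Pairing the
    velocity with the frame in the Euclidean product of the chart exhibits them as the solution of a
    smooth invertible linear system.\<close>
  obtain y :: "real \<Rightarrow> 'e" where y: "smooth_on J y"
    "\<And>s b. s \<in> J \<Longrightarrow> b \<in> Bs \<Longrightarrow> (\<Sum>a\<in>Bs. (y s \<bullet> a) * (Y a (\<gamma> s) c \<bullet> Y b (\<gamma> s) c)) = velocity A \<gamma> s c \<bullet> Y b (\<gamma> s) c"
    by (rule gram_solve_smooth[OF J(1) Bs, of "\<lambda>s a b. Y a (\<gamma> s) c \<bullet> Y b (\<gamma> s) c" "\<lambda>s b. velocity A \<gamma> s c \<bullet> Y b (\<gamma> s) c"])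
       (use nondeg in \<open>auto intro!: smooth_on_inner J(1) Ys vs\<close>)
  \<comment> \<open>Any coefficients of the velocity satisfy the same system, so by uniqueness they
    are those of the smooth solution; in particular \<open>y\<close> takes the prescribed values
    \<open>k\<close> at \<open>t\<close>.\<close>
  have coeff: "y s \<bullet> a = m a" if s: "s \<in> J" and m: "velocity A \<gamma> s = (\<Sum>b\<in>Bs. m b *\<^sub>R Y b (\<gamma> s))" and a: "a \<in> Bs"
    for s m a
  proof -
    have vel: "velocity A \<gamma> s c = (\<Sum>a\<in>Bs. m a *\<^sub>R Y a (\<gamma> s) c)"
      unfolding m by (rule sum_component)
    have "(\<Sum>a\<in>Bs. (y s \<bullet> a - m a) * (Y a (\<gamma> s) c \<bullet> Y b (\<gamma> s) c)) = 0" if "b \<in> Bs" for b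
    proof -
      have "velocity A \<gamma> s c \<bullet> Y b (\<gamma> s) c = (\<Sum>a\<in>Bs. m a * (Y a (\<gamma> s) c \<bullet> Y b (\<gamma> s) c))"
        unfolding vel by (simp only: inner_sum_left inner_scaleR_left)
      then show ?thesis
        unfolding left_diff_distrib sum_subtractf y(2)[OF s that] by (rule right_minus_eq[THEN iffD2])
    qed
    then have "\<forall>a\<in>Bs. y s \<bullet> a - m a = 0"
      by (rule nondeg[OF s, OF ballI])
    then show ?thesis using a by simp
  qed
  have vel: "velocity A \<gamma> s c = (\<Sum>b\<in>Bs. (y s \<bullet> b) *\<^sub>R Y b (\<gamma> s) c)" if s: "s \<in> J" for s
  proof -
    have "velocity A \<gamma> s \<in> D (\<gamma> s)" "\<gamma> s \<in> W"
      using D s by (auto simp: compatible_curve_def J_def)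
    then obtain m where m: "velocity A \<gamma> s = (\<Sum>b\<in>Bs. m b *\<^sub>R Y b (\<gamma> s))"
      using DY by blast
    have "velocity A \<gamma> s c = (\<Sum>b\<in>Bs. m b *\<^sub>R Y b (\<gamma> s) c)"
      unfolding m by (rule sum_component)
    also have "\<dots> = (\<Sum>b\<in>Bs. (y s \<bullet> b) *\<^sub>R Y b (\<gamma> s) c)"
      using coeff[OF s m] by simp
    finally show ?thesis .
  qed
  have "(y has_vector_derivative vector_derivative y (at t)) (at t)"
    using smooth_on_differentiable[OF y(1) J(2)] by (simp add: vector_derivative_works)
  from bounded_linear.has_vector_derivative[OF bounded_linear_inner_left this]
  have dy: "((\<lambda>s. y s \<bullet> b) has_vector_derivative vector_derivative y (at t) \<bullet> b) (at t)" for b .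
  have "((\<lambda>s. \<Sum>b\<in>Bs. (y s \<bullet> b) *\<^sub>R Y b (\<gamma> s) c) has_vector_derivative
      (\<Sum>b\<in>Bs. (vector_derivative y (at t) \<bullet> b) *\<^sub>R Y b (\<gamma> t) c) + (\<Sum>b\<in>Bs. (y t \<bullet> b) *\<^sub>R
      frechet_derivative (\<lambda>x. Y b (cinv c x) c) (at (snd c (\<gamma> t))) (velocity A \<gamma> t c))) (at t)"
    by (rule vector_derivative_frame_sum[OF dy vfield_along_curve[OF \<gamma> c W fr(2) Y]])
  then have "((\<lambda>s. velocity A \<gamma> s c) has_vector_derivative
      (\<Sum>b\<in>Bs. (vector_derivative y (at t) \<bullet> b) *\<^sub>R Y b (\<gamma> t) c) + (\<Sum>b\<in>Bs. (y t \<bullet> b) *\<^sub>R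
      frechet_derivative (\<lambda>x. Y b (cinv c x) c) (at (snd c (\<gamma> t))) (velocity A \<gamma> t c))) (at t)"
    by (rule has_vector_derivative_transform_within_open[OF _ J]) (simp add: vel)
  from vector_derivative_unique_at[OF accel_has_vector_derivative[OF \<gamma> c] this]
  show thesis
    using that[of "\<lambda>b. vector_derivative y (at t) \<bullet> b"] coeff[OF J(2) k] by simp
qed

text \<open>The Christoffel terms and the derivatives of the frame fields only depend on the common velocity; the
  derivatives of the frame coefficients remain.\<close>

lemma compatible_covariant_derivative_diff:
  assumes nabla: "anisotropic_connection A U nabla" and U: "open_in_tangent_bundle A U"
    and D: "regular_distribution A D"
    and \<gamma>1: "smooth_curve A I1 \<gamma>1" "t1 \<in> I1" "compatible_curve A D I1 \<gamma>1"
    and \<gamma>2: "smooth_curve A I2 \<gamma>2" "t2 \<in> I2" "compatible_curve A D I2 \<gamma>2"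
    and lift: "canonical_lift A \<gamma>1 t1 = (p, w)" "canonical_lift A \<gamma>2 t2 = (p, w)" "(p, w) \<in> U"
  shows "covariant_derivative A nabla \<gamma>1 (velocity A \<gamma>1) t1 - covariant_derivative A nabla \<gamma>2 (velocity A \<gamma>2) t2 \<in> D p"
    (is "?c1 - ?c2 \<in> _")
proof -
  have p: "\<gamma>1 t1 = p" "\<gamma>2 t2 = p" "velocity A \<gamma>1 t1 = w" "velocity A \<gamma>2 t2 = w"
    using lift by auto
  obtain W Bs Y where fr: "local_frame D W Bs Y" "p \<in> W"
    using ex_local_frame[OF D] by metis
  note Y = local_frameD(3)[OF fr(1)] and DY = local_frameD(4)[OF fr]
  obtain c where c: "c \<in> A" "p \<in> fst c" by (rule ex_chart)
  have "w \<in> D p"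
    using \<gamma>1 p by (auto simp: compatible_curve_def)
  then obtain k where k: "w = (\<Sum>b\<in>Bs. k b *\<^sub>R Y b p)"
    using DY by blast
  let ?N = "\<Sum>b\<in>Bs. k b *\<^sub>R frechet_derivative (\<lambda>x. Y b (cinv c x) c) (at (snd c p)) (w c)"
  obtain k1 where k1: "accel \<gamma>1 t1 c = (\<Sum>b\<in>Bs. k1 b *\<^sub>R Y b p c) + ?N"
    by (rule compatible_accel[OF \<gamma>1(1-3) fr(1), of c k]) (use p fr c k in auto)
  obtain k2 where k2: "accel \<gamma>2 t2 c = (\<Sum>b\<in>Bs. k2 b *\<^sub>R Y b p c) + ?N"
    by (rule compatible_accel[OF \<gamma>2(1-3) fr(1), of c k]) (use p fr c k in auto)
  have T1: "?c1 \<in> tangent_space A p"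
    using covariant_derivative_in_tangent_space[OF nabla U \<gamma>1(1,2)] lift by simp
  have T2: "?c2 \<in> tangent_space A p"
    using covariant_derivative_in_tangent_space[OF nabla U \<gamma>2(1,2)] lift by simp
  have "?c1 - ?c2 = (\<Sum>b\<in>Bs. (k1 b - k2 b) *\<^sub>R Y b p)"
  proof (rule tangent_eqI[OF _ _ c])
    show "?c1 - ?c2 \<in> tangent_space A p"
      by (intro subspace_diff subspace_tangent_space T1 T2)
    show "(\<Sum>b\<in>Bs. (k1 b - k2 b) *\<^sub>R Y b p) \<in> tangent_space A p"
      using vfields_on_tangent[OF Y fr(2)] by (intro subspace_sum subspace_scale subspace_tangent_space) auto
    have "?c1 c - ?c2 c = accel \<gamma>1 t1 c - accel \<gamma>2 t2 c"
      using covariant_derivative_velocity[OF \<gamma>1(1,2) c(1), of nabla]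
        covariant_derivative_velocity[OF \<gamma>2(1,2) c(1), of nabla] p c by simp
    then show "(?c1 - ?c2) c = (\<Sum>b\<in>Bs. (k1 b - k2 b) *\<^sub>R Y b p) c"
      by (simp add: k1 k2 sum_component scaleR_diff_left sum_subtractf)
  qed
  then show ?thesis
    unfolding DY by (rule range_eqI[where x = "\<lambda>b. k1 b - k2 b"])
qed

end

context finsler
begin

section \<open>Constrained curves and reaction forces\<close>

lemma fundamental_tensor_frame:
  assumes v: "(p, w) \<in> U" and c: "c \<in> A" "p \<in> fst c" and x: "x \<in> tangent_space A p"
    and y: "\<And>b. b \<in> Bs \<Longrightarrow> y b \<in> tangent_space A p"
  shows "fundamental_tensor L (p, w) x (\<Sum>b\<in>Bs. k b *\<^sub>R y b)
    = (\<Sum>b\<in>Bs. k b * tensor_coords A L c (snd c p, w c) (x c) (y b c))"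
proof -
  note lin = tensor_coords_bilinear(2)[OF c(1) coords_in[OF v c(2)]]
  have "(\<Sum>b\<in>Bs. k b *\<^sub>R y b) \<in> tangent_space A p"
    using y by (intro subspace_sum subspace_scale subspace_tangent_space)
  then show ?thesis
    by (simp add: fundamental_tensor_coords[OF v c x] sum_component linear_sum[OF lin] linear_cmul[OF lin])
qed

text \<open>A kernel vector of the Gram matrix gives an element \<open>x\<close> of
  \<open>D p\<close> orthogonal to the whole of \<open>D p\<close>; nondegeneracy makes
  \<open>x\<close> vanish, and independence of the frame makes its coefficients vanish.\<close>

lemma nondegenerate_gram:
  assumes fr: "local_frame D W Bs Y" "p \<in> W" and nondeg: "nondegenerate_subspace U L p (D p)"
    and v: "(p, w) \<in> U" "w \<in> D p" and c: "c \<in> A" "p \<in> fst c"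
    and 0: "\<forall>b\<in>Bs. (\<Sum>a\<in>Bs. u a * tensor_coords A L c (snd c p, w c) (Y a p c) (Y b p c)) = 0"
  shows "\<forall>a\<in>Bs. u a = 0"
proof -
  note Y = local_frameD(6)[OF fr] and DY = local_frameD(4)[OF fr] and ind = local_frameD(5)[OF fr]
  define x where "x = (\<Sum>a\<in>Bs. u a *\<^sub>R Y a p)"
  have x: "x \<in> tangent_space A p"
    unfolding x_def by (intro subspace_sum subspace_scale subspace_tangent_space Y)
  have xD: "x \<in> D p"
    unfolding DY x_def by (rule rangeI)
  have "fundamental_tensor L (p, w) x y = 0" if y: "y \<in> D p" for y
  proof -
    obtain k where k: "y = (\<Sum>b\<in>Bs. k b *\<^sub>R Y b p)" using y unfolding DY by blast
    note lin = tensor_coords_bilinear(1)[OF c(1) coords_in[OF v(1) c(2)]]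
    have "tensor_coords A L c (snd c p, w c) (x c) (Y b p c)
        = (\<Sum>a\<in>Bs. u a * tensor_coords A L c (snd c p, w c) (Y a p c) (Y b p c))" for b
      unfolding x_def sum_component by (simp add: linear_sum[OF lin] linear_cmul[OF lin])
    moreover have "fundamental_tensor L (p, w) x y
        = (\<Sum>b\<in>Bs. k b * tensor_coords A L c (snd c p, w c) (x c) (Y b p c))"
      unfolding k by (rule fundamental_tensor_frame[OF v(1) c x Y])
    ultimately show ?thesis using 0 by simp
  qed
  then have "x = 0"
    using nondeg v xD unfolding nondegenerate_subspace_def nondegenerate_on_def by blast
  then show ?thesis using ind unfolding x_def by blast
qed


text \<open>In a frame \<open>Y\<close> of \<open>D\<close> the curve is sought as \<open>x' = \<Sum> a\<^sub>b Y\<^sub>b(x)\<close>; the condition that the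
  covariant acceleration minus the force be orthogonal to \<open>D\<close> is then a linear system for \<open>a'\<close>, whose matrix is
  the Gram matrix of the frame.\<close>

lemma ex_constrained_curve:
  assumes nabla: "anisotropic_connection A U nabla" and F: "anisotropic_vfield A U F"
    and D: "regular_distribution A D" and nondeg: "\<And>p. nondegenerate_subspace U L p (D p)"
    and v: "(p, w) \<in> U" "w \<in> D p"
  obtains I \<gamma> where "0 \<in> I" "admissible_curve A U I \<gamma>" "canonical_lift A \<gamma> 0 = (p, w)" "compatible_curve A D I \<gamma>"
    "\<And>t. t \<in> I \<Longrightarrow> covariant_derivative A nabla \<gamma> (velocity A \<gamma>) t - F (canonical_lift A \<gamma> t)
       \<in> orth_complement A L D (canonical_lift A \<gamma> t)"
proof -
  obtain c where c: "c \<in> A" "p \<in> fst c" by (rule ex_chart)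
  obtain E W1 where E: "open W1" "p \<in> W1" "W1 \<subseteq> fst c" "\<And>i. i \<in> Basis \<Longrightarrow> E i \<in> vfields A"
    "\<And>i q. i \<in> Basis \<Longrightarrow> q \<in> W1 \<Longrightarrow> E i q = coord_field A c i q"
    using coord_frame_extension[OF c] by metis
  obtain W Bs Y where fr: "local_frame D W Bs Y" "p \<in> W"
    using ex_local_frame[OF D] by metis
  note Bs = local_frameD(2)[OF fr(1)] and Y = local_frameD(3)[OF fr(1)]
  have fin: "finite Bs" using Bs finite_subset finite_Basis by blast
  note Utan = open_U[unfolded open_in_tangent_bundle_def, THEN conjunct1]
  define W0 where "W0 = W \<inter> W1"
  have W0: "open W0" "p \<in> W0" "W0 \<subseteq> fst c" "W0 \<subseteq> W" "W0 \<subseteq> W1"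
    using E(1-3) fr local_frameD(1)[OF fr(1)] by (auto simp: W0_def)
  define S0 where "S0 = snd c ` W0"
  have S0: "open S0"
    unfolding S0_def by (rule open_chart_image[OF c(1) W0(1,3)])
  have q0: "cinv c x \<in> W0" "cinv c x \<in> fst c" "cinv c x \<in> W" "cinv c x \<in> W1" "snd c (cinv c x) = x"
    if "x \<in> S0" for x
    using that W0 c by (auto simp: S0_def subset_iff)
  define Yc where "Yc b x = Y b (cinv c x) c" for b x
  have Ys: "smooth_on S0 (Yc b)" if "b \<in> Bs" for b
    unfolding S0_def Yc_def by (rule vfields_on_smooth[OF Y[OF that] c(1)]) (use W0 in auto)
  \<comment> \<open>A state \<open>z\<close> consists of the position in the chart and the frame
    coefficients of the velocity. Then \<open>vv z\<close> is the velocity in the chart, and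
    \<open>\<beta> z\<close> below gives the bundle coordinates of the lifted curve.\<close>
  define vv where "vv z = (\<Sum>b\<in>Bs. (snd z \<bullet> b) *\<^sub>R Yc b (fst z))" for z :: "'b \<times> 'b"
  define \<beta> where "\<beta> z = (fst z, vv z)" for z
  define \<Omega>0 where "\<Omega>0 = S0 \<times> (UNIV :: 'b set)"
  have \<Omega>0: "open \<Omega>0"
    unfolding \<Omega>0_def by (intro open_Times S0 open_UNIV)
  have fst0: "smooth_on \<Omega>0 fst" and snd0: "smooth_on \<Omega>0 snd"
    using smooth_on_fst[OF \<Omega>0 smooth_on_ident[OF \<Omega>0]] smooth_on_snd[OF \<Omega>0 smooth_on_ident[OF \<Omega>0]] by auto
  have Y0: "smooth_on \<Omega>0 (\<lambda>z. Yc b (fst z))" if "b \<in> Bs" for b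
    by (rule smooth_on_compose[OF Ys[OF that] \<Omega>0 S0 _ fst0]) (auto simp: \<Omega>0_def)
  have vv0: "smooth_on \<Omega>0 vv"
    unfolding vv_def by (intro smooth_on_sum smooth_on_scaleR smooth_on_inner \<Omega>0 snd0 smooth_on_const Y0)
  have \<beta>0: "smooth_on \<Omega>0 \<beta>"
    unfolding \<beta>_def by (intro smooth_on_Pair \<Omega>0 fst0 vv0)
  \<comment> \<open>The states whose velocity belongs to \<open>U\<close>. As this velocity lies in
    \<open>D\<close> by construction, the Gram matrix is nondegenerate on all of
    \<open>\<Omega>\<close>.\<close>
  define \<Omega> where "\<Omega> = \<Omega>0 \<inter> \<beta> -` bundle_coords c U"
  have \<Omega>: "open \<Omega>"
    unfolding \<Omega>_def
    by (rule continuous_open_preimage[OF smooth_on_continuous_on[OF \<beta>0] \<Omega>0 open_bundle_coords[OF c(1)]])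
  have sub: "\<Omega> \<subseteq> \<Omega>0" and \<beta>U: "\<And>z. z \<in> \<Omega> \<Longrightarrow> \<beta> z \<in> bundle_coords c U"
    by (auto simp: \<Omega>_def)
  note fst1 = smooth_on_subset[OF fst0 sub] and snd1 = smooth_on_subset[OF snd0 sub]
    and Y1 = smooth_on_subset[OF Y0 sub] and vv1 = smooth_on_subset[OF vv0 sub] and \<beta>1 = smooth_on_subset[OF \<beta>0 sub]
  have zS0: "fst z \<in> S0" if "z \<in> \<Omega>" for z
    using that sub by (auto simp: \<Omega>0_def)
  \<comment> \<open>The part of covariant acceleration minus force that is free of the derivatives
    of the coefficients: derivatives of the frame along the velocity, Christoffel terms and force.
    The Christoffel terms are written with the fixed fields \<open>E\<close> to make their
    smoothness evident.\<close>
  define \<Xi> where "\<Xi> z = (\<Sum>b\<in>Bs. (snd z \<bullet> b) *\<^sub>R frechet_derivative (Yc b) (at (fst z)) (vv z))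
     + (\<Sum>i\<in>Basis. \<Sum>j\<in>Basis. ((vv z \<bullet> i) * (vv z \<bullet> j)) *\<^sub>R nabla (bundle_point A c (\<beta> z)) (E i) (E j) c)
     - F (bundle_point A c (\<beta> z)) c" for z
  have \<Xi>1: "smooth_on \<Omega> \<Xi>"
  proof -
    have "smooth_on \<Omega> (\<lambda>z. nabla (bundle_point A c (\<beta> z)) (E i) (E j) c)" if "i \<in> Basis" "j \<in> Basis" for i j
    proof (rule smooth_on_compose[OF _ \<Omega> open_bundle_coords[OF c(1)] \<beta>U \<beta>1])
      have "anisotropic_vfield A U (\<lambda>v. nabla v (E i) (E j))"
        using nabla E(4) that unfolding anisotropic_connection_def by simp
      then show "smooth_on (bundle_coords c U) (\<lambda>z. nabla (bundle_point A c z) (E i) (E j) c)"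
        using c(1) unfolding anisotropic_vfield_def by simp
    qed
    note N = this
    have "smooth_on \<Omega> (\<lambda>z. F (bundle_point A c (\<beta> z)) c)"
      by (rule smooth_on_compose[OF _ \<Omega> open_bundle_coords[OF c(1)] \<beta>U \<beta>1, where g = "\<lambda>z. F (bundle_point A c z) c"])
         (use F c(1) in \<open>simp add: anisotropic_vfield_def\<close>)
    note FF = this
    have "smooth_on \<Omega> (\<lambda>z. frechet_derivative (Yc b) (at (fst z)) (vv z))" if "b \<in> Bs" for b
      by (rule smooth_on_frechet_apply[OF Ys[OF that] \<Omega> S0 zS0 fst1 vv1])
    note dY = this
    show ?thesis
      unfolding \<Xi>_def
      by (intro smooth_on_diff smooth_on_add smooth_on_sum smooth_on_scaleR smooth_on_mult smooth_on_inner
          \<Omega> snd1 vv1 smooth_on_const N FF dY)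
  qed
  have base: "(cinv c (fst z), \<Sum>b\<in>Bs. (snd z \<bullet> b) *\<^sub>R Y b (cinv c (fst z))) = bundle_point A c (\<beta> z)"
    and inU: "bundle_point A c (\<beta> z) \<in> U" if z: "z \<in> \<Omega>" for z
  proof -
    note q = q0[OF zS0[OF z]]
    have T: "(\<Sum>b\<in>Bs. (snd z \<bullet> b) *\<^sub>R Y b (cinv c (fst z))) \<in> tangent_space A (cinv c (fst z))"
      using local_frameD(6)[OF fr(1) q(3)] by (intro subspace_sum subspace_scale subspace_tangent_space)
    have "(\<Sum>b\<in>Bs. (snd z \<bullet> b) *\<^sub>R Y b (cinv c (fst z))) c = vv z"
      unfolding vv_def Yc_def by (rule sum_component)
    then show "(cinv c (fst z), \<Sum>b\<in>Bs. (snd z \<bullet> b) *\<^sub>R Y b (cinv c (fst z))) = bundle_point A c (\<beta> z)"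
      using bundle_point_coords[OF T c(1) q(2)] q(5) by (simp add: \<beta>_def)
    show "bundle_point A c (\<beta> z) \<in> U"
      using \<beta>U[OF z] bundle_coords_iff[OF Utan c(1)] unfolding \<beta>_def by blast
  qed
  define G where "G z a b = tensor_coords A L c (\<beta> z) (Yc a (fst z)) (Yc b (fst z))" for z a b
  \<comment> \<open>The derivative of the coefficients as a function of the state: the system says
    that the combination of the frame with coefficients \<open>h z\<close>, added to
    \<open>\<Xi> z\<close>, is orthogonal to every frame vector.\<close>
  obtain h :: "'b \<times> 'b \<Rightarrow> 'b" where h: "smooth_on \<Omega> h"
    "\<And>z b. z \<in> \<Omega> \<Longrightarrow> b \<in> Bs \<Longrightarrow> (\<Sum>a\<in>Bs. (h z \<bullet> a) * G z a b) = - tensor_coords A L c (\<beta> z) (\<Xi> z) (Yc b (fst z))"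
  proof (rule gram_solve_smooth[OF \<Omega> Bs, of G "\<lambda>z b. - tensor_coords A L c (\<beta> z) (\<Xi> z) (Yc b (fst z))"])
    show "smooth_on \<Omega> (\<lambda>z. G z a b)" if "a \<in> Bs" "b \<in> Bs" for a b
      unfolding G_def by (rule tensor_coords_smooth[OF c(1) \<Omega> \<beta>1 \<beta>U Y1[OF that(1)] Y1[OF that(2)]])
    show "smooth_on \<Omega> (\<lambda>z. - tensor_coords A L c (\<beta> z) (\<Xi> z) (Yc b (fst z)))" if "b \<in> Bs" for b
      by (intro smooth_on_minus \<Omega> tensor_coords_smooth[OF c(1) \<Omega> \<beta>1 \<beta>U \<Xi>1 Y1[OF that]])
    show "\<forall>a\<in>Bs. u a = 0" if z: "z \<in> \<Omega>" and 0: "\<forall>b\<in>Bs. (\<Sum>a\<in>Bs. u a * G z a b) = 0" for z u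
    proof -
      note q = q0[OF zS0[OF z]]
      let ?q = "cinv c (fst z)" and ?w = "\<Sum>b\<in>Bs. (snd z \<bullet> b) *\<^sub>R Y b (cinv c (fst z))"
      have "?w \<in> D ?q"
        unfolding local_frameD(4)[OF fr(1) q(3)] by (rule rangeI)
      moreover have "(snd c ?q, ?w c) = \<beta> z"
        unfolding sum_component by (simp add: q(5) \<beta>_def vv_def Yc_def)
      ultimately show ?thesis
        using nondegenerate_gram[OF fr(1) q(3) nondeg, of ?w c u] base[OF z] inU[OF z] c(1) q(2) 0
        unfolding G_def Yc_def by simp
    qed
  qed blast
  obtain k0 where k0: "w = (\<Sum>b\<in>Bs. k0 b *\<^sub>R Y b p)"
    using v(2) unfolding local_frameD(4)[OF fr] by blast
  define a0 where "a0 = (\<Sum>b\<in>Bs. k0 b *\<^sub>R b)"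
  have a0: "a0 \<bullet> b = k0 b" if "b \<in> Bs" for b
  proof -
    have "a0 \<bullet> b = (\<Sum>c\<in>Bs. if c = b then k0 c else 0)"
      unfolding a0_def inner_sum_left using that Bs by (intro sum.cong) (auto simp: inner_Basis subset_iff)
    then show ?thesis using that fin by simp
  qed
  have vv_a0: "vv (snd c p, a0) = w c"
  proof -
    have "w c = (\<Sum>b\<in>Bs. k0 b *\<^sub>R Y b p c)"
      unfolding k0 by (rule sum_component)
    then show ?thesis using c a0 by (simp add: vv_def Yc_def)
  qed
  have z0: "(snd c p, a0) \<in> \<Omega>"
    using W0(2) coords_in[OF v(1) c(2)] by (simp add: \<Omega>_def \<Omega>0_def S0_def \<beta>_def vv_a0)
  \<comment> \<open>The right-hand side of the first order system for position and
    coefficients.\<close>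
  have "smooth_on \<Omega> (\<lambda>z. (vv z, h z))"
    by (rule smooth_on_Pair[OF \<Omega> vv1 h(1)])
  then obtain e z where e: "e > 0" and z: "z 0 = (snd c p, a0)" "smooth_on {-e<..<e} z"
    "\<And>t. t \<in> {-e<..<e} \<Longrightarrow> z t \<in> \<Omega>"
    "\<And>t. t \<in> {-e<..<e} \<Longrightarrow> (z has_vector_derivative (vv (z t), h (z t))) (at t)"
    by (rule ode_solution_smooth[OF \<Omega> z0]) (rule that; simp)
  define I where "I = {-e<..<e}"
  define \<gamma> where "\<gamma> t = cinv c (fst (z t))" for t
  note zI = z(2-4)[folded I_def]
  have I: "open I" "0 \<in> I" using e by (auto simp: I_def)
  note q = q0[OF zS0[OF zI(2)], folded \<gamma>_def]
  have dx: "((\<lambda>t. fst (z t)) has_vector_derivative vv (z t)) (at t)"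
    and da: "((\<lambda>t. snd (z t)) has_vector_derivative h (z t)) (at t)" if "t \<in> I" for t
    using bounded_linear.has_vector_derivative[OF bounded_linear_fst zI(3)[OF that]]
      bounded_linear.has_vector_derivative[OF bounded_linear_snd zI(3)[OF that]] by simp_all
  have xs: "smooth_on I (\<lambda>t. fst (z t))"
    by (rule smooth_on_fst[OF I(1) zI(1)])
  have \<gamma>: "smooth_curve A I \<gamma>"
    unfolding smooth_curve_def
  proof (intro conjI ballI I)
    show "is_interval I" by (simp add: I_def is_interval_oo)
    show cont: "continuous_on I \<gamma>"
      unfolding \<gamma>_def
      by (rule continuous_on_compose2[OF continuous_on_cinv[OF c(1)] smooth_on_continuous_on[OF xs]])
         (use zS0[OF zI(2)] image_mono[OF W0(3), of "snd c"] in \<open>auto simp: S0_def\<close>)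
    fix d assume d: "d \<in> A"
    define T where "T = {t \<in> I. \<gamma> t \<in> fst d}"
    have T: "open T"
    proof -
      have "open (\<gamma> -` fst d \<inter> I)"
        using cont I(1) open_dom[OF d] continuous_on_open_vimage[of I \<gamma>] by blast
      then show ?thesis by (simp add: T_def vimage_def Int_def conj_commute)
    qed
    have "smooth_on T (\<lambda>t. (snd d \<circ> cinv c) (fst (z t)))"
    proof (rule smooth_on_compose[OF smooth_transition[OF c(1) d] T])
      show "open (snd c ` (fst c \<inter> fst d))"
        by (rule open_chart_image[OF c(1) open_Int_dom[OF d open_dom[OF c(1)]]]) auto
      show "fst (z t) \<in> snd c ` (fst c \<inter> fst d)" if "t \<in> T" for t
        using that q by (intro image_eqI[of _ _ "\<gamma> t"]) (auto simp: T_def)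
      show "smooth_on T (\<lambda>t. fst (z t))"
        by (rule smooth_on_subset[OF xs]) (auto simp: T_def)
    qed
    then show "smooth_on {t \<in> I. \<gamma> t \<in> fst d} (snd d \<circ> \<gamma>)"
      by (simp add: T_def \<gamma>_def o_def)
  qed
  have velc: "velocity A \<gamma> t c = vv (z t)" if t: "t \<in> I" for t
  proof -
    have "((snd c \<circ> \<gamma>) has_vector_derivative vv (z t)) (at t)"
      by (rule has_vector_derivative_transform_within_open[OF dx[OF t] I(1) t]) (simp add: q(5))
    then show ?thesis
      using velocity_has_vector_derivative[OF \<gamma> t c(1) q(2)[OF t]] vector_derivative_unique_at by blast
  qed
  have vel: "velocity A \<gamma> t = (\<Sum>b\<in>Bs. (snd (z t) \<bullet> b) *\<^sub>R Y b (\<gamma> t))" if t: "t \<in> I" for t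
  proof (rule tangent_eqI[OF velocity_in_tangent_space[OF \<gamma> t] _ c(1) q(2)[OF t]])
    show "(\<Sum>b\<in>Bs. (snd (z t) \<bullet> b) *\<^sub>R Y b (\<gamma> t)) \<in> tangent_space A (\<gamma> t)"
      using local_frameD(6)[OF fr(1) q(3)[OF t]] by (intro subspace_sum subspace_scale subspace_tangent_space)
    show "velocity A \<gamma> t c = (\<Sum>b\<in>Bs. (snd (z t) \<bullet> b) *\<^sub>R Y b (\<gamma> t)) c"
      unfolding sum_component velc[OF t] vv_def Yc_def \<gamma>_def ..
  qed
  have lift: "canonical_lift A \<gamma> t = bundle_point A c (\<beta> (z t))" "canonical_lift A \<gamma> t \<in> U" if t: "t \<in> I" for t
  proof -
    show "canonical_lift A \<gamma> t = bundle_point A c (\<beta> (z t))"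
      using base[OF zI(2)[OF t]] unfolding vel[OF t] \<gamma>_def .
    then show "canonical_lift A \<gamma> t \<in> U"
      using inU[OF zI(2)[OF t]] by (rule ssubst)
  qed
  have acc: "accel \<gamma> t c = (\<Sum>b\<in>Bs. (h (z t) \<bullet> b) *\<^sub>R Y b (\<gamma> t) c)
      + (\<Sum>b\<in>Bs. (snd (z t) \<bullet> b) *\<^sub>R frechet_derivative (Yc b) (at (fst (z t))) (vv (z t)))" if t: "t \<in> I" for t
  proof -
    have 1: "((\<lambda>s. snd (z s) \<bullet> b) has_vector_derivative h (z t) \<bullet> b) (at t)" for b
      using bounded_linear.has_vector_derivative[OF bounded_linear_inner_left da[OF t]] .
    have 2: "((\<lambda>s. Y b (\<gamma> s) c) has_vector_derivative frechet_derivative (Yc b) (at (fst (z t))) (vv (z t))) (at t)"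
      if b: "b \<in> Bs" for b
      using vfield_along_curve[OF \<gamma> t c(1) q(2)[OF t] local_frameD(1)[OF fr(1)] q(3)[OF t] Y[OF b]]
      unfolding velc[OF t] q(5)[OF t] Yc_def[abs_def] .
    have "((\<lambda>s. \<Sum>b\<in>Bs. (snd (z s) \<bullet> b) *\<^sub>R Y b (\<gamma> s) c) has_vector_derivative
        (\<Sum>b\<in>Bs. (h (z t) \<bullet> b) *\<^sub>R Y b (\<gamma> t) c)
        + (\<Sum>b\<in>Bs. (snd (z t) \<bullet> b) *\<^sub>R frechet_derivative (Yc b) (at (fst (z t))) (vv (z t)))) (at t)"
      by (rule vector_derivative_frame_sum[OF 1 2])
    then have "((\<lambda>s. velocity A \<gamma> s c) has_vector_derivative
        (\<Sum>b\<in>Bs. (h (z t) \<bullet> b) *\<^sub>R Y b (\<gamma> t) c)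
        + (\<Sum>b\<in>Bs. (snd (z t) \<bullet> b) *\<^sub>R frechet_derivative (Yc b) (at (fst (z t))) (vv (z t)))) (at t)"
      by (rule has_vector_derivative_transform_within_open[OF _ I(1) t])
         (simp only: velc vv_def Yc_def \<gamma>_def)
    then show ?thesis
      using accel_has_vector_derivative[OF \<gamma> t c(1) q(2)[OF t]] vector_derivative_unique_at by blast
  qed
  show thesis
  proof (rule that[OF I(2)])
    show "admissible_curve A U I \<gamma>"
      using \<gamma> lift(2) by (simp add: admissible_curve_def)
    have "velocity A \<gamma> 0 = w"
      unfolding vel[OF I(2)] k0 using c a0 by (intro sum.cong) (auto simp: z(1) \<gamma>_def)
    then show "canonical_lift A \<gamma> 0 = (p, w)"
      using c by (simp add: \<gamma>_def z(1))
    show "compatible_curve A D I \<gamma>"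
      unfolding compatible_curve_def
    proof
      fix t assume t: "t \<in> I"
      show "velocity A \<gamma> t \<in> D (\<gamma> t)"
        unfolding vel[OF t] local_frameD(4)[OF fr(1) q(3)[OF t]] by (rule rangeI)
    qed
    fix t assume t: "t \<in> I"
    define R where "R = covariant_derivative A nabla \<gamma> (velocity A \<gamma>) t - F (canonical_lift A \<gamma> t)"
    have RT: "R \<in> tangent_space A (\<gamma> t)"
      unfolding R_def
    proof (intro subspace_diff subspace_tangent_space)
      show "covariant_derivative A nabla \<gamma> (velocity A \<gamma>) t \<in> tangent_space A (\<gamma> t)"
        by (rule covariant_derivative_in_tangent_space[OF nabla open_U \<gamma> t lift(2)[OF t]])
      show "F (canonical_lift A \<gamma> t) \<in> tangent_space A (\<gamma> t)"
        using F lift(2)[OF t] unfolding anisotropic_vfield_def by fastforce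
    qed
    have loc: "local_nabla A nabla (canonical_lift A \<gamma> t) (coord_field A c i) (coord_field A c j) c
        = nabla (bundle_point A c (\<beta> (z t))) (E i) (E j) c" if "i \<in> Basis" "j \<in> Basis" for i j
      unfolding lift(1)[OF t, symmetric]
      by (rule local_nabla_coord_fields[OF nabla open_U lift(2)[OF t] c(1) q(2)[OF t] E(1) q(4)[OF t] E(4,5) that])
    have Rc: "R c = (\<Sum>b\<in>Bs. (h (z t) \<bullet> b) *\<^sub>R Yc b (fst (z t))) + \<Xi> (z t)"
    proof -
      have "R c = covariant_derivative A nabla \<gamma> (velocity A \<gamma>) t c - F (canonical_lift A \<gamma> t) c"
        by (simp add: R_def)
      also have "\<dots> = accel \<gamma> t c + (\<Sum>i\<in>Basis. \<Sum>j\<in>Basis. ((vv (z t) \<bullet> i) * (vv (z t) \<bullet> j)) *\<^sub>R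
          nabla (bundle_point A c (\<beta> (z t))) (E i) (E j) c) - F (bundle_point A c (\<beta> (z t))) c"
        using loc by (simp add: covariant_derivative_velocity[OF \<gamma> t c(1) q(2)[OF t]] velc[OF t] lift(1)[OF t, symmetric])
      also have "\<dots> = (\<Sum>b\<in>Bs. (h (z t) \<bullet> b) *\<^sub>R Yc b (fst (z t))) + \<Xi> (z t)"
        unfolding acc[OF t] \<Xi>_def Yc_def \<gamma>_def by (simp add: algebra_simps)
      finally show ?thesis .
    qed
    have coords: "(snd c (\<gamma> t), velocity A \<gamma> t c) = \<beta> (z t)"
      by (simp add: \<beta>_def velc[OF t] q(5)[OF t])
    note lin = tensor_coords_bilinear(1)[OF c(1) \<beta>U[OF zI(2)[OF t]]]
    have RY: "tensor_coords A L c (\<beta> (z t)) (R c) (Yc b (fst (z t))) = 0" if "b \<in> Bs" for b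
    proof -
      have "tensor_coords A L c (\<beta> (z t)) (R c) (Yc b (fst (z t)))
        = (\<Sum>a\<in>Bs. (h (z t) \<bullet> a) * G (z t) a b) + tensor_coords A L c (\<beta> (z t)) (\<Xi> (z t)) (Yc b (fst (z t)))"
        unfolding Rc G_def by (simp add: linear_add[OF lin] linear_sum[OF lin] linear_cmul[OF lin])
      then show ?thesis
        using h(2)[OF zI(2)[OF t] that] by simp
    qed
    have "fundamental_tensor L (canonical_lift A \<gamma> t) R u = 0" if u: "u \<in> D (\<gamma> t)" for u
    proof -
      obtain k where k: "u = (\<Sum>b\<in>Bs. k b *\<^sub>R Y b (\<gamma> t))"
        using u unfolding local_frameD(4)[OF fr(1) q(3)[OF t]] by blast
      have "fundamental_tensor L (canonical_lift A \<gamma> t) R u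
          = (\<Sum>b\<in>Bs. k b * tensor_coords A L c (\<beta> (z t)) (R c) (Yc b (fst (z t))))"
        using fundamental_tensor_frame[OF lift(2)[OF t] c(1) q(2)[OF t] RT, of Bs "\<lambda>b. Y b (\<gamma> t)" k]
          local_frameD(6)[OF fr(1) q(3)[OF t]] unfolding coords k by (simp add: Yc_def \<gamma>_def)
      also have "\<dots> = 0" using RY by simp
      finally show ?thesis .
    qed
    then show "covariant_derivative A nabla \<gamma> (velocity A \<gamma>) t - F (canonical_lift A \<gamma> t)
       \<in> orth_complement A L D (canonical_lift A \<gamma> t)"
      using RT by (simp add: orth_complement_def R_def)
  qed
qed


text \<open>Linearity of \<open>fundamental_tensor\<close>, an iterated \<open>deriv\<close>, is
  read off from its coordinate form, which is valid for tangent arguments; hence the hypothesis on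
  \<open>D p\<close>.\<close>

lemma subspace_orth_complement:
  assumes v: "(p, w) \<in> U" and D: "D p \<subseteq> tangent_space A p"
  shows "subspace (orth_complement A L D (p, w))"
proof -
  obtain c where c: "c \<in> A" "p \<in> fst c" by (rule ex_chart)
  note lin = tensor_coords_bilinear(1)[OF c(1) coords_in[OF v c(2)]]
  have eq: "orth_complement A L D (p, w)
      = {x \<in> tangent_space A p. \<forall>u\<in>D p. tensor_coords A L c (snd c p, w c) (x c) (u c) = 0}"
    using D fundamental_tensor_coords[OF v c] by (auto simp: orth_complement_def subset_iff)
  show ?thesis
    unfolding eq subspace_def
    by (auto simp: subspace_0 subspace_add subspace_scale subspace_tangent_space scaleR_fun_apply
        linear_0[OF lin] linear_add[OF lin] linear_cmul[OF lin])
qed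

lemma orth_complement_Int:
  assumes "nondegenerate_subspace U L p (D p)" "(p, w) \<in> U" "w \<in> D p"
    and "x \<in> D p" "x \<in> orth_complement A L D (p, w)"
  shows "x = 0"
  using assms unfolding nondegenerate_subspace_def nondegenerate_on_def orth_complement_def by simp

text \<open>The difference lies in \<open>D p\<close> and in its orthogonal complement. The times
  \<open>t1\<close> and \<open>t2\<close> are independent of each other, so that a curve passing
  through a vector at some time can be compared with the curve that starts there.\<close>

lemma constrained_curves_agree:
  assumes nabla: "anisotropic_connection A U nabla" and D: "regular_distribution A D"
    and nondeg: "nondegenerate_subspace U L p (D p)"
    and v: "(p, w) \<in> U"
    and \<gamma>1: "smooth_curve A I1 \<gamma>1" "t1 \<in> I1" "compatible_curve A D I1 \<gamma>1" "canonical_lift A \<gamma>1 t1 = (p, w)"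
    and \<gamma>2: "smooth_curve A I2 \<gamma>2" "t2 \<in> I2" "compatible_curve A D I2 \<gamma>2" "canonical_lift A \<gamma>2 t2 = (p, w)"
    and o1: "covariant_derivative A nabla \<gamma>1 (velocity A \<gamma>1) t1 - f \<in> orth_complement A L D (p, w)"
    and o2: "covariant_derivative A nabla \<gamma>2 (velocity A \<gamma>2) t2 - f \<in> orth_complement A L D (p, w)"
  shows "covariant_derivative A nabla \<gamma>1 (velocity A \<gamma>1) t1 = covariant_derivative A nabla \<gamma>2 (velocity A \<gamma>2) t2"
    (is "?c1 = ?c2")
proof -
  have w: "w \<in> D p"
    using \<gamma>1 by (auto simp: compatible_curve_def)
  have DT: "D p \<subseteq> tangent_space A p"
    using D unfolding regular_distribution_def by blast
  have "?c1 - ?c2 \<in> D p"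
    by (rule compatible_covariant_derivative_diff[OF nabla open_U D \<gamma>1(1-3) \<gamma>2(1-3) \<gamma>1(4) \<gamma>2(4) v])
  moreover have "?c1 - ?c2 \<in> orth_complement A L D (p, w)"
    using subspace_diff[OF subspace_orth_complement[of p w D, OF v DT] o1 o2] by simp
  ultimately have "?c1 - ?c2 = 0"
    by (rule orth_complement_Int[of p D w, OF nondeg v w])
  then show ?thesis by simp
qed

end

theorem theorem4p16:
  fixes A :: "('m::{t2_space, second_countable_topology}, 'e::euclidean_space) chart set"
    and U :: "('m, 'e) tpoint set"
    and L :: "('m, 'e) tpoint \<Rightarrow> real"
    and nabla :: "('m, 'e) anconn"
    and F :: "('m, 'e) tpoint \<Rightarrow> ('m, 'e) tvec"
    and D :: "'m \<Rightarrow> ('m, 'e) tvec set"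
  assumes "smooth_manifold A"
    and "mechanical_system A U L F"
    and "chern_connection A U L nabla"
    and "regular_distribution A D"
    and "\<forall>p. nondegenerate_subspace U L p (D p)"
  shows "\<exists>!R. reaction_force A U nabla F D R \<and> dAlembert A U L D R"
proof -
  interpret finsler A U L
    by unfold_locales (use assms(1,2) in \<open>simp_all add: mechanical_system_def\<close>)
  have F: "anisotropic_vfield A U F" and nabla: "anisotropic_connection A U nabla"
    using assms(2,3) by (simp_all add: mechanical_system_def chern_connection_def)
  note D = assms(4)
  have nondeg: "nondegenerate_subspace U L p (D p)" for p
    using assms(5) by blast
  define S where "S = U \<inter> Sigma UNIV D"
  let ?cov = "\<lambda>\<gamma>. covariant_derivative A nabla \<gamma> (velocity A \<gamma>)"
  \<comment> \<open>The lifts are required to stay in \<open>S\<close>, so that each of them is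
    again an argument at which the reaction force is to be evaluated.\<close>
  define sol where "sol v I \<gamma> \<longleftrightarrow> 0 \<in> I \<and> smooth_curve A I \<gamma> \<and> (\<forall>t\<in>I. canonical_lift A \<gamma> t \<in> S) \<and>
    compatible_curve A D I \<gamma> \<and> canonical_lift A \<gamma> 0 = v \<and>
    (\<forall>t\<in>I. ?cov \<gamma> t - F (canonical_lift A \<gamma> t) \<in> orth_complement A L D (canonical_lift A \<gamma> t))" for v I \<gamma>
  have liftS: "canonical_lift A \<gamma> t \<in> S" if "admissible_curve A U I \<gamma>" "compatible_curve A D I \<gamma>" "t \<in> I" for \<gamma> I t
    using that by (simp add: admissible_curve_def compatible_curve_def S_def)
  have "\<exists>I \<gamma>. sol v I \<gamma>" if v: "v \<in> S" for v
  proof -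
    obtain p w where pw: "v = (p, w)" "(p, w) \<in> U" "w \<in> D p"
      using v by (cases v) (auto simp: S_def)
    show ?thesis
    proof (rule ex_constrained_curve[OF nabla F D nondeg pw(2,3)])
      fix I \<gamma>
      assume "0 \<in> I" "admissible_curve A U I \<gamma>" "canonical_lift A \<gamma> 0 = (p, w)" "compatible_curve A D I \<gamma>"
        "\<And>t. t \<in> I \<Longrightarrow> ?cov \<gamma> t - F (canonical_lift A \<gamma> t) \<in> orth_complement A L D (canonical_lift A \<gamma> t)"
      then have "sol v I \<gamma>"
        unfolding sol_def pw(1) using liftS by (simp add: admissible_curve_def)
      then show ?thesis by blast
    qed
  qed
  then obtain I \<gamma> where sol: "\<And>v. v \<in> S \<Longrightarrow> sol v (I v) (\<gamma> v)"
    by metis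
  note sol' = sol[unfolded sol_def]
  have agree: "?cov \<gamma>1 t1 = ?cov \<gamma>2 t2"
    if "smooth_curve A I1 \<gamma>1" "t1 \<in> I1" "compatible_curve A D I1 \<gamma>1" "canonical_lift A \<gamma>1 t1 = v"
      "smooth_curve A I2 \<gamma>2" "t2 \<in> I2" "compatible_curve A D I2 \<gamma>2" "canonical_lift A \<gamma>2 t2 = v" "v \<in> S"
      "?cov \<gamma>1 t1 - F v \<in> orth_complement A L D v" "?cov \<gamma>2 t2 - F v \<in> orth_complement A L D v"
    for I1 \<gamma>1 t1 I2 \<gamma>2 t2 v
    using constrained_curves_agree[OF nabla D nondeg, of "fst v" "snd v" I1 \<gamma>1 t1 I2 \<gamma>2 t2 "F v"] that
    by (simp add: S_def)
  \<comment> \<open>The initial acceleration of the chosen curve dictates the value at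
    \<open>v\<close>. Off \<open>S\<close> the restriction takes the default value demanded of
    extensional functions.\<close>
  define R where "R = restrict (\<lambda>v. ?cov (\<gamma> v) 0 - F v) S"
  have R: "R v \<in> orth_complement A L D v" if "v \<in> S" for v
    using sol'[OF that] that unfolding R_def by auto
  have Rcov: "?cov (\<gamma> v) t = F (canonical_lift A (\<gamma> v) t) + R (canonical_lift A (\<gamma> v) t)"
    if v: "v \<in> S" and t: "t \<in> I v" for v t
  proof -
    \<comment> \<open>The value of \<open>R\<close> at a later lift \<open>u\<close> comes from the
      curve chosen for \<open>u\<close>, not from the one chosen for \<open>v\<close>; both have
      velocity \<open>u\<close> at the respective times, so their accelerations agree.\<close>
    define u where "u = canonical_lift A (\<gamma> v) t"
    have u: "u \<in> S" using sol'[OF v] t by (simp add: u_def)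
    have "?cov (\<gamma> v) t = ?cov (\<gamma> u) 0"
      by (rule agree[of "I v" _ _ u "I u"]) (use sol'[OF v] sol'[OF u] t u in \<open>auto simp: u_def\<close>)
    then show ?thesis
      using u unfolding R_def u_def by simp
  qed
  show ?thesis
  proof (rule ex1I[of _ R], intro conjI)
    show "reaction_force A U nabla F D R"
      unfolding reaction_force_def S_def[symmetric]
    proof (intro conjI ballI)
      show "R \<in> (\<Pi>\<^sub>E v\<in>S. tangent_space A (fst v))"
        using R by (auto simp: PiE_iff R_def orth_complement_def)
      fix v assume v: "v \<in> S"
      then show "\<exists>I \<gamma>. 0 \<in> I \<and> admissible_curve A U I \<gamma> \<and> canonical_lift A \<gamma> 0 = v \<and> compatible_curve A D I \<gamma> \<and>
          (\<forall>t\<in>I. ?cov \<gamma> t = F (canonical_lift A \<gamma> t) + R (canonical_lift A \<gamma> t))"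
        using sol'[OF v] Rcov[OF v] by (intro exI[of _ "I v"] exI[of _ "\<gamma> v"]) (simp add: admissible_curve_def S_def)
    qed
    show "dAlembert A U L D R"
      unfolding dAlembert_def S_def[symmetric] using R by blast
  next
    fix R' assume R': "reaction_force A U nabla F D R' \<and> dAlembert A U L D R'"
    have ext: "R' \<in> (\<Pi>\<^sub>E v\<in>S. tangent_space A (fst v))"
      using R' by (simp add: reaction_force_def S_def)
    show "R' = R"
    proof (rule extensionalityI[of _ S])
      show "R' \<in> extensional S" "R \<in> extensional S"
        using ext by (auto simp: PiE_def R_def)
      fix v assume v: "v \<in> S"
      obtain J \<delta> where \<delta>: "0 \<in> J" "admissible_curve A U J \<delta>" "canonical_lift A \<delta> 0 = v" "compatible_curve A D J \<delta>"
        "\<forall>t\<in>J. ?cov \<delta> t = F (canonical_lift A \<delta> t) + R' (canonical_lift A \<delta> t)"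
        using conjunct2[OF conjunct1[OF R', unfolded reaction_force_def S_def[symmetric]], THEN bspec, OF v] by blast
      have cov: "?cov \<delta> 0 = F v + R' v"
        using bspec[OF \<delta>(5,1)] unfolding \<delta>(3) .
      \<comment> \<open>By \<open>cov\<close> this vector is the acceleration of
        \<open>\<delta>\<close> minus the force, so the d'Alembert principle for \<open>R'\<close>
        is exactly what allows \<open>\<delta>\<close> to be compared with the chosen curve.\<close>
      have "R' v \<in> orth_complement A L D v"
        using R' v by (simp add: dAlembert_def S_def)
      then have "?cov \<delta> 0 = ?cov (\<gamma> v) 0"
        by (intro agree[of J _ _ v "I v"])
           (use sol'[OF v] \<delta>(1-4) v cov in \<open>auto simp: admissible_curve_def\<close>)
      then show "R' v = R v"
        using v cov by (simp add: R_def eq_diff_eq add.commute)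
    qed
  qed
qed

end
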